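(* Let $(Q(t))_{t\ge 0}$ be a regular HA-semigroup on $D$ with exponent $\psi$, and let $(\gamma(t))_{t\ge 0}$ be a stochastically continuous SC-semigroup associated with $(Q(t))_{t\ge 0}$, with characteristic function $$\int_D \exp\{\langle u,\xi\rangle\}\,\gamma(t,d\xi)=\exp\{\phi(t,u)\},\qquad t\ge 0,\ u\in U,$$ $$\phi(t,u)=b_1(t)u_1+b_2(t)u_2+a(t)u_2^2+\int_D\big(e^{\langle u,\xi\rangle}-1-u_2\chi(\xi_2)\big)\,m(t,d\xi),$$ where $a(t)\in\mathbb{R}_+$, $(b_1(t),b_2(t))\in D$ and $m(t,d\xi)$ is a $\sigma$-finite measure on $D$ supported by $D\setminus\{0\}$ with $\int_D[\chi(\xi_1)+\chi^2(\xi_2)]\,m(t,d\xi)<\infty$. Then $(\gamma(t))_{t\ge 0}$ is regular if and only if the function $t\mapsto b_2(t)$ is absolutely continuous on $[0,\infty)$.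
   Context: $\mathbb{R}_+=[0,\infty)$, $D=\mathbb{R}_+\times\mathbb{R}$, $U=\mathbb{C}_-\times(i\mathbb{R})$, where $\mathbb{C}_-=\{a+ib: a\le 0,\ b\in\mathbb{R}\}$ and $i\mathbb{R}=\{ib:b\in\mathbb{R}\}$; $\langle u,\xi\rangle=u_1\xi_1+u_2\xi_2$ (bilinear). $\chi(x)=x$ for $x\in[-1,1]$, $\chi(x)=1$ for $x>1$, $\chi(x)=-1$ for $x<-1$. HA-semigroup: a transition semigroup $(Q(t))_{t\ge0}$ with state space $D$ such that for each $t\ge0$ there is a continuous two-dimensional complex-valued function $\psi(t,\cdot)=(\psi_1(t,\cdot),\psi_2(t,\cdot))$ on $U$ with $\int_D \exp\{\langle u,\xi\rangle\}Q(t,x,d\xi)=\exp\{\langle x,\psi(t,u)\rangle\}$ for all $x\in D$, $u\in U$. It is stochastically continuous if $t\mapsto Q(t,x,\cdot)$ is weakly continuous on $[0,\infty)$ for each $x\in D$. It is regular if it is stochastically continuous and the derivative $\psi'_t(0,u)$ exists for all $u\in U$ and is continuous at $u=0$. (One always has $\psi(t,u)\in U$.) SC-semigroup associated with $(Q(t))_{t\ge0}$: a family of probability measures $(\gamma(t))_{t\ge0}$ on $D$ with $\gamma(r+t)=(\gamma(r)Q(t))*\gamma(t)$ for all $r,t\ge0$, where $*$ is convolution and $\gamma(r)Q(t)(B)=\int_D Q(t,\xi,B)\gamma(r,d\xi)$. It is stochastically continuous if $t\mapsto\gamma(t)$ is weakly continuous on $[0,\infty)$. Each $\gamma(t)$ of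 a stochastically continuous SC-semigroup is infinitely divisible and has characteristic function of the form displayed in the claim. The SC-semigroup $(\gamma(t))_{t\ge0}$ is regular if $\phi(t,u)=\log\hat\gamma(t,u)$ has the representation $\phi(t,u)=\int_0^t F(\psi(s,u))\,ds$ for $t\ge0$, $u\in U$, where $F=\log\hat\nu$ for some infinitely divisible probability measure $\nu$ on $D$. Here $\hat\nu(u)=\int_D e^{\langle u,\xi\rangle}\nu(d\xi)$, $u\in U$, and the logarithm is the continuous one vanishing at $u=0$. Absolute continuity on $[0,\infty)$ means absolute continuity on every bounded interval. *)

theory Defs
  imports "HOL-Probability.Probability"
begin

definition D :: "(real \<times> real) set" where
  "D = {0..} \<times> UNIV"

definition U :: "(complex \<times> complex) set" where
  "U = {u. Re (fst u) \<le> 0 \<and> Re (snd u) = 0}"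

abbreviation borel_D :: "(real \<times> real) measure" where
  "borel_D \<equiv> restrict_space borel D"

(* The pairing is complex-bilinear, with no conjugation; it serves for both
   \<langle>u, \<xi>\<rangle> and \<langle>x, \<psi>(t, u)\<rangle>, the complex vector always being the first argument. *)
definition pairing :: "complex \<times> complex \<Rightarrow> real \<times> real \<Rightarrow> complex" where
  "pairing u x = fst u * of_real (fst x) + snd u * of_real (snd x)"

definition trunc :: "real \<Rightarrow> real" where
  "trunc x = (if x > 1 then 1 else if x < -1 then -1 else x)"

definition char_fun :: "(real \<times> real) measure \<Rightarrow> complex \<times> complex \<Rightarrow> complex" where
  "char_fun \<mu> u = (LINT \<xi>|\<mu>. exp (pairing u \<xi>))"

(* g is (on U) the logarithm of the characteristic function that is continuous
   and vanishes at 0; as U is connected, these properties determine g on U. *)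
definition is_log_char_fun ::
    "(real \<times> real) measure \<Rightarrow> (complex \<times> complex \<Rightarrow> complex) \<Rightarrow> bool" where
  "is_log_char_fun \<mu> g \<longleftrightarrow>
     continuous_on U g \<and> g 0 = 0 \<and> (\<forall>u\<in>U. exp (g u) = char_fun \<mu> u)"

(* The library convolution lives on the whole plane; the result is concentrated
   on D because D is closed under addition. *)
definition conv_D ::
    "(real \<times> real) measure \<Rightarrow> (real \<times> real) measure \<Rightarrow> (real \<times> real) measure" where
  "conv_D \<mu> \<nu> = restrict_space (\<mu> \<star> \<nu>) D"

primrec conv_power :: "(real \<times> real) measure \<Rightarrow> nat \<Rightarrow> (real \<times> real) measure" where
  "conv_power \<mu> 0 = return borel_D 0"
| "conv_power \<mu> (Suc n) = conv_D \<mu> (conv_power \<mu> n)"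

definition infinitely_divisible :: "(real \<times> real) measure \<Rightarrow> bool" where
  "infinitely_divisible \<nu> \<longleftrightarrow>
     \<nu> \<in> space (prob_algebra borel_D) \<and>
     (\<forall>n\<ge>1. \<exists>\<mu>\<in>space (prob_algebra borel_D). conv_power \<mu> n = \<nu>)"

definition weakly_continuous :: "(real \<Rightarrow> (real \<times> real) measure) \<Rightarrow> bool" where
  "weakly_continuous \<mu> \<longleftrightarrow>
     (\<forall>f :: real \<times> real \<Rightarrow> real. continuous_on D f \<and> bounded (f ` D) \<longrightarrow>
        continuous_on {0..} (\<lambda>t. LINT x|\<mu> t. f x))"

definition transition_semigroup ::
    "(real \<Rightarrow> real \<times> real \<Rightarrow> (real \<times> real) measure) \<Rightarrow> bool" where
  "transition_semigroup Q \<longleftrightarrow>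
     (\<forall>t\<ge>0. Q t \<in> borel_D \<rightarrow>\<^sub>M prob_algebra borel_D) \<and>
     (\<forall>x\<in>D. Q 0 x = return borel_D x) \<and>
     (\<forall>s\<ge>0. \<forall>t\<ge>0. \<forall>x\<in>D. Q (s + t) x = Q s x \<bind> Q t)"

definition HA_semigroup ::
    "(real \<Rightarrow> real \<times> real \<Rightarrow> (real \<times> real) measure) \<Rightarrow>
     (real \<Rightarrow> complex \<times> complex \<Rightarrow> complex \<times> complex) \<Rightarrow> bool" where
  "HA_semigroup Q \<psi> \<longleftrightarrow>
     transition_semigroup Q \<and>
     (\<forall>t\<ge>0. continuous_on U (\<psi> t) \<and>
        (\<forall>x\<in>D. \<forall>u\<in>U. char_fun (Q t x) u = exp (pairing (\<psi> t u) x)))"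

definition regular_HA_semigroup ::
    "(real \<Rightarrow> real \<times> real \<Rightarrow> (real \<times> real) measure) \<Rightarrow>
     (real \<Rightarrow> complex \<times> complex \<Rightarrow> complex \<times> complex) \<Rightarrow> bool" where
  "regular_HA_semigroup Q \<psi> \<longleftrightarrow>
     HA_semigroup Q \<psi> \<and>
     (\<forall>x\<in>D. weakly_continuous (\<lambda>t. Q t x)) \<and>
     (\<exists>\<psi>'. (\<forall>u\<in>U. ((\<lambda>t. \<psi> t u) has_vector_derivative \<psi>' u) (at 0 within {0..})) \<and>
            continuous (at 0 within U) \<psi>')"

definition SC_semigroup ::
    "(real \<Rightarrow> real \<times> real \<Rightarrow> (real \<times> real) measure) \<Rightarrow>
     (real \<Rightarrow> (real \<times> real) measure) \<Rightarrow> bool" where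
  "SC_semigroup Q \<gamma> \<longleftrightarrow>
     (\<forall>t\<ge>0. \<gamma> t \<in> space (prob_algebra borel_D)) \<and>
     (\<forall>r\<ge>0. \<forall>t\<ge>0. \<gamma> (r + t) = conv_D (\<gamma> r \<bind> Q t) (\<gamma> t))"

definition regular_SC_semigroup ::
    "(real \<Rightarrow> complex \<times> complex \<Rightarrow> complex \<times> complex) \<Rightarrow>
     (real \<Rightarrow> (real \<times> real) measure) \<Rightarrow> bool" where
  "regular_SC_semigroup \<psi> \<gamma> \<longleftrightarrow>
     (\<exists>\<nu> F \<phi>. infinitely_divisible \<nu> \<and> is_log_char_fun \<nu> F \<and>
        (\<forall>t\<ge>0. is_log_char_fun (\<gamma> t) (\<phi> t) \<and>
           (\<forall>u\<in>U. ((\<lambda>s. F (\<psi> s u)) has_integral \<phi> t u) {0..t})))"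

(* d ranges over the finite families of non-overlapping compact subintervals of {a..b}. *)
definition abs_continuous_on_interval :: "real \<Rightarrow> real \<Rightarrow> (real \<Rightarrow> real) \<Rightarrow> bool" where
  "abs_continuous_on_interval a b f \<longleftrightarrow>
     (\<forall>\<epsilon>>0. \<exists>\<delta>>0. \<forall>d. d division_of \<Union>d \<and> \<Union>d \<subseteq> {a..b} \<and> (\<Sum>K\<in>d. Sup K - Inf K) < \<delta> \<longrightarrow>
        (\<Sum>K\<in>d. \<bar>f (Sup K) - f (Inf K)\<bar>) < \<epsilon>)"

definition abs_continuous_on_halfline :: "(real \<Rightarrow> real) \<Rightarrow> bool" where
  "abs_continuous_on_halfline f \<longleftrightarrow> (\<forall>T\<ge>0. abs_continuous_on_interval 0 T f)"

end

(* The function phi satisfies phi (t + r) u = phi r (psi t u) + phi t u, and psi_2 t u = z t * u_2 because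
   Q t (0, 1) and Q t (0, -1) are convolution inverses. For small times psi t is close to the identity, so
   the increments of phi over a time span r are comparable with phi r itself; summing T / r of them shows
   that phi r is of order r. This is carried out first for the first coordinate and the jumps, then for the
   real part on the second axis averaged over frequencies, and finally for the drift b_2. Hence the
   functions phi r / r are equicontinuous, and they converge, as r tends to 0, to a continuous F with
   d/dt phi t u = F (psi t u). The law nu with exponent F and its convolution roots are limits of
   convolution powers of gamma (1 / (n k)).

   The triplets increase with t, since the increments of phi are limits of sums of char_fun kappa - 1 with
   probability measures kappa. Subtracting from b_2 the imaginary part of phi t (0, i) leaves the integral
   of trunc - sin against m t, whose increments are thereby controlled by those of phi. So both sides of the
   equivalence always hold. *)

theory Submission
  imports Defs
begin

text \<open>At the outset \<open>\<phi> r\<close> is only known to tend to 0 with \<open>r\<close>,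
  without a rate, and an increment is \<open>\<phi> r (\<psi> t u)\<close>, not
  \<open>\<phi> r u\<close>. A rate can be read off only from quantities that keep their size, up to
  a constant, when the flow moves the frequency. The real part at a single frequency is not of this
  kind, since 1 - cos vanishes at the multiples of 2 pi; its average is comparable with a Gaussian
  term plus the integral of min 1 ((\<epsilon> y)^2), which a dilation by a factor between 1/2 and 2
  changes only boundedly. The order of the estimates is forced: the flow gives (0, i y) a nonzero
  first coordinate, so the first axis must be settled before the second, and sin -
  \<open>trunc\<close> is controlled through min 1 (y^2), so the real part must be settled before
  the drift. For \<open>b2\<close> the difficulty is that \<open>trunc\<close> - sin changes sign,
  so its integral is not monotone in the jump measure. Factoring it into a bounded continuous
  function times an averaged 1 - cos leaves positive finite measures, whose increments are
  controlled by their total mass.\<close>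

section \<open>Elementary estimates\<close>

text \<open>On the closed left half-plane, which is convex, the derivative of \<open>exp\<close> has
  modulus at most 1.\<close>

lemma norm_exp_diff_le:
  fixes p q :: complex
  assumes "Re p \<le> 0" "Re q \<le> 0"
  shows "norm (exp p - exp q) \<le> norm (p - q)"
proof -
  have "convex {z. Re z \<le> 0}"
    by (rule convex_halfspace_Re_le)
  then have "norm (exp p - exp q) \<le> 1 * norm (p - q)"
    by (rule field_differentiable_bound[where f' = exp])
       (use assms in \<open>auto intro!: derivative_eq_intros\<close>)
  then show ?thesis by simp
qed

text \<open>Real and imaginary parts of the Taylor remainders of exp (i x) of orders 1, 2 and 4. The
  fifth-power remainder is what the lower bound of \<open>wt\<close> needs.\<close>

lemma iexp_bounds:
  fixes x :: real
  shows "\<bar>1 - cos x\<bar> \<le> x\<^sup>2 / 2" "\<bar>sin x - x\<bar> \<le> \<bar>x\<bar> ^ 3 / 6"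
    "\<bar>sin x - x + x ^ 3 / 6\<bar> \<le> \<bar>x\<bar> ^ 5 / 120"
    "norm (exp (\<i> * of_real x) - 1 - \<i> * of_real x) \<le> x\<^sup>2 / 2"
proof -
  have 1: "norm (exp (\<i> * of_real x) - 1 - \<i> * of_real x) \<le> x\<^sup>2 / 2"
    using iexp_approx1[of x 1] by (simp add: algebra_simps numeral_2_eq_2)
  then show "norm (exp (\<i> * of_real x) - 1 - \<i> * of_real x) \<le> x\<^sup>2 / 2" .
  have "\<bar>Re (exp (\<i> * of_real x) - 1 - \<i> * of_real x)\<bar> \<le> x\<^sup>2 / 2"
    using abs_Re_le_cmod 1 by (rule order_trans)
  then show "\<bar>1 - cos x\<bar> \<le> x\<^sup>2 / 2"
    by (simp add: Re_exp abs_minus_commute)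
  have 2: "norm (exp (\<i> * of_real x) - (1 + \<i> * of_real x - (of_real x)\<^sup>2 / 2)) \<le> \<bar>x\<bar> ^ 3 / 6"
    using iexp_approx1[of x 2] by (simp add: eval_nat_numeral fact_numeral power_mult_distrib algebra_simps)
  have "\<bar>Im (exp (\<i> * of_real x) - (1 + \<i> * of_real x - (of_real x)\<^sup>2 / 2))\<bar> \<le> \<bar>x\<bar> ^ 3 / 6"
    using abs_Im_le_cmod 2 by (rule order_trans)
  then show "\<bar>sin x - x\<bar> \<le> \<bar>x\<bar> ^ 3 / 6"
    by (simp add: Im_exp)
  have "norm (exp (\<i> * of_real x) - (\<Sum>k\<le>4. (\<i> * of_real x) ^ k / fact k)) \<le> \<bar>x\<bar> ^ 5 / 120"
    using iexp_approx1[of x 4] by (simp add: fact_numeral eval_nat_numeral)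
  then have "\<bar>Im (exp (\<i> * of_real x) - (\<Sum>k\<le>4. (\<i> * of_real x) ^ k / fact k))\<bar> \<le> \<bar>x\<bar> ^ 5 / 120"
    using abs_Im_le_cmod by (rule order_trans[rotated])
  moreover have "Im (exp (\<i> * of_real x) - (\<Sum>k\<le>4. (\<i> * of_real x) ^ k / fact k)) = sin x - x + x ^ 3 / 6"
    by (simp add: Im_exp eval_nat_numeral fact_numeral field_simps)
  ultimately show "\<bar>sin x - x + x ^ 3 / 6\<bar> \<le> \<bar>x\<bar> ^ 5 / 120"
    by simp
qed

text \<open>The square expands to |w|^2 - 2 Re w + 1. It bounds squares of
  \<open>exp (pairing u \<xi>) - 1\<close> by twice the jump integrand of
  \<open>nrm\<close>.\<close>

lemma norm_minus_one_sq_le: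
  fixes w :: complex
  assumes "norm w \<le> 1"
  shows "(norm (w - 1))\<^sup>2 \<le> 2 * (1 - Re w)"
proof -
  have "(norm w)\<^sup>2 \<le> 1"
    using assms by (simp add: power_le_one)
  moreover have "(norm (w - 1))\<^sup>2 = (norm w)\<^sup>2 - 2 * Re w + 1"
    unfolding cmod_power2 by (simp add: power2_eq_square algebra_simps)
  ultimately show ?thesis by simp
qed

text \<open>On [0, 1] one has exp (-y) \<le> 1 / (1 + y) \<le> 1 - y / 2; beyond 1 monotonicity
  reduces to the endpoint.\<close>

lemma one_minus_exp_ge:
  fixes x :: real
  assumes "x \<ge> 0"
  shows "min 1 x / 2 \<le> 1 - exp (- x)"
proof -
  have 1: "exp (- y) \<le> 1 - y / 2" if "0 \<le> y" "y \<le> 1" for y :: real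
  proof -
    have "1 + y \<le> exp y" by (rule exp_ge_add_one_self)
    then have "exp (- y) \<le> 1 / (1 + y)"
      using that by (simp add: exp_minus field_simps)
    also have "\<dots> \<le> 1 - y / 2"
      using that mult_right_mono[of y 1 y] by (simp add: field_simps)
    finally show ?thesis .
  qed
  show ?thesis
  proof (cases "x \<le> 1")
    case True then show ?thesis using 1[of x] assms by simp
  next
    case False
    then have "exp (- x) \<le> exp (- 1)" by simp
    then show ?thesis using 1[of 1] False by linarith
  qed
qed

lemma trunc_nonneg: "x \<ge> 0 \<Longrightarrow> trunc x = min 1 x"
  by (simp add: trunc_def)

lemma trunc_sq: "(trunc x)\<^sup>2 = min 1 (x\<^sup>2)"
proof -
  have "\<bar>x\<bar> \<le> 1 \<longleftrightarrow> x\<^sup>2 \<le> 1" by (simp add: abs_square_le_1)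
  then show ?thesis by (auto simp: trunc_def min_def abs_le_iff)
qed

lemma abs_trunc_le: "\<bar>trunc x\<bar> \<le> 1" "\<bar>trunc x\<bar> \<le> \<bar>x\<bar>"
  by (auto simp: trunc_def)

lemma trunc_id: "\<bar>x\<bar> \<le> 1 \<Longrightarrow> trunc x = x"
  by (auto simp: trunc_def)

lemma continuous_on_trunc [continuous_intros]:
  fixes f :: "'a::topological_space \<Rightarrow> real"
  assumes "continuous_on S f"
  shows "continuous_on S (\<lambda>x. trunc (f x))"
proof -
  have "trunc y = max (-1) (min 1 y)" for y by (auto simp: trunc_def)
  then show ?thesis using assms by (auto intro!: continuous_intros)
qed

lemma borel_measurable_trunc [measurable]: "trunc \<in> borel_measurable borel"
  by (rule borel_measurable_continuous_onI) (intro continuous_intros)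

text \<open>A single \<open>x\<close> determines \<open>a - b\<close> only modulo a lattice of
  imaginary numbers. For \<open>x\<close> so small that x |a - b| < 1, the principal logarithm
  inverts \<open>exp\<close>.\<close>

lemma eq_of_exp_scale_eq:
  fixes a b :: complex
  assumes "\<And>x. x > 0 \<Longrightarrow> exp (of_real x * a) = exp (of_real x * b)"
  shows "a = b"
proof -
  define x where "x = 1 / (1 + norm (a - b))"
  have x: "x > 0" "x * norm (a - b) < 1"
    by (auto simp: x_def field_simps add_nonneg_pos add_pos_nonneg)
  define w where "w = of_real x * (a - b)"
  have "exp w = 1"
    using assms[OF x(1)] by (simp add: w_def right_diff_distrib exp_diff)
  have nw: "norm w < 1"
    using x by (simp add: w_def norm_mult)
  have "\<bar>Im w\<bar> < pi"
    using abs_Im_le_cmod[of w] nw pi_gt3 by linarith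
  then have "Ln (exp w) = w"
    by (intro Ln_exp) auto
  then have "w = 0"
    using \<open>exp w = 1\<close> by simp
  then show ?thesis using x by (simp add: w_def)
qed

text \<open>Averaging \<open>1 - cos (s * x)\<close> over \<open>s\<close> makes it bounded away from zero for large \<open>x\<close>.\<close>

abbreviation unit_unif :: "real measure" where
  "unit_unif \<equiv> restrict_space lborel {0..1}"

definition wt :: "real \<Rightarrow> real" where
  "wt x = (LINT s|unit_unif. 1 - cos (s * x))"

lemma prob_space_unit_unif: "prob_space unit_unif"
  by (rule prob_spaceI) (simp add: emeasure_restrict_space space_restrict_space)

interpretation unit_unif: prob_space unit_unif
  by (rule prob_space_unit_unif)

lemma integrable_unit_unif:
  fixes f :: "real \<Rightarrow> 'a::{banach, second_countable_topology}"
  assumes "continuous_on {0..1} f"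
  shows "integrable unit_unif f"
proof -
  have "set_integrable lborel {0..1} f"
    using assms by (rule borel_integrable_atLeastAtMost')
  then show ?thesis
    by (simp add: integrable_restrict_space set_integrable_def)
qed

lemma integrable_unit_unif_cos: "integrable unit_unif (\<lambda>s. 1 - cos (s * x))"
  by (rule integrable_unit_unif) (auto intro!: continuous_intros)

lemma wt_nonzero:
  assumes "x \<noteq> 0"
  shows "wt x = 1 - sin x / x"
proof -
  have "wt x = (LINT s:{0..1}|lborel. 1 - cos (s * x))"
    by (simp add: wt_def integral_restrict_space set_lebesgue_integral_def)
  also have "\<dots> = integral {0..1} (\<lambda>s. 1 - cos (s * x))"
    by (rule set_borel_integral_eq_integral) (auto intro!: borel_integrable_atLeastAtMost' continuous_intros)
  also have "\<dots> = (1 - sin (1 * x) / x) - (0 - sin (0 * x) / x)"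
    by (rule integral_unique, rule fundamental_theorem_of_calculus)
       (use assms in \<open>auto intro!: derivative_eq_intros simp flip: has_real_derivative_iff_has_vector_derivative\<close>)
  finally show ?thesis by simp
qed

lemma wt_zero [simp]: "wt 0 = 0"
  by (simp add: wt_def)

lemma wt_minus [simp]: "wt (- x) = wt x"
  by (simp add: wt_def)

text \<open>Up to 2 the Taylor polynomial of degree 5 gives the factor 1/6 - 4/120 = 2/15, which
  exceeds 1/10; beyond 2 the quotient sin x / x is at most 1/2.\<close>

lemma wt_lower: "min 1 (x\<^sup>2) / 10 \<le> wt x"
proof -
  have pos: "min 1 (x\<^sup>2) / 10 \<le> wt x" if "x > 0" for x
  proof (cases "x \<le> 2")
    case True
    have "sin x \<le> x - x ^ 3 / 6 + x ^ 5 / 120"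
      using abs_le_D1[OF iexp_bounds(3)[of x]] that by (simp add: abs_of_pos del: abs_le_iff) 
    then have "sin x / x \<le> (x - x ^ 3 / 6 + x ^ 5 / 120) / x"
      using that by (intro divide_right_mono) auto
    also have "\<dots> = 1 - x\<^sup>2 / 6 + x\<^sup>2 * x\<^sup>2 / 120"
      using that by (simp add: field_simps eval_nat_numeral)
    also have "\<dots> \<le> 1 - x\<^sup>2 / 6 + x\<^sup>2 * 4 / 120"
    proof -
      have "x\<^sup>2 \<le> 2\<^sup>2" using True that by (intro power_mono) auto
      then show ?thesis by (intro add_left_mono divide_right_mono mult_left_mono) auto
    qed
    finally have "wt x \<ge> x\<^sup>2 * (2 / 15)"
      using wt_nonzero[of x] that by simp
    moreover have "x\<^sup>2 * (2 / 15) \<ge> x\<^sup>2 / 10" by simp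
    ultimately show ?thesis by linarith
  next
    case False
    have "sin x / x \<le> 1 / x" using that by (intro divide_right_mono) auto
    also have "\<dots> \<le> 1 / 2" using False by (simp add: field_simps)
    finally show ?thesis using wt_nonzero[of x] that by linarith
  qed
  consider "x = 0" | "x > 0" | "- x > 0" by linarith
  then show ?thesis using pos[of x] pos[of "-x"] by cases auto
qed

lemma wt_upper: "wt x \<le> 2 * min 1 (x\<^sup>2)"
proof -
  have "wt x \<le> (LINT s|unit_unif. 2 * min 1 (x\<^sup>2))"
    unfolding wt_def
  proof (rule integral_mono[OF integrable_unit_unif_cos])
    fix s assume "s \<in> space unit_unif"
    then have s: "0 \<le> s" "s \<le> 1" by (auto simp: space_restrict_space)
    have "1 - cos (s * x) \<le> (s * x)\<^sup>2 / 2"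
      using iexp_bounds(1)[of "s * x"] by linarith
    also have "\<dots> \<le> x\<^sup>2 / 2"
      using s by (simp add: power_mult_distrib mult_left_le_one_le power_le_one)
    finally have "1 - cos (s * x) \<le> 2 * x\<^sup>2"
      using zero_le_power2[of x] by linarith
    moreover have "1 - cos (s * x) \<le> 2" using cos_ge_minus_one[of "s * x"] by linarith
    ultimately show "1 - cos (s * x) \<le> 2 * min 1 (x\<^sup>2)" by (simp add: min_def)
  qed auto
  then show ?thesis using unit_unif.prob_space by simp
qed

lemma wt_nonneg: "0 \<le> wt x"
  using wt_lower[of x] by (smt (verit) divide_nonneg_pos min_def zero_le_power2)

lemma borel_measurable_wt [measurable]: "wt \<in> borel_measurable borel"
proof -
  have "wt = (\<lambda>x. if x = 0 then 0 else 1 - sin x / x)"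
    using wt_nonzero by auto
  also have "\<dots> \<in> borel_measurable borel" by measurable
  finally show ?thesis .
qed

lemma isCont_wt:
  assumes "x \<noteq> 0" shows "isCont wt x"
proof -
  have "\<forall>\<^sub>F y in nhds x. y \<noteq> 0"
    using assms by (rule t1_space_nhds)
  then have "\<forall>\<^sub>F y in nhds x. wt y = 1 - sin y / y"
    by eventually_elim (rule wt_nonzero)
  then have "isCont wt x \<longleftrightarrow> isCont (\<lambda>y. 1 - sin y / y) x"
    by (rule isCont_cong)
  then show ?thesis using assms by simp
qed

text \<open>Convergence of \<open>exp (x * f)\<close> for each single \<open>x > 0\<close> does not bound the winding of \<open>f\<close>;
  integrating over \<open>x\<close> does, since \<open>f = (exp (d * f) - 1) / \<integral>\<^sub>0\<^sup>d exp (x * f) dx\<close>.\<close>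

lemma continuous_on_of_exp_scale:
  fixes f :: "'a::metric_space \<Rightarrow> complex"
  assumes re: "\<And>p. p \<in> S \<Longrightarrow> Re (f p) \<le> 0"
    and cont: "\<And>x. x > 0 \<Longrightarrow> continuous_on S (\<lambda>p. exp (of_real x * f p))"
  shows "continuous_on S f"
proof (rule continuous_on_sequentiallyI)
  fix u p assume u: "\<forall>n. u n \<in> S" and p: "p \<in> S" and lim: "u \<longlonglongrightarrow> p"
  \<comment> \<open>On \<open>{0..d}\<close> this length keeps exp (x f p) at distance less than 1
    from 1, so the integrand of \<open>J (f p)\<close> has positive real part and one may divide by
    \<open>J (f p)\<close>.\<close>
  define d where "d = 1 / (1 + norm (f p))"
  have d: "d > 0" "d * norm (f p) < 1"
    by (auto simp: d_def field_simps add_nonneg_pos add_pos_nonneg)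
  define J where "J c = integral {0..d} (\<lambda>x. exp (of_real x * c))" for c :: complex
  have J: "c * J c = exp (of_real d * c) - 1" for c
  proof -
    have "((\<lambda>z. exp (z * c)) has_field_derivative c * exp (z * c)) (at z)" for z
      by (auto intro!: derivative_eq_intros)
    then have "((\<lambda>x. exp (of_real x * c)) has_vector_derivative c * exp (of_real x * c)) (at x within {0..d})" for x
      by (rule has_vector_derivative_real_field)
    then have 1: "((\<lambda>x. c * exp (of_real x * c)) has_integral (exp (of_real d * c) - exp (of_real 0 * c))) {0..d}"
      using d by (intro fundamental_theorem_of_calculus) auto
    have 2: "((\<lambda>x. c * exp (of_real x * c)) has_integral (c * J c)) {0..d}"
      unfolding J_def
      by (intro has_integral_mult_right integrable_integral integrable_continuous_real continuous_intros)
    show ?thesis using has_integral_unique[OF 2 1] by simp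
  qed
  have e: "(\<lambda>n. exp (of_real x * f (u n))) \<longlonglongrightarrow> exp (of_real x * f p)" if "x \<ge> 0" for x
  proof (cases "x = 0")
    case False
    then have "x > 0" using that by simp
    from cont[OF this] show ?thesis
      using continuous_on_sequentially[of S "\<lambda>p. exp (of_real x * f p)"] u p lim
      by (auto simp: o_def)
  qed auto
  have "(\<lambda>n. J (f (u n))) \<longlonglongrightarrow> J (f p)"
    unfolding J_def
  proof (rule dominated_convergence[where h = "\<lambda>_. 1"])
    show "(\<lambda>x. exp (complex_of_real x * f (u k))) integrable_on {0..d}" for k
      by (intro integrable_continuous_real continuous_intros)
    show "norm (exp (complex_of_real x * f (u k))) \<le> 1" if "x \<in> {0..d}" for x k
      using that re[of "u k"] u by (auto simp: norm_exp_eq_Re mult_nonneg_nonpos)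
  qed (use e in auto)
  moreover have "J (f p) \<noteq> 0"
  proof -
    have "Re (J (f p)) = integral {0..d} (\<lambda>x. Re (exp (of_real x * f p)))"
      unfolding J_def
      by (subst integral_linear[OF _ bounded_linear_Re, unfolded o_def])
        (auto intro!: integrable_continuous_real continuous_intros)
    also have "\<dots> > 0"
    proof -
      have "exp (- 0) * 0 < d * (1 - d * norm (f p))"
        using d by simp
      also have "d * (1 - d * norm (f p)) = integral {0..d} (\<lambda>x. 1 - d * norm (f p))"
        using d by simp
      also have "\<dots> \<le> integral {0..d} (\<lambda>x. Re (exp (of_real x * f p)))"
      proof (rule integral_le)
        fix x assume x: "x \<in> {0..d}"
        have "norm (exp (of_real x * f p) - exp 0) \<le> norm (of_real x * f p - 0)"
          using x re[OF p] by (intro norm_exp_diff_le) (auto simp: mult_nonneg_nonpos)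
        also have "\<dots> \<le> d * norm (f p)"
          using x by (simp add: norm_mult mult_right_mono)
        finally have "\<bar>Re (exp (of_real x * f p) - 1)\<bar> \<le> d * norm (f p)"
          using abs_Re_le_cmod order_trans by (metis exp_zero)
        then show "1 - d * norm (f p) \<le> Re (exp (of_real x * f p))" by simp
      qed (auto intro!: integrable_continuous_real continuous_intros)
      finally show ?thesis by simp
    qed
    finally show ?thesis by auto
  qed
  ultimately have lim2: "(\<lambda>n. (exp (of_real d * f (u n)) - 1) / J (f (u n))) \<longlonglongrightarrow> (exp (of_real d * f p) - 1) / J (f p)"
    and ev: "\<forall>\<^sub>F n in sequentially. J (f (u n)) \<noteq> 0"
    using e[of d] d by (auto intro!: tendsto_intros tendsto_imp_eventually_ne)
  have "(exp (of_real d * f p) - 1) / J (f p) = f p"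
    using J[of "f p"] \<open>J (f p) \<noteq> 0\<close> by (simp add: field_simps)
  moreover have "\<forall>\<^sub>F n in sequentially. (exp (of_real d * f (u n)) - 1) / J (f (u n)) = f (u n)"
    using ev
  proof eventually_elim
    case (elim n)
    then show ?case using J[of "f (u n)"] by (simp add: field_simps)
  qed
  ultimately show "(\<lambda>n. f (u n)) \<longlonglongrightarrow> f p"
    using lim2 by (auto simp: tendsto_cong)
qed

section \<open>Characteristic functions on the half plane\<close>

lemma zero_in_U [simp]: "0 \<in> U"
  by (simp add: U_def)

lemma in_U_iff: "(u1, u2) \<in> U \<longleftrightarrow> Re u1 \<le> 0 \<and> Re u2 = 0"
  by (simp add: U_def)

lemma add_in_U: "u \<in> U \<Longrightarrow> v \<in> U \<Longrightarrow> u + v \<in> U"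
  by (simp add: U_def)

lemma scaleR_in_U: "u \<in> U \<Longrightarrow> c \<ge> 0 \<Longrightarrow> c *\<^sub>R u \<in> U"
  by (simp add: U_def mult_nonneg_nonpos)

lemma convex_U: "convex U"
  by (rule convexI) (simp add: add_in_U scaleR_in_U)

lemma closed_U: "closed U"
proof -
  have "U = {u. Re (fst u) \<le> 0} \<inter> {u. Re (snd u) = 0}"
    by (auto simp: U_def)
  moreover have "closed ({u. Re (fst u) \<le> 0} \<inter> {u. Re (snd u) = 0} :: (complex \<times> complex) set)"
    by (intro closed_Int closed_Collect_le closed_Collect_eq continuous_intros)
  ultimately show ?thesis by simp
qed

lemma in_D_iff: "x \<in> D \<longleftrightarrow> fst x \<ge> 0"
  by (cases x) (simp add: D_def)

lemma zero_in_D [simp]: "0 \<in> D"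
  by (simp add: in_D_iff)

lemma add_in_D: "x \<in> D \<Longrightarrow> y \<in> D \<Longrightarrow> x + y \<in> D"
  by (simp add: in_D_iff)

lemma closed_D: "closed D"
proof -
  have "D = {x. fst x \<ge> 0}" by (auto simp: in_D_iff)
  moreover have "closed {x :: real \<times> real. fst x \<ge> 0}"
    by (intro closed_Collect_le continuous_intros)
  ultimately show ?thesis by simp
qed

lemma D_in_sets [measurable, simp]: "D \<in> sets borel"
  using closed_D by (rule borel_closed)

lemma space_borel_D: "space borel_D = D"
  by (simp add: space_restrict_space)

lemma measurable_on_D:
  "sets M = sets borel_D \<Longrightarrow> f \<in> borel \<rightarrow>\<^sub>M N \<Longrightarrow> f \<in> M \<rightarrow>\<^sub>M N"
  by (subst measurable_cong_sets[of M borel_D N N]) (auto intro: measurable_restrict_space1)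

lemma space_on_D: "sets M = sets borel_D \<Longrightarrow> space M = D"
  using sets_eq_imp_space_eq space_borel_D by metis

lemma sets_on_D:
  assumes "sets M = sets borel_D" "A \<in> sets borel" "A \<subseteq> D"
  shows "A \<in> sets M"
  using assms by (auto simp: sets_restrict_space)

lemma continuous_on_pairing [continuous_intros]:
  assumes "continuous_on S f" "continuous_on S g"
  shows "continuous_on S (\<lambda>x. pairing (f x) (g x))"
  unfolding pairing_def using assms by (intro continuous_intros)

lemma borel_measurable_exp_pairing [measurable]:
  "(\<lambda>\<xi>. exp (pairing u \<xi>)) \<in> borel_measurable borel"
  by (intro borel_measurable_continuous_onI continuous_intros)

lemma Re_pairing_le:
  assumes "u \<in> U" "x \<in> D"
  shows "Re (pairing u x) \<le> 0"
  using assms by (auto simp: pairing_def U_def in_D_iff mult_nonpos_nonneg)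

lemma norm_exp_pairing_le:
  assumes "u \<in> U" "x \<in> D"
  shows "norm (exp (pairing u x)) \<le> 1"
  using Re_pairing_le[OF assms] by simp

lemma norm_pairing_le: "norm (pairing u x) \<le> norm u * norm x * 2"
proof -
  have "norm (pairing u x) \<le> norm (fst u) * \<bar>fst x\<bar> + norm (snd u) * \<bar>snd x\<bar>"
    unfolding pairing_def by (rule order_trans[OF norm_triangle_ineq]) (simp add: norm_mult)
  also have "\<dots> \<le> norm u * norm x + norm u * norm x"
    using norm_fst_le[of "fst u" "snd u"] norm_snd_le[of "snd u" "fst u"]
      norm_fst_le[of "fst x" "snd x"] norm_snd_le[of "snd x" "fst x"]
    by (intro add_mono mult_mono) auto
  finally show ?thesis by (simp add: mult.commute)
qed

lemma pairing_zero [simp]: "pairing 0 x = 0" "pairing u 0 = 0"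
  by (simp_all add: pairing_def)

lemma pairing_add: "pairing (u + v) x = pairing u x + pairing v x"
  "pairing u (x + y) = pairing u x + pairing u y"
  by (simp_all add: pairing_def algebra_simps)

lemma pairing_diff: "pairing (u - v) x = pairing u x - pairing v x"
  by (simp add: pairing_def algebra_simps)

abbreviation prob_D :: "(real \<times> real) measure set" where
  "prob_D \<equiv> space (prob_algebra borel_D)"

lemma prob_DD:
  assumes "\<rho> \<in> prob_D"
  shows "prob_space \<rho>" "sets \<rho> = sets borel_D" "space \<rho> = D"
  using assms space_on_D by (auto simp: space_prob_algebra)

lemma prob_D_measurable: "\<rho> \<in> prob_D \<Longrightarrow> f \<in> borel_measurable borel \<Longrightarrow> f \<in> borel_measurable \<rho>"
  using measurable_on_D prob_DD(2) by blast

lemma integrable_bounded_on_D: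
  fixes f :: "real \<times> real \<Rightarrow> 'b::{banach, second_countable_topology}"
  assumes "\<rho> \<in> prob_D" "f \<in> borel_measurable borel" "\<And>x. x \<in> D \<Longrightarrow> norm (f x) \<le> B"
  shows "integrable \<rho> f"
proof -
  interpret prob_space \<rho> using assms prob_DD by blast
  show ?thesis
    using assms prob_D_measurable prob_DD(3)[OF assms(1)]
    by (intro integrable_const_bound[where B = B]) auto
qed

lemma integrable_exp_pairing:
  assumes "\<rho> \<in> prob_D" "u \<in> U"
  shows "integrable \<rho> (\<lambda>\<xi>. exp (pairing u \<xi>))"
  using assms norm_exp_pairing_le[OF assms(2)]
  by (intro integrable_bounded_on_D[where B = 1]) auto

lemma norm_integral_le_on_D:
  fixes f :: "real \<times> real \<Rightarrow> 'b::{banach, second_countable_topology}"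
  assumes "\<rho> \<in> prob_D" "\<And>x. x \<in> D \<Longrightarrow> norm (f x) \<le> g x" "integrable \<rho> g"
  shows "norm (LINT x|\<rho>. f x) \<le> (LINT x|\<rho>. g x)"
proof -
  have "norm (LINT x|\<rho>. f x) \<le> (LINT x|\<rho>. norm (f x))"
    by (rule integral_norm_bound)
  also have "\<dots> \<le> (LINT x|\<rho>. g x)"
  proof (intro integral_mono_AE' AE_I2)
    fix x assume "x \<in> space \<rho>"
    then have "norm (f x) \<le> g x" using assms(2) prob_DD(3)[OF assms(1)] by auto
    moreover from this show "norm (f x) \<le> g x" .
    ultimately show "0 \<le> g x" using norm_ge_zero order_trans by blast
  qed (rule assms(3))
  finally show ?thesis .
qed

lemma norm_char_fun_le_1:
  assumes "\<rho> \<in> prob_D" "u \<in> U"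
  shows "norm (char_fun \<rho> u) \<le> 1"
proof -
  interpret prob_space \<rho> using assms prob_DD by blast
  have "norm (char_fun \<rho> u) \<le> (LINT x|\<rho>. 1)"
    unfolding char_fun_def using assms norm_exp_pairing_le
    by (intro norm_integral_le_on_D) auto
  then show ?thesis using prob_space by simp
qed

lemma char_fun_zero:
  assumes "\<rho> \<in> prob_D"
  shows "char_fun \<rho> 0 = 1"
proof -
  interpret prob_space \<rho> using assms prob_DD by blast
  show ?thesis using prob_space by (simp add: char_fun_def)
qed

lemma char_fun_return:
  assumes "x \<in> D"
  shows "char_fun (return borel_D x) u = exp (pairing u x)"
  unfolding char_fun_def
  using assms by (intro integral_return) (auto simp: space_borel_D intro: measurable_restrict_space1)

text \<open>Weak convergence gives pointwise convergence of characteristic functions; the bounded test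
  functions \<open>min 2 (d * norm x)\<close> turn it into joint continuity.\<close>

lemma continuous_on_char_fun:
  assumes \<mu>: "\<And>t. t \<ge> 0 \<Longrightarrow> \<mu> t \<in> prob_D" and wc: "weakly_continuous \<mu>"
  shows "continuous_on ({0..} \<times> U) (\<lambda>(t, u). char_fun (\<mu> t) u)"
proof (rule continuous_on_sequentiallyI)
  fix p :: "nat \<Rightarrow> real \<times> complex \<times> complex" and q
  assume p: "\<forall>n. p n \<in> {0..} \<times> U" and q: "q \<in> {0..} \<times> U" and lim: "p \<longlonglongrightarrow> q"
  define t where "t n = fst (p n)" for n
  define u where "u n = snd (p n)" for n
  define s where "s = fst q"
  define v where "v = snd q"
  have tu: "t n \<ge> 0" "u n \<in> U" for n
    using p by (auto simp: t_def u_def dest!: spec[of _ n])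
  have sv: "s \<ge> 0" "v \<in> U" using q by (auto simp: s_def v_def)
  have lt: "t \<longlonglongrightarrow> s" and lu: "u \<longlonglongrightarrow> v"
    using tendsto_fst[OF lim] tendsto_snd[OF lim] by (simp_all add: t_def[abs_def] u_def[abs_def] s_def v_def)
  have wconv: "(\<lambda>n. LINT x|\<mu> (t n). f x) \<longlonglongrightarrow> (LINT x|\<mu> s. f x)"
    if "continuous_on D f" "bounded (f ` D)" for f :: "real \<times> real \<Rightarrow> real"
  proof -
    have "continuous_on {0..} (\<lambda>t. LINT x|\<mu> t. f x)"
      using wc that by (auto simp: weakly_continuous_def)
    then show ?thesis
      using continuous_on_sequentially[of "{0..}" "\<lambda>t. LINT x|\<mu> t. f x"] tu sv lt
      by (auto simp: o_def)
  qed
  have conv_v: "(\<lambda>n. char_fun (\<mu> (t n)) v) \<longlonglongrightarrow> char_fun (\<mu> s) v"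
  proof -
    have b: "bounded ((\<lambda>x. Re (exp (pairing v x))) ` D)" "bounded ((\<lambda>x. Im (exp (pairing v x))) ` D)"
      using norm_exp_pairing_le[OF sv(2)] abs_Re_le_cmod abs_Im_le_cmod order_trans
      by (auto intro!: boundedI[where B = 1]; blast)+
    have "(\<lambda>n. LINT x|\<mu> (t n). Re (exp (pairing v x))) \<longlonglongrightarrow> (LINT x|\<mu> s. Re (exp (pairing v x)))"
      by (rule wconv[OF _ b(1)]) (intro continuous_intros)
    moreover have "(\<lambda>n. LINT x|\<mu> (t n). Im (exp (pairing v x))) \<longlonglongrightarrow> (LINT x|\<mu> s. Im (exp (pairing v x)))"
      by (rule wconv[OF _ b(2)]) (intro continuous_intros)
    moreover have "(LINT x|\<mu> r. Re (exp (pairing v x))) = Re (char_fun (\<mu> r) v)"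
      "(LINT x|\<mu> r. Im (exp (pairing v x))) = Im (char_fun (\<mu> r) v)" if "r \<ge> 0" for r
      unfolding char_fun_def using integrable_exp_pairing[OF \<mu>[OF that] sv(2)]
      by (simp_all only: integral_Re integral_Im)
    ultimately show ?thesis
      using tu sv by (simp add: tendsto_complex_iff)
  qed
  have diff: "(\<lambda>n. char_fun (\<mu> (t n)) (u n) - char_fun (\<mu> (t n)) v) \<longlonglongrightarrow> 0"
  proof (rule LIMSEQ_I)
    fix e :: real assume e: "e > 0"
    define f where "f d x = min 2 (d * (2 * norm x))" for d :: real and x :: "real \<times> real"
    have fcont: "continuous_on A (f d)" and fmeas: "f d \<in> borel_measurable borel" for A d
      unfolding f_def by (intro continuous_intros) simp
    have fb: "norm (f d x) \<le> 2" if "d \<ge> 0" for d x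
      using that by (auto simp: f_def)
    interpret s: prob_space "\<mu> s" using \<mu>[OF sv(1)] prob_DD by blast
    have "(\<lambda>n. LINT x|\<mu> s. f (1 / real (Suc n)) x) \<longlonglongrightarrow> (LINT x|\<mu> s. 0)"
    proof (rule integral_dominated_convergence[where w = "\<lambda>_. 2"])
      show "AE x in \<mu> s. (\<lambda>n. f (1 / real (Suc n)) x) \<longlonglongrightarrow> 0"
      proof (rule AE_I2)
        fix x
        have "(\<lambda>n. 1 / real (Suc n)) \<longlonglongrightarrow> 0" by (rule LIMSEQ_Suc[OF lim_1_over_n])
        then have "(\<lambda>n. f (1 / real (Suc n)) x) \<longlonglongrightarrow> min 2 (0 * (2 * norm x))"
          unfolding f_def by (intro tendsto_intros)
        then show "(\<lambda>n. f (1 / real (Suc n)) x) \<longlonglongrightarrow> 0" by simp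
      qed
    qed (use fb fmeas in \<open>auto intro!: prob_D_measurable[OF \<mu>[OF sv(1)]]\<close>)
    then obtain n0 where "norm (LINT x|\<mu> s. f (1 / real (Suc n0)) x) < e"
      using e by (auto dest!: LIMSEQ_D[where r = e])
    then obtain d where d: "d > 0" "(LINT x|\<mu> s. f d x) < e"
      by (metis abs_less_iff of_nat_0_less_iff real_norm_def zero_less_Suc zero_less_divide_1_iff)
    \<comment> \<open>Dominated convergence has made one integral small under the single measure
      \<open>\<mu> s\<close>; weak convergence carries the smallness over to
      \<open>\<mu> (t n)\<close>, uniformly for large \<open>n\<close>.\<close>
    have "(\<lambda>n. LINT x|\<mu> (t n). f d x) \<longlonglongrightarrow> (LINT x|\<mu> s. f d x)"
      using fb d(1) by (intro wconv fcont) (auto intro!: boundedI[where B = 2])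
    then have "\<forall>\<^sub>F n in sequentially. (LINT x|\<mu> (t n). f d x) < e"
      using d(2) order_tendstoD(2) by blast
    moreover have "\<forall>\<^sub>F n in sequentially. norm (u n - v) < d"
      using lu d(1) by (metis (no_types, lifting) dist_norm tendstoD eventually_mono)
    ultimately have "\<forall>\<^sub>F n in sequentially. norm (char_fun (\<mu> (t n)) (u n) - char_fun (\<mu> (t n)) v) < e"
    proof eventually_elim
      case (elim n)
      have "char_fun (\<mu> (t n)) (u n) - char_fun (\<mu> (t n)) v
        = (LINT x|\<mu> (t n). exp (pairing (u n) x) - exp (pairing v x))"
        unfolding char_fun_def using tu sv \<mu> integrable_exp_pairing by (subst Bochner_Integration.integral_diff) auto
      also have "norm \<dots> \<le> (LINT x|\<mu> (t n). f d x)"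
      proof (rule norm_integral_le_on_D[OF \<mu>[OF tu(1)]])
        show "integrable (\<mu> (t n)) (f d)"
          using fb[OF less_imp_le[OF d(1)]] by (intro integrable_bounded_on_D[OF \<mu>[OF tu(1)] fmeas]) simp
        fix x assume x: "x \<in> D"
        have "norm (exp (pairing (u n) x) - exp (pairing v x)) \<le> norm (pairing (u n) x - pairing v x)"
          using Re_pairing_le x tu sv by (intro norm_exp_diff_le) auto
        also have "\<dots> \<le> norm (u n - v) * norm x * 2"
          using norm_pairing_le[of "u n - v" x] by (simp add: pairing_diff)
        also have "\<dots> \<le> d * (2 * norm x)"
          using elim(2) mult_right_mono[of "norm (u n - v)" d "norm x"] by (simp add: mult.commute)
        finally have 1: "norm (exp (pairing (u n) x) - exp (pairing v x)) \<le> d * (2 * norm x)" .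
        have "norm (exp (pairing (u n) x) - exp (pairing v x)) \<le> 2"
          using norm_exp_pairing_le[OF tu(2) x] norm_exp_pairing_le[OF sv(2) x] norm_triangle_ineq4 
          by (smt (verit, best))
        with 1 show "norm (exp (pairing (u n) x) - exp (pairing v x)) \<le> f d x"
          by (simp add: f_def)
      qed
      finally show ?case using elim by linarith
    qed
    then show "\<exists>n0. \<forall>n\<ge>n0. norm (char_fun (\<mu> (t n)) (u n) - char_fun (\<mu> (t n)) v - 0) < e"
      by (simp add: eventually_sequentially)
  qed
  have "(\<lambda>n. char_fun (\<mu> (t n)) (u n)) \<longlonglongrightarrow> char_fun (\<mu> s) v"
    using tendsto_add[OF diff conv_v] by simp
  then show "(\<lambda>n. case p n of (t, u) \<Rightarrow> char_fun (\<mu> t) u) \<longlonglongrightarrow> (case q of (t, u) \<Rightarrow> char_fun (\<mu> t) u)"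
    by (simp add: t_def u_def s_def v_def case_prod_beta)
qed

section \<open>Convolutions, convolution powers and mixtures along a kernel\<close>

lemma conv_D_in_prob_D:
  assumes "\<mu> \<in> prob_D" "\<nu> \<in> prob_D"
  shows "conv_D \<mu> \<nu> \<in> prob_D"
    and char_fun_conv_D: "u \<in> U \<Longrightarrow> char_fun (conv_D \<mu> \<nu>) u = char_fun \<mu> u * char_fun \<nu> u"
proof -
  interpret \<mu>: prob_space \<mu> using assms prob_DD by blast
  interpret \<nu>: prob_space \<nu> using assms prob_DD by blast
  interpret P: pair_prob_space \<mu> \<nu> ..
  note [measurable_cong] = prob_DD(2)[OF assms(1)] prob_DD(2)[OF assms(2)]
  have id: "(\<lambda>x. x) \<in> \<mu> \<rightarrow>\<^sub>M borel" "(\<lambda>x. x) \<in> \<nu> \<rightarrow>\<^sub>M borel"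
    using measurable_on_D[OF prob_DD(2)[OF assms(1)] measurable_ident]
      measurable_on_D[OF prob_DD(2)[OF assms(2)] measurable_ident] by (simp_all add: id_def)
  have plus: "(\<lambda>(x, y). x + y) \<in> \<mu> \<Otimes>\<^sub>M \<nu> \<rightarrow>\<^sub>M (borel :: (real \<times> real) measure)"
    unfolding split_beta
    by (intro borel_measurable_add measurable_compose[OF measurable_fst id(1)]
        measurable_compose[OF measurable_snd id(2)])
  have conv: "conv_D \<mu> \<nu> = restrict_space (distr (\<mu> \<Otimes>\<^sub>M \<nu>) borel (\<lambda>(x, y). x + y)) D"
    by (simp add: conv_D_def convolution_def)
  have inD: "x + y \<in> D" if "(x, y) \<in> space (\<mu> \<Otimes>\<^sub>M \<nu>)" for x y
    using that prob_DD(3)[OF assms(1)] prob_DD(3)[OF assms(2)] by (auto simp: space_pair_measure add_in_D)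
  have "(\<lambda>(x, y). x + y) -` D \<inter> space (\<mu> \<Otimes>\<^sub>M \<nu>) = space (\<mu> \<Otimes>\<^sub>M \<nu>)"
    using inD by auto
  then have "emeasure (distr (\<mu> \<Otimes>\<^sub>M \<nu>) borel (\<lambda>(x, y). x + y)) D = 1"
    using plus by (simp add: emeasure_distr P.emeasure_space_1)
  then have "prob_space (conv_D \<mu> \<nu>)"
    unfolding conv by (intro prob_spaceI) (simp add: space_restrict_space emeasure_restrict_space)
  then show "conv_D \<mu> \<nu> \<in> prob_D"
    by (simp add: space_prob_algebra conv sets_restrict_space)
  assume u: "u \<in> U"
  have "char_fun (conv_D \<mu> \<nu>) u
    = (LINT p|(\<mu> \<Otimes>\<^sub>M \<nu>). indicator D (fst p + snd p) *\<^sub>R exp (pairing u (fst p + snd p)))"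
    unfolding char_fun_def conv
    by (subst integral_restrict_space, simp, subst integral_distr[OF plus]) (auto simp: case_prod_beta)
  also have "\<dots> = (LINT p|(\<mu> \<Otimes>\<^sub>M \<nu>). exp (pairing u (fst p)) * exp (pairing u (snd p)))"
    using inD by (intro Bochner_Integration.integral_cong) (auto simp: pairing_add exp_add)
  also have "\<dots> = (LINT x|\<mu>. LINT y|\<nu>. exp (pairing u x) * exp (pairing u y))"
  proof (subst P.integral_fst'[symmetric])
    have m1: "(\<lambda>p. exp (pairing u (fst p))) \<in> borel_measurable (\<mu> \<Otimes>\<^sub>M \<nu>)"
      by (intro measurable_compose[OF measurable_fst] prob_D_measurable[OF assms(1)]) simp
    have m2: "(\<lambda>p. exp (pairing u (snd p))) \<in> borel_measurable (\<mu> \<Otimes>\<^sub>M \<nu>)"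
      by (intro measurable_compose[OF measurable_snd] prob_D_measurable[OF assms(2)]) simp
    show "integrable (\<mu> \<Otimes>\<^sub>M \<nu>) (\<lambda>p. exp (pairing u (fst p)) * exp (pairing u (snd p)))"
    proof (rule P.integrable_const_bound[where B = 1])
      show "AE p in \<mu> \<Otimes>\<^sub>M \<nu>. norm (exp (pairing u (fst p)) * exp (pairing u (snd p))) \<le> 1"
        using norm_exp_pairing_le[OF u] prob_DD(3)[OF assms(1)] prob_DD(3)[OF assms(2)]
        by (intro AE_I2) (auto simp: norm_mult space_pair_measure simp del: norm_exp_eq_Re intro!: mult_le_one)
    qed (intro borel_measurable_times m1 m2)
  qed simp
  also have "\<dots> = char_fun \<mu> u * char_fun \<nu> u"
    by (simp add: char_fun_def)
  finally show "char_fun (conv_D \<mu> \<nu>) u = char_fun \<mu> u * char_fun \<nu> u" .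
qed

lemma conv_power_in_prob_D:
  assumes "\<mu> \<in> prob_D"
  shows "conv_power \<mu> n \<in> prob_D"
    and char_fun_conv_power: "u \<in> U \<Longrightarrow> char_fun (conv_power \<mu> n) u = char_fun \<mu> u ^ n"
proof -
  have ret: "return borel_D (0 :: real \<times> real) \<in> prob_D"
    by (auto simp: space_prob_algebra space_borel_D intro!: prob_space_return)
  show *: "conv_power \<mu> n \<in> prob_D" for n
    by (induction n) (use ret assms conv_D_in_prob_D in auto)
  show "u \<in> U \<Longrightarrow> char_fun (conv_power \<mu> n) u = char_fun \<mu> u ^ n"
    by (induction n) (use * assms char_fun_conv_D in \<open>auto simp: char_fun_return\<close>)
qed

lemma char_fun_bind:
  assumes \<rho>: "\<rho> \<in> prob_D" and K: "K \<in> borel_D \<rightarrow>\<^sub>M prob_algebra borel_D"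
  shows bind_in_prob_D: "\<rho> \<bind> K \<in> prob_D"
    and "u \<in> U \<Longrightarrow> char_fun (\<rho> \<bind> K) u = (LINT x|\<rho>. char_fun (K x) u)"
proof -
  show "\<rho> \<bind> K \<in> prob_D"
    using prob_space_bind'[OF \<rho> K] sets_bind'[OF \<rho> K] by (simp add: space_prob_algebra)
  then have bP: "\<rho> \<bind> K \<in> prob_D" .
  interpret prob_space \<rho> using \<rho> prob_DD by blast
  have KM: "K \<in> \<rho> \<rightarrow>\<^sub>M prob_algebra borel_D"
    using K by (simp add: measurable_cong_sets[OF prob_DD(2)[OF \<rho>] refl])
  have Kx: "K x \<in> prob_D" if "x \<in> D" for x
    using measurable_space[OF K] that by (simp add: space_borel_D)
  \<comment> \<open>Bounded real integrands come first; the exponential is then put together from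
    its real and imaginary parts.\<close>
  have real: "(LINT x|(\<rho> \<bind> K). f x) = (LINT x|\<rho>. LINT y|K x. f y)"
    and real_int: "integrable \<rho> (\<lambda>x. LINT y|K x. f y)"
    if f: "f \<in> borel_measurable borel" and b: "\<And>x. x \<in> D \<Longrightarrow> \<bar>f x\<bar> \<le> 1" for f :: "real \<times> real \<Rightarrow> real"
  proof -
    have fm: "f \<in> borel_measurable borel_D" using f by (rule measurable_restrict_space1)
    show "(LINT x|(\<rho> \<bind> K). f x) = (LINT x|\<rho>. LINT y|K x. f y)"
    proof (rule integral_bind[OF fm _ measurable_prob_algebraD[OF KM]])
      show "AE x in \<rho>. emeasure (K x) (space (K x)) \<le> ennreal 1"
        using Kx prob_DD(3)[OF \<rho>] by (intro AE_I2) (simp add: prob_DD(1) prob_space.emeasure_space_1)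
    qed (use b space_borel_D finite_measure_axioms in auto)
    show "integrable \<rho> (\<lambda>x. LINT y|K x. f y)"
    proof (rule integrable_const_bound[where B = 1])
      show "AE x in \<rho>. norm (LINT y|K x. f y) \<le> 1"
      proof (rule AE_I2)
        fix x assume "x \<in> space \<rho>"
        then have x: "K x \<in> prob_D" using Kx prob_DD(3)[OF \<rho>] by simp
        then interpret Kx: prob_space "K x" using prob_DD by blast
        have "norm (LINT y|K x. f y) \<le> (LINT y|K x. 1)"
          using b by (intro norm_integral_le_on_D[OF x]) auto
        then show "norm (LINT y|K x. f y) \<le> 1" using Kx.prob_space by simp
      qed
      have "(\<lambda>M. LINT y|M. f y) \<in> borel_measurable (subprob_algebra borel_D)"
        using fm by (rule integral_measurable_subprob_algebra)
      then show "(\<lambda>x. LINT y|K x. f y) \<in> borel_measurable \<rho>"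
        by (rule measurable_compose[OF measurable_prob_algebraD[OF KM]])
    qed
  qed
  assume u: "u \<in> U"
  have b: "\<bar>Re (exp (pairing u x))\<bar> \<le> 1" "\<bar>Im (exp (pairing u x))\<bar> \<le> 1" if "x \<in> D" for x
    using norm_exp_pairing_le[OF u that] abs_Re_le_cmod abs_Im_le_cmod order_trans by blast+
  have m: "(\<lambda>x. Re (exp (pairing u x))) \<in> borel_measurable borel" "(\<lambda>x. Im (exp (pairing u x))) \<in> borel_measurable borel"
    by measurable
  have c: "(LINT y|M. Re (exp (pairing u y))) = Re (char_fun M u)"
    "(LINT y|M. Im (exp (pairing u y))) = Im (char_fun M u)" if "M \<in> prob_D" for M
    unfolding char_fun_def using integrable_exp_pairing[OF that u] by (simp_all only: integral_Re integral_Im)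
  have eq: "(LINT x|\<rho>. LINT y|K x. Re (exp (pairing u y))) = (LINT x|\<rho>. Re (char_fun (K x) u))"
     "(LINT x|\<rho>. LINT y|K x. Im (exp (pairing u y))) = (LINT x|\<rho>. Im (char_fun (K x) u))"
    using Kx prob_DD(3)[OF \<rho>] c by (auto intro!: Bochner_Integration.integral_cong)
  have ints: "integrable \<rho> (\<lambda>x. Re (char_fun (K x) u))" "integrable \<rho> (\<lambda>x. Im (char_fun (K x) u))"
    by (rule Bochner_Integration.integrable_cong[OF refl, THEN iffD1, OF _ real_int[OF m(1) b(1)]],
        use Kx prob_DD(3)[OF \<rho>] c in simp_all)
      (rule Bochner_Integration.integrable_cong[OF refl, THEN iffD1, OF _ real_int[OF m(2) b(2)]],
        use Kx prob_DD(3)[OF \<rho>] c in simp_all)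
  then have "integrable \<rho> (\<lambda>x. of_real (Re (char_fun (K x) u)) + \<i> * of_real (Im (char_fun (K x) u)))"
    by (intro Bochner_Integration.integrable_add integrable_mult_right integrable_of_real)
  then have "integrable \<rho> (\<lambda>x. char_fun (K x) u)"
    by (simp flip: complex_eq)
  then have "Re (LINT x|\<rho>. char_fun (K x) u) = (LINT x|\<rho>. Re (char_fun (K x) u))"
    "Im (LINT x|\<rho>. char_fun (K x) u) = (LINT x|\<rho>. Im (char_fun (K x) u))"
    by simp_all
  then show "char_fun (\<rho> \<bind> K) u = (LINT x|\<rho>. char_fun (K x) u)"
    using real[OF m(1) b(1)] real[OF m(2) b(2)] c[OF bP] eq by (simp add: complex_eq_iff)
qed

section \<open>Levy-Khintchine exponents\<close>

lemma integral_unit_unif_sq: "(LINT s|unit_unif. s\<^sup>2) = 1 / 3"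
proof -
  have "(LINT s|unit_unif. s\<^sup>2) = (LINT s:{0..1}|lborel. s\<^sup>2)"
    by (simp add: integral_restrict_space set_lebesgue_integral_def)
  also have "\<dots> = integral {0..1} (\<lambda>s::real. s\<^sup>2)"
    by (rule set_borel_integral_eq_integral) (auto intro!: borel_integrable_atLeastAtMost' continuous_intros)
  also have "\<dots> = 1 ^ 3 / 3 - 0 ^ 3 / 3"
    by (rule integral_unique, rule fundamental_theorem_of_calculus)
       (auto intro!: derivative_eq_intros simp flip: has_real_derivative_iff_has_vector_derivative)
  finally show ?thesis by simp
qed

lemma borel_measurable_fst_snd [measurable]:
  "fst \<in> borel_measurable (borel :: (real \<times> real) measure)"
  "snd \<in> borel_measurable (borel :: (real \<times> real) measure)"
  by (intro borel_measurable_continuous_onI continuous_intros)+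

lemma one_minus_cos_le: "1 - cos x \<le> 2 * min 1 ((x::real)\<^sup>2)"
proof -
  have "1 - cos x \<le> 2 * x\<^sup>2" using iexp_bounds(1)[of x] zero_le_power2[of x] by linarith
  moreover have "1 - cos x \<le> 2" using cos_ge_minus_one[of x] by linarith
  ultimately show ?thesis by (simp add: min_def)
qed

lemma min_sq_scale_le: "min 1 ((c * x)\<^sup>2) \<le> (1 + c\<^sup>2) * min 1 ((x::real)\<^sup>2)"
proof -
  have "(c * x)\<^sup>2 \<le> (1 + c\<^sup>2) * x\<^sup>2"
    by (simp add: power_mult_distrib distrib_right)
  moreover have "min 1 ((c * x)\<^sup>2) \<le> (1 + c\<^sup>2) * 1" by (simp add: min.coboundedI1)
  ultimately show ?thesis by (auto simp: min_def)
qed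

lemma min_sq_mono: "\<bar>x\<bar> \<le> \<bar>y\<bar> \<Longrightarrow> min 1 (x\<^sup>2) \<le> min 1 ((y::real)\<^sup>2)"
  by (intro min.mono order_refl) (simp add: abs_le_square_iff)

text \<open>The measure may have infinite mass near 0. Everything rests on bounding |k y (1 - cos (s
  c y))| by a multiple of min 1 (y^2), uniformly for s in [0, 1], which makes Fubini applicable. The
  weight \<open>k\<close> is 1 for averaged real parts and \<open>trunc_ratio\<close> for the
  drift.\<close>

lemma
  fixes M :: "(real \<times> real) measure" and k :: "real \<Rightarrow> real"
  assumes sf: "sigma_finite_measure M" and sets: "sets M = sets borel_D"
    and int: "integrable M (\<lambda>\<xi>. min 1 ((snd \<xi>)\<^sup>2))"
    and k [measurable]: "k \<in> borel_measurable borel" and B: "\<And>x. \<bar>k x\<bar> \<le> B"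
  shows integrable_one_minus_cos: "integrable M (\<lambda>\<xi>. k (snd \<xi>) * (1 - cos (c * snd \<xi>)))"
    and integrable_integral_one_minus_cos:
      "integrable unit_unif (\<lambda>s. LINT \<xi>|M. k (snd \<xi>) * (1 - cos (s * (c * snd \<xi>))))"
    and integral_one_minus_cos_swap:
      "(LINT s|unit_unif. LINT \<xi>|M. k (snd \<xi>) * (1 - cos (s * (c * snd \<xi>)))) = (LINT \<xi>|M. k (snd \<xi>) * wt (c * snd \<xi>))"
    and integrable_wt: "integrable M (\<lambda>\<xi>. k (snd \<xi>) * wt (c * snd \<xi>))"
proof -
  interpret sigma_finite_measure M by (rule sf)
  interpret P: pair_sigma_finite unit_unif M ..
  have [measurable]: "snd \<in> borel_measurable M"
    by (rule measurable_on_D[OF sets]) simp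
  have "0 \<le> B" using B[of 0] by linarith
  have bd: "\<bar>k x * (1 - cos (c * x))\<bar> \<le> B * (2 * (1 + c\<^sup>2)) * min 1 (x\<^sup>2)" for x c :: real
  proof -
    have "\<bar>k x * (1 - cos (c * x))\<bar> \<le> B * (2 * min 1 ((c * x)\<^sup>2))"
      unfolding abs_mult using B[of x] one_minus_cos_le[of "c * x"] cos_le_one[of "c * x"]
      by (intro mult_mono) auto
    also have "\<dots> \<le> B * (2 * ((1 + c\<^sup>2) * min 1 (x\<^sup>2)))"
      using \<open>0 \<le> B\<close> by (intro mult_left_mono min_sq_scale_le) auto
    finally show ?thesis by (simp only: mult.assoc)
  qed
  have I: "integrable M (\<lambda>\<xi>. k (snd \<xi>) * (1 - cos (c * snd \<xi>)))" for c
    using bd by (intro Bochner_Integration.integrable_bound[OF integrable_mult_right[OF int, of "B * (2 * (1 + c\<^sup>2))"]])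
       (auto intro!: AE_I2 order_trans[OF bd])
  show "integrable M (\<lambda>\<xi>. k (snd \<xi>) * (1 - cos (c * snd \<xi>)))" by (rule I)
  define f :: "real \<times> real \<times> real \<Rightarrow> real" where "f = (\<lambda>(s, \<xi>). k (snd \<xi>) * (1 - cos (s * (c * snd \<xi>))))"
  have fm [measurable]: "f \<in> borel_measurable (unit_unif \<Otimes>\<^sub>M M)"
  proof -
    have "snd \<in> borel_measurable M" by (rule measurable_on_D[OF sets]) simp
    then have [measurable]: "(\<lambda>p. snd (snd p)) \<in> borel_measurable (unit_unif \<Otimes>\<^sub>M M)"
      by (rule measurable_compose[OF measurable_snd])
    have "(\<lambda>s. s) \<in> borel_measurable unit_unif" by (rule measurable_restrict_space1) simp
    then have [measurable]: "fst \<in> borel_measurable (unit_unif \<Otimes>\<^sub>M M)"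
      by (rule measurable_compose[OF measurable_fst])
    show ?thesis unfolding f_def case_prod_beta by measurable
  qed
  have fint: "integrable (unit_unif \<Otimes>\<^sub>M M) f"
  proof (rule P.Fubini_integrable[OF fm])
    show "AE s in unit_unif. integrable M (\<lambda>\<xi>. f (s, \<xi>))"
      using I by (auto simp: f_def simp flip: mult.assoc)
    show "integrable unit_unif (\<lambda>s. LINT \<xi>|M. norm (f (s, \<xi>)))"
    proof (rule unit_unif.integrable_const_bound[where B = "(LINT \<xi>|M. B * (2 * (1 + c\<^sup>2)) * min 1 ((snd \<xi>)\<^sup>2))"])
      show "AE s in unit_unif. norm (LINT \<xi>|M. norm (f (s, \<xi>))) \<le> (LINT \<xi>|M. B * (2 * (1 + c\<^sup>2)) * min 1 ((snd \<xi>)\<^sup>2))"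
      proof (rule AE_I2)
        fix s assume "s \<in> space unit_unif"
        then have s: "0 \<le> s" "s \<le> 1" by (auto simp: space_restrict_space)
        have "norm (LINT \<xi>|M. norm (f (s, \<xi>))) = (LINT \<xi>|M. norm (f (s, \<xi>)))"
          by (simp add: integral_nonneg_AE)
        also have "\<dots> \<le> (LINT \<xi>|M. B * (2 * (1 + c\<^sup>2)) * min 1 ((snd \<xi>)\<^sup>2))"
        proof (rule integral_mono)
          show "integrable M (\<lambda>\<xi>. norm (f (s, \<xi>)))"
            using I[of "s * c"] by (auto simp: f_def mult.assoc)
          show "integrable M (\<lambda>\<xi>. B * (2 * (1 + c\<^sup>2)) * min 1 ((snd \<xi>)\<^sup>2))"
            using int by simp
          fix \<xi> :: "real \<times> real"
          have "norm (f (s, \<xi>)) \<le> B * (2 * (1 + (s * c)\<^sup>2)) * min 1 ((snd \<xi>)\<^sup>2)"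
            using bd[of "snd \<xi>" "s * c"] by (simp add: f_def mult.assoc)
          also have "\<dots> \<le> B * (2 * (1 + c\<^sup>2)) * min 1 ((snd \<xi>)\<^sup>2)"
            using s \<open>0 \<le> B\<close> by (intro mult_right_mono mult_left_mono add_left_mono)
              (auto simp: power_mult_distrib mult_left_le_one_le power_le_one)
          finally show "norm (f (s, \<xi>)) \<le> B * (2 * (1 + c\<^sup>2)) * min 1 ((snd \<xi>)\<^sup>2)" .
        qed
        finally show "norm (LINT \<xi>|M. norm (f (s, \<xi>))) \<le> (LINT \<xi>|M. B * (2 * (1 + c\<^sup>2)) * min 1 ((snd \<xi>)\<^sup>2))" .
      qed
    qed measurable
  qed
  show "integrable unit_unif (\<lambda>s. LINT \<xi>|M. k (snd \<xi>) * (1 - cos (s * (c * snd \<xi>))))"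
    using P.integrable_fst'[OF fint] by (simp add: f_def)
  have k_wt: "(LINT s|unit_unif. f (s, \<xi>)) = k (snd \<xi>) * wt (c * snd \<xi>)" for \<xi>
    by (simp add: f_def wt_def)
  have "(LINT s|unit_unif. LINT \<xi>|M. f (s, \<xi>)) = (LINT \<xi>|M. LINT s|unit_unif. f (s, \<xi>))"
    using P.Fubini_integral[of "\<lambda>s \<xi>. f (s, \<xi>)"] fint by simp
  then show "(LINT s|unit_unif. LINT \<xi>|M. k (snd \<xi>) * (1 - cos (s * (c * snd \<xi>)))) = (LINT \<xi>|M. k (snd \<xi>) * wt (c * snd \<xi>))"
    unfolding k_wt by (simp add: f_def)
  interpret Q: pair_sigma_finite M unit_unif ..
  have "integrable M (\<lambda>\<xi>. LINT s|unit_unif. f (s, \<xi>))"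
    using Q.integrable_fst'[OF P.integrable_product_swap[OF fint]] by simp
  then show "integrable M (\<lambda>\<xi>. k (snd \<xi>) * wt (c * snd \<xi>))"
    using k_wt by simp
qed

text \<open>With y = exp (-x/3), 1 - y^3 factors as (1 - y) (1 + y + y^2), and the second factor is
  at most 3. The third is the loss in \<open>fst_psi_fst_axis_lower\<close>.\<close>

lemma one_minus_exp_third_ge:
  fixes x :: real
  assumes "x \<ge> 0"
  shows "(1 - exp (- x)) / 3 \<le> 1 - exp (- (x / 3))"
proof -
  define y where "y = exp (- (x / 3))"
  have y: "0 < y" "y \<le> 1" using assms by (auto simp: y_def)
  have "exp (- x) = y ^ 3"
    by (simp add: y_def flip: exp_of_nat_mult)
  then have "1 - exp (- x) = (1 - y) * (1 + y + y\<^sup>2)"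
    by (simp add: algebra_simps eval_nat_numeral)
  also have "\<dots> \<le> (1 - y) * 3"
    using y power_le_one[of y 2] by (intro mult_left_mono) linarith+
  finally show ?thesis by (simp add: y_def)
qed

text \<open>The left side is at most \<delta> x and at most 2, hence at most 2 min 1 (\<delta> x),
  and \<open>one_minus_exp_ge\<close> costs another factor 2. A complex perturbation is thereby
  dominated by a real Laplace exponent.\<close>

lemma norm_exp_minus_one_le:
  fixes v :: complex and x \<delta> :: real
  assumes "Re v \<le> 0" "norm v \<le> \<delta>" "x \<ge> 0"
  shows "norm (exp (v * of_real x) - 1) \<le> 4 * (1 - exp (- (\<delta> * x)))"
proof -
  have 1: "norm (exp (v * of_real x) - 1) \<le> \<delta> * x"
  proof -
    have "norm (exp (v * of_real x) - exp 0) \<le> norm (v * of_real x - 0)"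
      using assms by (intro norm_exp_diff_le) (auto simp: mult_nonpos_nonneg)
    also have "\<dots> \<le> \<delta> * x"
      using assms by (simp add: norm_mult mult_right_mono)
    finally show ?thesis by simp
  qed
  have 2: "norm (exp (v * of_real x) - 1) \<le> 2"
  proof -
    have "norm (exp (v * of_real x)) \<le> 1"
      using assms by (simp add: mult_nonpos_nonneg)
    then show ?thesis
      using norm_triangle_ineq4[of "exp (v * of_real x)" 1] by (simp del: norm_exp_eq_Re)
  qed
  have "0 \<le> \<delta>" using assms(2) norm_ge_zero order_trans by blast
  then have "min 1 (\<delta> * x) / 2 \<le> 1 - exp (- (\<delta> * x))"
    using assms by (intro one_minus_exp_ge) simp
  moreover have "n \<le> 4 * E" if "min 1 y / 2 \<le> E" "n \<le> y" "n \<le> 2" "0 \<le> n" for n y E :: real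
    using that by (auto simp: min_def split: if_splits)
  ultimately show ?thesis using 1 2 norm_ge_zero by blast
qed

text \<open>For |x| \<le> 1 the cubic Taylor error is at most 8/6 x^2; otherwise the trivial bound
  is 1 + 2. The range of \<open>y\<close> contains all values of \<open>z t\<close> on a short time
  interval.\<close>

lemma sin_minus_trunc_le:
  fixes x y :: real
  assumes "0 \<le> y" "y \<le> 2"
  shows "\<bar>sin (y * x) - y * trunc x\<bar> \<le> 3 * min 1 (x\<^sup>2)"
proof (cases "\<bar>x\<bar> \<le> 1")
  case True
  have "\<bar>sin (y * x) - y * x\<bar> \<le> \<bar>y * x\<bar> ^ 3 / 6" by (rule iexp_bounds(2))
  also have "\<dots> = (y ^ 3 * (\<bar>x\<bar> ^ 3)) / 6" using assms by (simp add: abs_mult power_mult_distrib)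
  also have "\<dots> \<le> (2 ^ 3 * (\<bar>x\<bar> ^ 2)) / 6"
    using assms True by (intro divide_right_mono mult_mono power_mono power_decreasing) auto
  also have "\<dots> \<le> 3 * x\<^sup>2" by simp
  also have "x\<^sup>2 = min 1 (x\<^sup>2)" using True abs_square_le_1[of x] by simp
  finally show ?thesis unfolding trunc_id[OF True] .
next
  case False
  have "\<bar>sin (y * x) - y * trunc x\<bar> \<le> \<bar>sin (y * x)\<bar> + \<bar>y\<bar> * \<bar>trunc x\<bar>"
    by (metis abs_mult abs_triangle_ineq4)
  also have "\<dots> \<le> 1 + 2 * 1"
    using assms abs_trunc_le by (intro add_mono mult_mono) auto
  finally show ?thesis
    using False abs_square_le_1[of x] by (simp add: min_def)
qed

text \<open>The smallness of \<open>y\<close> is shared out as |y x| = r |r x| with r = sqrt |y|: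
  where |r x| < 1 the sine is at most r, and elsewhere the truncated square at scale r is already 1.
  Both terms are controlled by \<open>avg_nrm\<close>, at the scales 1 and r.\<close>

lemma sin_minus_trunc_small:
  fixes x y :: real
  assumes "\<bar>y\<bar> \<le> 1"
  shows "\<bar>sin (y * x) - y * trunc x\<bar> \<le> 2 * sqrt \<bar>y\<bar> * min 1 (x\<^sup>2) + min 1 ((sqrt \<bar>y\<bar> * x)\<^sup>2)"
proof -
  define r where "r = sqrt \<bar>y\<bar>"
  have r: "0 \<le> r" "r \<le> 1" "\<bar>y\<bar> = r\<^sup>2" using assms by (auto simp: r_def)
  have yr: "\<bar>y\<bar> \<le> r" using r by (simp add: power2_eq_square mult_left_le)
  have "\<bar>sin (y * x) - y * trunc x\<bar> \<le> 2 * r * min 1 (x\<^sup>2) + min 1 ((r * x)\<^sup>2)"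
  proof (cases "\<bar>x\<bar> \<le> 1")
    case True
    have "\<bar>sin (y * x) - y * x\<bar> \<le> \<bar>y * x\<bar> ^ 3 / 6" by (rule iexp_bounds(2))
    also have "\<dots> = (\<bar>y\<bar> ^ 3 * (\<bar>x\<bar> ^ 3)) / 6" by (simp add: abs_mult power_mult_distrib)
    also have "\<dots> \<le> (\<bar>y\<bar> ^ 1 * (\<bar>x\<bar> ^ 2)) / 6"
      using assms True by (intro divide_right_mono mult_mono power_mono power_decreasing) auto
    also have "\<dots> \<le> (r * \<bar>x\<bar> ^ 2) / 6"
      using yr by (intro divide_right_mono mult_right_mono) auto
    also have "\<dots> \<le> 2 * r * x\<^sup>2" using r by simp
    finally have "\<bar>sin (y * x) - y * trunc x\<bar> \<le> 2 * r * min 1 (x\<^sup>2)"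
      using True abs_square_le_1[of x] by (simp add: trunc_id min_def)
    then show ?thesis by (smt (verit) zero_le_power2)
  next
    case False
    then have m: "min 1 (x\<^sup>2) = 1" using abs_square_le_1[of x] by simp
    have s: "\<bar>sin (y * x)\<bar> \<le> r + min 1 ((r * x)\<^sup>2)"
    proof (cases "(r * x)\<^sup>2 \<ge> 1")
      case True then show ?thesis using r(1) abs_sin_le_one[of "y * x"] unfolding min_absorb1[OF True] by linarith
    next
      case False
      have "\<bar>sin (y * x)\<bar> \<le> \<bar>y * x\<bar>" by (rule abs_sin_x_le_abs_x)
      also have "\<dots> = r * \<bar>r * x\<bar>" using r by (simp add: abs_mult power2_eq_square)
      also have "\<dots> \<le> r * 1"
        using False r abs_square_le_1[of "r * x"] by (intro mult_left_mono) auto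
      finally show ?thesis by (simp add: min_def add_increasing2)
    qed
    have "\<bar>y * trunc x\<bar> \<le> r * 1"
      unfolding abs_mult using yr abs_trunc_le(1) r by (intro mult_mono) auto
    then show ?thesis using s m abs_triangle_ineq4[of "sin (y * x)" "y * trunc x"] by simp
  qed
  then show ?thesis by (simp add: r_def)
qed

section \<open>The exponent of a single Levy-Khintchine triplet\<close>

locale levy_khintchine =
  fixes b1 b2 a :: real and m :: "(real \<times> real) measure"
  assumes b1_nonneg: "b1 \<ge> 0" and a_nonneg: "a \<ge> 0"
    and sets_m: "sets m = sets borel_D" and sigma_finite_m: "sigma_finite_measure m"
    and nn_integral_m: "(\<integral>\<^sup>+ \<xi>. ennreal (trunc (fst \<xi>) + (trunc (snd \<xi>))\<^sup>2) \<partial>m) < \<infinity>"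
begin

sublocale m: sigma_finite_measure m by (rule sigma_finite_m)

definition integrand :: "complex \<times> complex \<Rightarrow> real \<times> real \<Rightarrow> complex" where
  "integrand u \<xi> = exp (pairing u \<xi>) - 1 - snd u * of_real (trunc (snd \<xi>))"

definition expo :: "complex \<times> complex \<Rightarrow> complex" where
  "expo u = of_real b1 * fst u + of_real b2 * snd u + of_real a * (snd u)\<^sup>2 + (LINT \<xi>|m. integrand u \<xi>)"

text \<open>On \<open>U\<close> this is minus the logarithm of the modulus of the characteristic
  function; the drift \<open>b2\<close> drops out there, because the second coordinate is
  imaginary.\<close>

definition nrm :: "complex \<times> complex \<Rightarrow> real" where
  "nrm u = - Re (expo u)"

text \<open>A measure of size at frequency scale \<open>\<epsilon>\<close> that, unlike
  \<open>nrm\<close> at one frequency, cannot vanish by resonance with jumps on a lattice.\<close>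

definition avg_nrm :: "real \<Rightarrow> real" where
  "avg_nrm \<epsilon> = (LINT s|unit_unif. nrm (0, \<i> * of_real (s * \<epsilon>)))"

lemmas space_m = space_on_D[OF sets_m]

lemma measurable_m: "f \<in> borel \<rightarrow>\<^sub>M N \<Longrightarrow> f \<in> m \<rightarrow>\<^sub>M N"
  by (rule measurable_on_D[OF sets_m])

lemma integrable_m_bound:
  fixes f :: "real \<times> real \<Rightarrow> 'b::{banach, second_countable_topology}"
  assumes "integrable m g" "f \<in> borel_measurable borel" "\<And>\<xi>. \<xi> \<in> D \<Longrightarrow> norm (f \<xi>) \<le> g \<xi>"
  shows "integrable m f"
  by (rule Bochner_Integration.integrable_bound[OF assms(1) measurable_m[OF assms(2)]])
     (auto intro!: AE_I2 order_trans[OF assms(3)] simp: space_m)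

lemma integrable_small: "integrable m (\<lambda>\<xi>. min 1 (fst \<xi>))" "integrable m (\<lambda>\<xi>. min 1 ((snd \<xi>)\<^sup>2))"
proof -
  have int: "integrable m (\<lambda>\<xi>. trunc (fst \<xi>) + (trunc (snd \<xi>))\<^sup>2)"
  proof (rule integrableI_nonneg)
    show "AE \<xi> in m. 0 \<le> trunc (fst \<xi>) + (trunc (snd \<xi>))\<^sup>2"
      by (intro AE_I2) (auto simp: space_m in_D_iff trunc_nonneg)
  qed (use nn_integral_m in \<open>auto intro!: measurable_m borel_measurable_add borel_measurable_power measurable_compose[OF _ borel_measurable_trunc]\<close>)
  show "integrable m (\<lambda>\<xi>. min 1 (fst \<xi>))" "integrable m (\<lambda>\<xi>. min 1 ((snd \<xi>)\<^sup>2))"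
    by (rule integrable_m_bound[OF int]; auto simp: in_D_iff trunc_nonneg trunc_sq)+
qed

lemmas integrable_cos = integrable_one_minus_cos[OF sigma_finite_m sets_m integrable_small(2)]
lemmas integrable_integral_cos = integrable_integral_one_minus_cos[OF sigma_finite_m sets_m integrable_small(2)]
lemmas integral_cos_swap = integral_one_minus_cos_swap[OF sigma_finite_m sets_m integrable_small(2)]
lemmas integrable_wt_m = integrable_wt[OF sigma_finite_m sets_m integrable_small(2)]

lemma integrand_measurable [measurable]: "integrand u \<in> borel_measurable borel"
  unfolding integrand_def pairing_def by measurable

lemma norm_integrand_le:
  assumes u: "u \<in> U" and \<xi>: "\<xi> \<in> D"
  shows "norm (integrand u \<xi>) \<le> (2 + norm (fst u)) * min 1 (fst \<xi>) + (2 + norm (snd u) + (norm (snd u))\<^sup>2) * min 1 ((snd \<xi>)\<^sup>2)"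
proof -
  obtain u1 u2 x y where eq: "u = (u1, u2)" "\<xi> = (x, y)" by fastforce
  have h: "Re u1 \<le> 0" "Re u2 = 0" "x \<ge> 0" using u \<xi> by (auto simp: eq in_U_iff in_D_iff)
  define s where "s = Im u2"
  have u2: "u2 = \<i> * of_real s" using h by (simp add: s_def complex_eq_iff)
  \<comment> \<open>The first coordinate needs no compensation and is integrable at first order; the
    remainder is the compensated exponential of the second coordinate alone, of second order near
    0.\<close>
  have split: "integrand u \<xi> = (exp (u1 * of_real x) - 1) * exp (u2 * of_real y) + (exp (u2 * of_real y) - 1 - u2 * of_real (trunc y))"
    by (simp add: integrand_def eq pairing_def exp_add algebra_simps)
  have e2: "norm (exp (u2 * of_real y)) = 1" using h by simp
  have A: "norm (exp (u1 * of_real x) - 1) \<le> (2 + norm u1) * min 1 x"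
  proof -
    have "norm (exp (u1 * of_real x) - exp 0) \<le> norm (u1 * of_real x - 0)"
      using h by (intro norm_exp_diff_le) (auto simp: mult_nonpos_nonneg)
    then have 1: "norm (exp (u1 * of_real x) - 1) \<le> norm u1 * x" using h by (simp add: norm_mult)
    have "norm (exp (u1 * of_real x)) \<le> 1" using h by (simp add: mult_nonpos_nonneg)
    then have 2: "norm (exp (u1 * of_real x) - 1) \<le> 2"
      using norm_triangle_ineq4[of "exp (u1 * of_real x)" 1] by (simp del: norm_exp_eq_Re)
    show ?thesis
    proof (cases "x \<le> 1")
      case True
      then have "norm u1 * x \<le> (2 + norm u1) * x" using h by (intro mult_right_mono) auto
      then show ?thesis using 1 True by simp
    qed (use 2 in \<open>simp add: add_increasing2\<close>)
  qed
  have B: "norm (exp (u2 * of_real y) - 1 - u2 * of_real (trunc y)) \<le> (2 + norm u2 + (norm u2)\<^sup>2) * min 1 (y\<^sup>2)"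
  proof (cases "\<bar>y\<bar> \<le> 1")
    case True
    have "norm (exp (\<i> * of_real (s * y)) - 1 - \<i> * of_real (s * y)) \<le> (s * y)\<^sup>2 / 2" by (rule iexp_bounds(4))
    then have "norm (exp (u2 * of_real y) - 1 - u2 * of_real (trunc y)) \<le> s\<^sup>2 * y\<^sup>2 / 2"
      using True by (simp add: trunc_id u2 power_mult_distrib mult.assoc)
    also have "\<dots> \<le> s\<^sup>2 * y\<^sup>2" by simp
    also have "\<dots> \<le> (2 + norm u2 + (norm u2)\<^sup>2) * y\<^sup>2"
      by (intro mult_right_mono) (auto simp: u2 norm_mult)
    finally show ?thesis using True abs_square_le_1[of y] by simp
  next
    case False
    have "norm (exp (u2 * of_real y) - 1 - u2 * of_real (trunc y)) \<le> norm (exp (u2 * of_real y) - 1) + norm (u2 * of_real (trunc y))"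
      by (rule norm_triangle_ineq4)
    also have "\<dots> \<le> (norm (exp (u2 * of_real y)) + norm (1::complex)) + norm u2 * 1"
      using abs_trunc_le(1)[of y] by (intro add_mono norm_triangle_ineq4) (auto simp: norm_mult intro!: mult_left_le)
    also have "\<dots> = 2 + norm u2" unfolding e2 by simp
    also have "\<dots> \<le> 2 + norm u2 + (norm u2)\<^sup>2" by simp
    finally show ?thesis using False abs_square_le_1[of y] by simp
  qed
  have "norm (integrand u \<xi>) \<le> norm (exp (u1 * of_real x) - 1) * norm (exp (u2 * of_real y)) + norm (exp (u2 * of_real y) - 1 - u2 * of_real (trunc y))"
    unfolding split norm_mult[symmetric] by (rule norm_triangle_ineq)
  then show ?thesis using A B e2 by (simp add: eq del: norm_exp_eq_Re)
qed

lemma integrable_integrand: "u \<in> U \<Longrightarrow> integrable m (integrand u)"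
  by (rule integrable_m_bound[OF _ integrand_measurable norm_integrand_le])
     (intro Bochner_Integration.integrable_add integrable_mult_right integrable_small)

lemma expo_zero [simp]: "expo 0 = 0"
  by (simp add: expo_def integrand_def)

lemma continuous_on_expo: "continuous_on U expo"
proof -
  have "continuous_on U (\<lambda>u. LINT \<xi>|m. integrand u \<xi>)"
  proof (rule continuous_on_sequentiallyI)
    fix u :: "nat \<Rightarrow> complex \<times> complex" and v
    assume u: "\<forall>n. u n \<in> U" and v: "v \<in> U" and lim: "u \<longlonglongrightarrow> v"
    obtain R where R: "\<And>n. norm (u n) \<le> R"
      using convergent_imp_Bseq[OF convergentI[OF lim]] by (auto simp: Bseq_def)
    have n: "norm (fst (u n)) \<le> R" "norm (snd (u n)) \<le> R" for n
      using R[of n] norm_fst_le[of "fst (u n)" "snd (u n)"] norm_snd_le[of "snd (u n)" "fst (u n)"] by auto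
    have R0: "0 \<le> R" using R[of 0] norm_ge_zero order_trans by blast
    show "(\<lambda>n. LINT \<xi>|m. integrand (u n) \<xi>) \<longlonglongrightarrow> (LINT \<xi>|m. integrand v \<xi>)"
    proof (rule integral_dominated_convergence[where w = "\<lambda>\<xi>. (2 + R) * min 1 (fst \<xi>) + (2 + R + R\<^sup>2) * min 1 ((snd \<xi>)\<^sup>2)"])
      show "integrable m (\<lambda>\<xi>. (2 + R) * min 1 (fst \<xi>) + (2 + R + R\<^sup>2) * min 1 ((snd \<xi>)\<^sup>2))"
        by (intro Bochner_Integration.integrable_add integrable_mult_right integrable_small)
      show "AE \<xi> in m. (\<lambda>n. integrand (u n) \<xi>) \<longlonglongrightarrow> integrand v \<xi>"
        unfolding integrand_def pairing_def using lim by (intro AE_I2 tendsto_intros)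
      show "AE \<xi> in m. norm (integrand (u n) \<xi>) \<le> (2 + R) * min 1 (fst \<xi>) + (2 + R + R\<^sup>2) * min 1 ((snd \<xi>)\<^sup>2)" for n
      proof (rule AE_I2)
        fix \<xi> assume "\<xi> \<in> space m"
        then have \<xi>: "\<xi> \<in> D" by (simp add: space_m)
        show "norm (integrand (u n) \<xi>) \<le> (2 + R) * min 1 (fst \<xi>) + (2 + R + R\<^sup>2) * min 1 ((snd \<xi>)\<^sup>2)"
          by (rule order_trans[OF norm_integrand_le[OF u[rule_format] \<xi>]])
            (use n \<xi> R0 in \<open>auto intro!: add_mono mult_right_mono power_mono simp: in_D_iff\<close>)
      qed
    qed (auto intro!: measurable_m)
  qed
  then show ?thesis unfolding expo_def by (intro continuous_intros)
qed

lemma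
  assumes u: "u \<in> U"
  shows nrm_eq: "nrm u = - b1 * Re (fst u) + a * (Im (snd u))\<^sup>2 + (LINT \<xi>|m. 1 - Re (exp (pairing u \<xi>)))"
    and integrable_one_minus_Re: "integrable m (\<lambda>\<xi>. 1 - Re (exp (pairing u \<xi>)))"
proof -
  have r: "Re (snd u) = 0" using u by (simp add: U_def)
  have Re: "Re (integrand u \<xi>) = - (1 - Re (exp (pairing u \<xi>)))" for \<xi>
    by (simp add: integrand_def r)
  have "integrable m (\<lambda>\<xi>. - Re (integrand u \<xi>))"
    using integrable_integrand[OF u] by simp
  then show "integrable m (\<lambda>\<xi>. 1 - Re (exp (pairing u \<xi>)))"
    by (simp add: Re)
  have "Re (LINT \<xi>|m. integrand u \<xi>) = (LINT \<xi>|m. Re (integrand u \<xi>))"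
    using integrable_integrand[OF u] by simp
  also have "\<dots> = (LINT \<xi>|m. - (1 - Re (exp (pairing u \<xi>))))"
    unfolding Re ..
  also have "\<dots> = - (LINT \<xi>|m. 1 - Re (exp (pairing u \<xi>)))"
    by (rule Bochner_Integration.integral_minus)
  finally show "nrm u = - b1 * Re (fst u) + a * (Im (snd u))\<^sup>2 + (LINT \<xi>|m. 1 - Re (exp (pairing u \<xi>)))"
    by (simp add: nrm_def expo_def r power2_eq_square)
qed

lemma one_minus_Re_nonneg: "u \<in> U \<Longrightarrow> \<xi> \<in> D \<Longrightarrow> 0 \<le> 1 - Re (exp (pairing u \<xi>))"
  using norm_exp_pairing_le[of u \<xi>] complex_Re_le_cmod[of "exp (pairing u \<xi>)"] by linarith

lemma nrm_nonneg: "u \<in> U \<Longrightarrow> 0 \<le> nrm u"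
  unfolding nrm_eq using b1_nonneg a_nonneg one_minus_Re_nonneg[of u]
  by (intro add_nonneg_nonneg integral_nonneg_AE AE_I2)
     (auto simp: space_m U_def mult_nonneg_nonpos)

lemma nrm_le_norm: "nrm u \<le> norm (expo u)"
  unfolding nrm_def using abs_Re_le_cmod[of "expo u"] by linarith

text \<open>In \<open>expo (u + v) - expo u - expo v\<close> the drift and the compensator cancel.\<close>

lemma expo_add_le:
  assumes u: "u \<in> U" and v: "v \<in> U" and c: "c > 0"
  shows "norm (expo (u + v) - expo u - expo v) \<le> c * nrm u + nrm v / c"
proof -
  let ?e = "\<lambda>u \<xi>. exp (pairing u \<xi>)"
  have r: "Re (snd u) = 0" "Re (snd v) = 0" using u v by (simp_all add: U_def)
  have prod: "integrand (u + v) \<xi> - integrand u \<xi> - integrand v \<xi> = (?e u \<xi> - 1) * (?e v \<xi> - 1)" for \<xi>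
    by (simp add: integrand_def pairing_add exp_add algebra_simps)
  have ints: "integrable m (integrand (u + v))" "integrable m (integrand u)" "integrable m (integrand v)"
    using u v add_in_U integrable_integrand by auto
  have "(LINT \<xi>|m. integrand (u + v) \<xi>) - (LINT \<xi>|m. integrand u \<xi>) - (LINT \<xi>|m. integrand v \<xi>)
     = (LINT \<xi>|m. (?e u \<xi> - 1) * (?e v \<xi> - 1))"
    unfolding prod[symmetric] using ints by (simp add: Bochner_Integration.integral_diff)
  then have eq: "expo (u + v) - expo u - expo v = of_real (2 * a) * (snd u * snd v) + (LINT \<xi>|m. (?e u \<xi> - 1) * (?e v \<xi> - 1))"
    by (simp add: expo_def algebra_simps power2_eq_square)
  \<comment> \<open>The weight \<open>c\<close> remains free: it will be small against the bounded
    \<open>nrm u\<close>, while \<open>nrm v\<close> is made small afterwards to pay for the factor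
    1/c.\<close>
  have am_gm: "p * q \<le> c * p\<^sup>2 / 2 + q\<^sup>2 / c / 2" for p q :: real
  proof -
    have "0 \<le> (c * p - q)\<^sup>2 / (2 * c)" using c by simp
    also have "\<dots> = c * p\<^sup>2 / 2 + q\<^sup>2 / c / 2 - p * q" using c by (simp add: power2_eq_square field_simps)
    finally show ?thesis by simp
  qed
  have A: "norm (of_real (2 * a) * (snd u * snd v)) \<le> c * (a * (Im (snd u))\<^sup>2) + a * (Im (snd v))\<^sup>2 / c"
  proof -
    have "norm (snd u) = \<bar>Im (snd u)\<bar>" "norm (snd v) = \<bar>Im (snd v)\<bar>" using r by (simp_all add: cmod_def)
    then have "norm (of_real (2 * a) * (snd u * snd v)) = 2 * a * (\<bar>Im (snd u)\<bar> * \<bar>Im (snd v)\<bar>)"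
      using a_nonneg by (simp add: norm_mult)
    also have "\<dots> \<le> 2 * a * (c * \<bar>Im (snd u)\<bar>\<^sup>2 / 2 + \<bar>Im (snd v)\<bar>\<^sup>2 / c / 2)"
      using a_nonneg by (intro mult_left_mono am_gm) auto
    finally show ?thesis by (simp add: algebra_simps)
  qed
  have B: "norm (LINT \<xi>|m. (?e u \<xi> - 1) * (?e v \<xi> - 1)) \<le> (LINT \<xi>|m. c * (1 - Re (?e u \<xi>)) + (1 - Re (?e v \<xi>)) / c)"
  proof (rule order_trans[OF integral_norm_bound], rule integral_mono_AE')
    show "integrable m (\<lambda>\<xi>. c * (1 - Re (?e u \<xi>)) + (1 - Re (?e v \<xi>)) / c)"
      using integrable_one_minus_Re[OF u] integrable_one_minus_Re[OF v]
      by (intro Bochner_Integration.integrable_add integrable_mult_right integrable_divide) auto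
    have *: "norm ((?e u \<xi> - 1) * (?e v \<xi> - 1)) \<le> c * (1 - Re (?e u \<xi>)) + (1 - Re (?e v \<xi>)) / c"
      if \<xi>: "\<xi> \<in> D" for \<xi>
    proof -
      have "norm ((?e u \<xi> - 1) * (?e v \<xi> - 1)) \<le> c * (norm (?e u \<xi> - 1))\<^sup>2 / 2 + (norm (?e v \<xi> - 1))\<^sup>2 / c / 2"
        unfolding norm_mult by (rule am_gm)
      also have "\<dots> \<le> c * (2 * (1 - Re (?e u \<xi>))) / 2 + (2 * (1 - Re (?e v \<xi>))) / c / 2"
        using c norm_minus_one_sq_le[OF norm_exp_pairing_le[OF u \<xi>]] norm_minus_one_sq_le[OF norm_exp_pairing_le[OF v \<xi>]]
        by (intro add_mono divide_right_mono mult_left_mono) auto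
      also have "\<dots> = c * (1 - Re (?e u \<xi>)) + (1 - Re (?e v \<xi>)) / c"
        using c by (simp add: field_simps)
      finally show ?thesis .
    qed
    show "AE \<xi> in m. norm ((?e u \<xi> - 1) * (?e v \<xi> - 1)) \<le> c * (1 - Re (?e u \<xi>)) + (1 - Re (?e v \<xi>)) / c"
      using * by (intro AE_I2) (simp add: space_m)
    show "AE \<xi> in m. 0 \<le> c * (1 - Re (?e u \<xi>)) + (1 - Re (?e v \<xi>)) / c"
      using c one_minus_Re_nonneg[OF u] one_minus_Re_nonneg[OF v]
      by (intro AE_I2 add_nonneg_nonneg mult_nonneg_nonneg divide_nonneg_pos) (auto simp: space_m)
  qed
  have C: "(LINT \<xi>|m. c * (1 - Re (?e u \<xi>)) + (1 - Re (?e v \<xi>)) / c)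
    = c * (LINT \<xi>|m. 1 - Re (?e u \<xi>)) + (LINT \<xi>|m. 1 - Re (?e v \<xi>)) / c"
    using integrable_one_minus_Re[OF u] integrable_one_minus_Re[OF v] 
    by (subst Bochner_Integration.integral_add) auto
  have "norm (expo (u + v) - expo u - expo v) \<le> norm (of_real (2 * a) * (snd u * snd v)) + norm (LINT \<xi>|m. (?e u \<xi> - 1) * (?e v \<xi> - 1))"
    unfolding eq by (rule norm_triangle_ineq)
  also have "\<dots> \<le> c * (a * (Im (snd u))\<^sup>2 + (LINT \<xi>|m. 1 - Re (?e u \<xi>))) + (a * (Im (snd v))\<^sup>2 + (LINT \<xi>|m. 1 - Re (?e v \<xi>))) / c"
    using A B C by (simp add: algebra_simps add_divide_distrib)
  also have "\<dots> \<le> c * nrm u + nrm v / c"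
    using c b1_nonneg u v unfolding nrm_eq[OF u] nrm_eq[OF v]
    by (intro add_mono mult_left_mono divide_right_mono) (auto simp: U_def mult_nonneg_nonpos)
  finally show ?thesis .
qed

section \<open>Estimates along the first axis\<close>

lemma
  assumes "l \<ge> 0"
  shows nrm_fst: "nrm (- of_real l, 0) = b1 * l + (LINT \<xi>|m. 1 - exp (- (l * fst \<xi>)))"
    and integrable_fst_exp: "integrable m (\<lambda>\<xi>. 1 - exp (- (l * fst \<xi>)))"
proof -
  have u: "(- of_real l, 0) \<in> U" using assms by (simp add: in_U_iff)
  have e: "Re (exp (pairing (- of_real l, 0) \<xi>)) = exp (- (l * fst \<xi>))" for \<xi>
    by (simp add: pairing_def Re_exp)
  show "nrm (- of_real l, 0) = b1 * l + (LINT \<xi>|m. 1 - exp (- (l * fst \<xi>)))"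
    using nrm_eq[OF u] by (simp add: e)
  show "integrable m (\<lambda>\<xi>. 1 - exp (- (l * fst \<xi>)))"
    using integrable_one_minus_Re[OF u] by (simp add: e)
qed

lemma nrm_fst_mono:
  assumes "0 \<le> k" "k \<le> l"
  shows "nrm (- of_real k, 0) \<le> nrm (- of_real l, 0)"
proof -
  have "(LINT \<xi>|m. 1 - exp (- (k * fst \<xi>))) \<le> (LINT \<xi>|m. 1 - exp (- (l * fst \<xi>)))"
    using assms integrable_fst_exp by (intro integral_mono) (auto simp: space_m in_D_iff mult_right_mono)
  moreover have "b1 * k \<le> b1 * l" using assms b1_nonneg by (intro mult_left_mono)
  ultimately show ?thesis using assms nrm_fst by simp
qed

lemma nrm_fst_third:
  assumes "0 \<le> l"
  shows "nrm (- of_real l, 0) / 3 \<le> nrm (- of_real (l / 3), 0)"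
proof -
  have "(LINT \<xi>|m. (1 - exp (- (l * fst \<xi>))) / 3) \<le> (LINT \<xi>|m. 1 - exp (- (l / 3 * fst \<xi>)))"
  proof (rule integral_mono)
    fix \<xi> assume "\<xi> \<in> space m"
    then have "0 \<le> l * fst \<xi>" using assms by (simp add: space_m in_D_iff)
    from one_minus_exp_third_ge[OF this] show "(1 - exp (- (l * fst \<xi>))) / 3 \<le> 1 - exp (- (l / 3 * fst \<xi>))"
      by simp
  qed (use assms integrable_fst_exp[of l] integrable_fst_exp[of "l / 3"] in auto)
  then show ?thesis using nrm_fst[OF assms] nrm_fst[of "l / 3"] assms by (simp add: add_divide_distrib)
qed

text \<open>The factor exp (v2 y) has modulus 1, so the second coordinate disappears from the bound
  and \<open>norm_exp_minus_one_le\<close> leaves the exponent at the real point -\<delta>. Bounds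
  on the first axis thus absorb the first coordinate produced by the flow.\<close>

lemma expo_fst_perturb:
  assumes u: "(v1, v2) \<in> U" and \<delta>: "norm v1 \<le> \<delta>"
  shows "norm (expo (v1, v2) - expo (0, v2)) \<le> 4 * nrm (- of_real \<delta>, 0)"
proof -
  have u0: "(0, v2) \<in> U" and r: "Re v1 \<le> 0" "Re v2 = 0" using u by (auto simp: in_U_iff)
  have \<delta>0: "0 \<le> \<delta>" using \<delta> norm_ge_zero order_trans by blast
  let ?g = "\<lambda>\<xi>. (exp (v1 * of_real (fst \<xi>)) - 1) * exp (v2 * of_real (snd \<xi>))"
  have "integrand (v1, v2) \<xi> - integrand (0, v2) \<xi> = ?g \<xi>" for \<xi>
    by (simp add: integrand_def pairing_def exp_add algebra_simps)
  then have "(LINT \<xi>|m. integrand (v1, v2) \<xi>) - (LINT \<xi>|m. integrand (0, v2) \<xi>) = (LINT \<xi>|m. ?g \<xi>)"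
    using integrable_integrand[OF u] integrable_integrand[OF u0]
    by (simp flip: Bochner_Integration.integral_diff)
  then have eq: "expo (v1, v2) - expo (0, v2) = of_real b1 * v1 + (LINT \<xi>|m. ?g \<xi>)"
    by (simp add: expo_def algebra_simps)
  have *: "norm (?g \<xi>) \<le> 4 * (1 - exp (- (\<delta> * fst \<xi>)))" if "\<xi> \<in> D" for \<xi>
    using norm_exp_minus_one_le[OF r(1) \<delta>, of "fst \<xi>"] that r by (simp add: norm_mult in_D_iff)
  have "norm (LINT \<xi>|m. ?g \<xi>) \<le> (LINT \<xi>|m. 4 * (1 - exp (- (\<delta> * fst \<xi>))))"
  proof (rule order_trans[OF integral_norm_bound], rule integral_mono_AE')
    show "integrable m (\<lambda>\<xi>. 4 * (1 - exp (- (\<delta> * fst \<xi>))))"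
      using integrable_fst_exp[OF \<delta>0] by (rule integrable_mult_right)
    show "AE \<xi> in m. norm (?g \<xi>) \<le> 4 * (1 - exp (- (\<delta> * fst \<xi>)))"
      using * by (intro AE_I2) (simp add: space_m)
    show "AE \<xi> in m. 0 \<le> 4 * (1 - exp (- (\<delta> * fst \<xi>)))"
      using \<delta>0 by (intro AE_I2) (simp add: space_m in_D_iff)
  qed
  moreover have "norm (of_real b1 * v1) \<le> 4 * (b1 * \<delta>)"
  proof -
    have "norm (of_real b1 * v1) \<le> b1 * \<delta>"
      using b1_nonneg \<delta> by (simp add: norm_mult mult_left_mono)
    also have "\<dots> \<le> 4 * (b1 * \<delta>)" using b1_nonneg \<delta>0 by simp
    finally show ?thesis .
  qed
  ultimately show ?thesis
    unfolding eq nrm_fst[OF \<delta>0] integral_mult_right_zero distrib_left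
    by (intro order_trans[OF norm_triangle_ineq] add_mono)
qed

section \<open>Estimates along the second axis\<close>

lemma nrm_snd: "nrm (0, \<i> * of_real y) = a * y\<^sup>2 + (LINT \<xi>|m. 1 - cos (y * snd \<xi>))"
proof -
  have u: "(0, \<i> * of_real y) \<in> U" by (simp add: in_U_iff)
  have e: "Re (exp (pairing (0, \<i> * of_real y) \<xi>)) = cos (y * snd \<xi>)" for \<xi>
    by (simp add: pairing_def Re_exp)
  show ?thesis using nrm_eq[OF u] by (simp add: e)
qed

lemma
  shows avg_nrm_eq: "avg_nrm \<epsilon> = a * \<epsilon>\<^sup>2 / 3 + (LINT \<xi>|m. wt (\<epsilon> * snd \<xi>))"
    and integrable_nrm_snd: "integrable unit_unif (\<lambda>s. nrm (0, \<i> * of_real (s * \<epsilon>)))"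
proof -
  have eq: "nrm (0, \<i> * of_real (s * \<epsilon>)) = a * \<epsilon>\<^sup>2 * s\<^sup>2 + (LINT \<xi>|m. 1 * (1 - cos (s * (\<epsilon> * snd \<xi>))))" for s
    unfolding nrm_snd by (simp add: power_mult_distrib mult.assoc)
  have I1: "integrable unit_unif (\<lambda>s. a * \<epsilon>\<^sup>2 * s\<^sup>2)"
    by (intro integrable_mult_right integrable_unit_unif continuous_intros)
  have I2: "integrable unit_unif (\<lambda>s. LINT \<xi>|m. 1 * (1 - cos (s * (\<epsilon> * snd \<xi>))))"
    using integrable_integral_cos[of "\<lambda>_. 1" 1 \<epsilon>] by simp
  show "integrable unit_unif (\<lambda>s. nrm (0, \<i> * of_real (s * \<epsilon>)))"
    unfolding eq using I1 I2 by (rule Bochner_Integration.integrable_add)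
  have "avg_nrm \<epsilon> = (LINT s|unit_unif. a * \<epsilon>\<^sup>2 * s\<^sup>2) + (LINT s|unit_unif. LINT \<xi>|m. 1 * (1 - cos (s * (\<epsilon> * snd \<xi>))))"
    unfolding avg_nrm_def eq using I1 I2 by (rule Bochner_Integration.integral_add)
  then show "avg_nrm \<epsilon> = a * \<epsilon>\<^sup>2 / 3 + (LINT \<xi>|m. wt (\<epsilon> * snd \<xi>))"
    using integral_cos_swap[of "\<lambda>_. 1" 1 \<epsilon>] by (simp add: integral_unit_unif_sq)
qed

lemma integrable_min_sq: "integrable m (\<lambda>\<xi>. min 1 ((c * snd \<xi>)\<^sup>2))"
proof (rule integrable_m_bound[OF integrable_mult_right[OF integrable_small(2), of "1 + c\<^sup>2"]])
  fix \<xi> :: "real \<times> real"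
  show "norm (min 1 ((c * snd \<xi>)\<^sup>2)) \<le> (1 + c\<^sup>2) * min 1 ((snd \<xi>)\<^sup>2)"
    using min_sq_scale_le[of c "snd \<xi>"] by simp
qed simp

lemma integral_min_sq_le: "(LINT \<xi>|m. min 1 ((\<epsilon> * snd \<xi>)\<^sup>2)) \<le> 10 * avg_nrm \<epsilon>"
proof -
  have "(LINT \<xi>|m. min 1 ((\<epsilon> * snd \<xi>)\<^sup>2)) \<le> (LINT \<xi>|m. 10 * wt (\<epsilon> * snd \<xi>))"
  proof (rule integral_mono[OF integrable_min_sq])
    show "integrable m (\<lambda>\<xi>. 10 * wt (\<epsilon> * snd \<xi>))"
      using integrable_wt_m[of "\<lambda>_. 1" 1 \<epsilon>] by simp
    fix \<xi> show "min 1 ((\<epsilon> * snd \<xi>)\<^sup>2) \<le> 10 * wt (\<epsilon> * snd \<xi>)"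
      using wt_lower[of "\<epsilon> * snd \<xi>"] by simp
  qed
  moreover have "0 \<le> a * \<epsilon>\<^sup>2" using a_nonneg by simp
  ultimately show ?thesis using avg_nrm_eq[of \<epsilon>] by simp
qed

lemma avg_nrm_nonneg: "0 \<le> avg_nrm \<epsilon>"
  unfolding avg_nrm_eq using a_nonneg wt_nonneg by (intro add_nonneg_nonneg integral_nonneg_AE AE_I2) auto

lemma nrm_snd_le_avg:
  assumes "\<bar>y\<bar> \<le> \<epsilon>"
  shows "nrm (0, \<i> * of_real y) \<le> 20 * avg_nrm \<epsilon>"
proof -
  have "(LINT \<xi>|m. 1 - cos (y * snd \<xi>)) \<le> (LINT \<xi>|m. 20 * wt (\<epsilon> * snd \<xi>))"
  proof (rule integral_mono)
    show "integrable m (\<lambda>\<xi>. 1 - cos (y * snd \<xi>))" "integrable m (\<lambda>\<xi>. 20 * wt (\<epsilon> * snd \<xi>))"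
      using integrable_cos[of "\<lambda>_. 1" 1 y] integrable_wt_m[of "\<lambda>_. 1" 1 \<epsilon>] by simp_all
    fix \<xi>
    have "1 - cos (y * snd \<xi>) \<le> 2 * min 1 ((y * snd \<xi>)\<^sup>2)" by (rule one_minus_cos_le)
    also have "\<dots> \<le> 2 * min 1 ((\<epsilon> * snd \<xi>)\<^sup>2)"
      using assms by (intro mult_left_mono min_sq_mono) (auto simp: abs_mult intro!: mult_right_mono)
    also have "\<dots> \<le> 20 * wt (\<epsilon> * snd \<xi>)"
      using wt_lower[of "\<epsilon> * snd \<xi>"] by simp
    finally show "1 - cos (y * snd \<xi>) \<le> 20 * wt (\<epsilon> * snd \<xi>)" .
  qed
  moreover have "a * y\<^sup>2 \<le> a * \<epsilon>\<^sup>2"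
    using a_nonneg assms power_mono[of "\<bar>y\<bar>" \<epsilon> 2] by (intro mult_left_mono) auto
  moreover have "a * \<epsilon>\<^sup>2 \<le> 20 * (a * \<epsilon>\<^sup>2 / 3)" using a_nonneg by simp
  ultimately show ?thesis unfolding nrm_snd avg_nrm_eq by simp
qed

text \<open>Both sides are compared with min 1 of a square through \<open>wt_upper\<close> and
  \<open>wt_lower\<close>: 80 = 2 * 4 * 10, where 4 comes from z^2 \<ge> 1/4. The Gaussian term
  loses only the factor 4.\<close>

lemma avg_nrm_scale:
  assumes "1 / 2 \<le> z"
  shows "avg_nrm \<epsilon> / 80 \<le> avg_nrm (z * \<epsilon>)"
proof -
  have z2: "1 / 4 \<le> z\<^sup>2" using power_mono[OF assms, of 2] by (simp add: power2_eq_square)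
  have "(LINT \<xi>|m. wt (\<epsilon> * snd \<xi>) / 80) \<le> (LINT \<xi>|m. wt (z * \<epsilon> * snd \<xi>))"
  proof (rule integral_mono)
    show "integrable m (\<lambda>\<xi>. wt (\<epsilon> * snd \<xi>) / 80)" "integrable m (\<lambda>\<xi>. wt (z * \<epsilon> * snd \<xi>))"
      using integrable_wt_m[of "\<lambda>_. 1" 1 \<epsilon>] integrable_wt_m[of "\<lambda>_. 1" 1 "z * \<epsilon>"] by simp_all
    fix \<xi> :: "real \<times> real"
    let ?x = "\<epsilon> * snd \<xi>"
    have "?x\<^sup>2 / 4 \<le> (z * ?x)\<^sup>2"
      using mult_right_mono[OF z2, of "?x\<^sup>2"] by (simp add: power_mult_distrib)
    then have "min 1 (?x\<^sup>2) / 4 \<le> min 1 ((z * ?x)\<^sup>2)" by (auto simp: min_def)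
    moreover have "p / 80 \<le> r" if "p \<le> 2 * q" "q / 4 \<le> s" "s / 10 \<le> r" for p q r s :: real
      using that by linarith
    ultimately show "wt ?x / 80 \<le> wt (z * \<epsilon> * snd \<xi>)"
      using wt_upper[of ?x] wt_lower[of "z * ?x"] unfolding mult.assoc by blast
  qed
  moreover have "a * \<epsilon>\<^sup>2 / 3 / 80 \<le> a * (z * \<epsilon>)\<^sup>2 / 3"
  proof -
    have "a * \<epsilon>\<^sup>2 * (1 / 80) \<le> a * \<epsilon>\<^sup>2 * z\<^sup>2"
      using z2 a_nonneg by (intro mult_left_mono) auto
    then show ?thesis by (simp add: power_mult_distrib mult_ac)
  qed
  ultimately show ?thesis unfolding avg_nrm_eq by (simp add: add_divide_distrib)
qed

lemma
  shows Im_expo_snd: "Im (expo (0, \<i> * of_real y)) = b2 * y + (LINT \<xi>|m. sin (y * snd \<xi>) - y * trunc (snd \<xi>))"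
    and integrable_sin_trunc: "integrable m (\<lambda>\<xi>. sin (y * snd \<xi>) - y * trunc (snd \<xi>))"
proof -
  have u: "(0, \<i> * of_real y) \<in> U" by (simp add: in_U_iff)
  have e: "Im (integrand (0, \<i> * of_real y) \<xi>) = sin (y * snd \<xi>) - y * trunc (snd \<xi>)" for \<xi>
    by (simp add: integrand_def pairing_def Im_exp)
  show "Im (expo (0, \<i> * of_real y)) = b2 * y + (LINT \<xi>|m. sin (y * snd \<xi>) - y * trunc (snd \<xi>))"
    using integrable_integrand[OF u] by (simp add: expo_def power2_eq_square flip: e)
  show "integrable m (\<lambda>\<xi>. sin (y * snd \<xi>) - y * trunc (snd \<xi>))"
    using integrable_Im[OF integrable_integrand[OF u]] by (simp add: e)
qed

lemma Im_expo_snd_le: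
  assumes "0 \<le> y" "y \<le> 2"
  shows "\<bar>Im (expo (0, \<i> * of_real y)) - b2 * y\<bar> \<le> 30 * avg_nrm 1"
proof -
  have "\<bar>LINT \<xi>|m. sin (y * snd \<xi>) - y * trunc (snd \<xi>)\<bar> \<le> (LINT \<xi>|m. 3 * min 1 ((1 * snd \<xi>)\<^sup>2))"
    using sin_minus_trunc_le[OF assms] integrable_sin_trunc[of y] integrable_min_sq[of 1]
    by (intro order_trans[OF integral_abs_bound] integral_mono) auto
  then show ?thesis using Im_expo_snd[of y] integral_min_sq_le[of 1] by simp
qed

text \<open>Integrating \<open>sin_minus_trunc_small\<close> gives a bound in which every term is
  small for small \<open>y\<close>: the first two have an explicit small factor, and the last is
  \<open>avg_nrm\<close> at a small scale.\<close>

lemma Im_expo_snd_small: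
  assumes "\<bar>y\<bar> \<le> 1"
  shows "\<bar>Im (expo (0, \<i> * of_real y))\<bar> \<le> \<bar>b2\<bar> * \<bar>y\<bar> + 20 * sqrt \<bar>y\<bar> * avg_nrm 1 + 10 * avg_nrm (sqrt \<bar>y\<bar>)"
proof -
  let ?r = "sqrt \<bar>y\<bar>"
  have "\<bar>LINT \<xi>|m. sin (y * snd \<xi>) - y * trunc (snd \<xi>)\<bar>
      \<le> (LINT \<xi>|m. 2 * ?r * min 1 ((1 * snd \<xi>)\<^sup>2) + min 1 ((?r * snd \<xi>)\<^sup>2))"
    using sin_minus_trunc_small[OF assms] integrable_sin_trunc[of y] integrable_min_sq[of 1] integrable_min_sq[of ?r]
    by (intro order_trans[OF integral_abs_bound] integral_mono) auto
  also have "\<dots> = 2 * ?r * (LINT \<xi>|m. min 1 ((1 * snd \<xi>)\<^sup>2)) + (LINT \<xi>|m. min 1 ((?r * snd \<xi>)\<^sup>2))"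
    using integrable_min_sq[of 1] integrable_min_sq[of ?r] by (subst Bochner_Integration.integral_add) auto
  also have "\<dots> \<le> 2 * ?r * (10 * avg_nrm 1) + 10 * avg_nrm ?r"
    by (intro add_mono mult_left_mono integral_min_sq_le) auto
  finally have "\<bar>LINT \<xi>|m. sin (y * snd \<xi>) - y * trunc (snd \<xi>)\<bar> \<le> 20 * ?r * avg_nrm 1 + 10 * avg_nrm ?r" by simp
  moreover have "\<bar>Im (expo (0, \<i> * of_real y))\<bar> \<le> \<bar>b2 * y\<bar> + \<bar>LINT \<xi>|m. sin (y * snd \<xi>) - y * trunc (snd \<xi>)\<bar>"
    unfolding Im_expo_snd by (rule abs_triangle_ineq)
  ultimately show ?thesis by (simp add: abs_mult)
qed

end

section \<open>The flow and the functional equation of the exponents\<close>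

lemma eq_zero_of_exp_eq_one:
  fixes w :: complex
  assumes "exp w = 1" "norm w < 1"
  shows "w = 0"
proof -
  have "\<bar>Im w\<bar> < pi"
    using abs_Im_le_cmod[of w] assms(2) pi_gt3 by linarith
  then have "Ln (exp w) = w"
    by (intro Ln_exp) auto
  then show ?thesis using assms(1) by simp
qed

text \<open>Two distinct values of \<open>h\<close> differ by a nonzero multiple of 2 pi i, in
  particular by at least 1, so \<open>h\<close> is constant. This lifts identities between
  characteristic functions to their continuous logarithms.\<close>

lemma zero_of_exp_eq_one_connected:
  fixes h :: "'a::topological_space \<Rightarrow> complex"
  assumes S: "connected S" and h: "continuous_on S h" "\<And>x. x \<in> S \<Longrightarrow> exp (h x) = 1"
    and p: "p \<in> S" "h p = 0" and x: "x \<in> S"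
  shows "h x = 0"
proof -
  have "h constant_on S"
  proof (rule continuous_discrete_range_constant[OF S h(1)])
    fix x assume x: "x \<in> S"
    have "1 \<le> norm (h y - h x)" if "y \<in> S" "h y \<noteq> h x" for y
    proof (rule ccontr)
      assume "\<not> 1 \<le> norm (h y - h x)"
      moreover have "exp (h y - h x) = 1" using h(2) x that by (simp add: exp_diff)
      ultimately have "h y - h x = 0" by (intro eq_zero_of_exp_eq_one) auto
      then show False using that by simp
    qed
    then show "\<exists>e>0. \<forall>y. y \<in> S \<and> h y \<noteq> h x \<longrightarrow> e \<le> norm (h y - h x)"
      by (intro exI[of _ 1]) auto
  qed
  then show ?thesis using p x by (auto simp: constant_on_def)
qed

text \<open>Since exp (h y) stays in the right half-plane, \<open>h\<close> agrees with the
  principal logarithm of exp (h y): the two differ by a continuous function with values in 2 pi i Z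
  that vanishes at \<open>p\<close>.\<close>

lemma norm_le_of_exp_near_one:
  fixes h :: "'a::topological_space \<Rightarrow> complex"
  assumes S: "connected S" and h: "continuous_on S h" "\<And>x. x \<in> S \<Longrightarrow> norm (exp (h x) - 1) \<le> e" and e: "e < 1 / 2"
    and p: "p \<in> S" "h p = 0" and x: "x \<in> S"
  shows "norm (h x) \<le> 2 * e"
proof -
  have Re: "Re (exp (h y)) > 0" if "y \<in> S" for y
    using h(2)[OF that] e abs_Re_le_cmod[of "exp (h y) - 1"] by (simp add: abs_le_iff)
  have "h x - Ln (exp (h x)) = 0"
  proof (rule zero_of_exp_eq_one_connected[OF S _ _ p(1) _ x])
    show "continuous_on S (\<lambda>x. h x - Ln (exp (h x)))"
      using h(1) Re by (intro continuous_intros) (auto simp: complex_nonpos_Reals_iff not_le)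
    show "exp (h y - Ln (exp (h y))) = 1" for y
      by (simp add: exp_diff)
  qed (use p in auto)
  moreover have "norm (Ln (1 + (exp (h x) - 1))) \<le> 2 * norm (exp (h x) - 1)"
    using h(2)[OF x] e by (intro norm_Ln_le) auto
  ultimately show ?thesis using h(2)[OF x] by simp
qed

text \<open>The deviation \<open>d\<close> from the linear function is additive and vanishes at the
  integers, so its values are those on [0, 1] and it is bounded. A bounded additive function is
  0.\<close>

lemma additive_continuous_imp_linear:
  fixes f :: "real \<Rightarrow> real"
  assumes add: "\<And>x y. f (x + y) = f x + f y" and cont: "continuous_on UNIV f"
  shows "f x = x * f 1"
proof -
  define d where "d x = f x - x * f 1" for x
  have d_add: "d (x + y) = d x + d y" for x y
    using add by (simp add: d_def algebra_simps)
  have d0: "d 0 = 0" using d_add[of 0 0] by simp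
  have d_nat: "d (real n * x) = real n * d x" for n x
    by (induction n) (simp_all add: d0 d_add algebra_simps)
  have "d 1 = 0" by (simp add: d_def)
  then have d_nat1: "d (real n) = 0" for n using d_nat[of n 1] by simp
  have d_int: "d (of_int k) = 0" for k
  proof (cases "k \<ge> 0")
    case True then show ?thesis using d_nat1[of "nat k"] by simp
  next
    case False
    have "d (of_int k + real (nat (- k))) = d (of_int k) + d (real (nat (- k)))" by (rule d_add)
    then show ?thesis using d_nat1[of "nat (- k)"] False d0 by simp
  qed
  have "compact (d ` {0..1})"
    unfolding d_def using continuous_on_subset[OF cont]
    by (intro compact_continuous_image continuous_intros) auto
  then obtain B where B: "\<And>y. y \<in> {0..1} \<Longrightarrow> norm (d y) \<le> B"
    using compact_imp_bounded bounded_iff by (metis imageI)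
  have bound: "\<bar>d y\<bar> \<le> B" for y
  proof -
    have "d (of_int \<lfloor>y\<rfloor> + frac y) = d (of_int \<lfloor>y\<rfloor>) + d (frac y)" by (rule d_add)
    then have "d y = d (frac y)" by (simp add: d_int frac_def)
    then show ?thesis using B[of "frac y"] frac_ge_0[of y] less_imp_le[OF frac_lt_1[of y]] by simp
  qed
  have "d x = 0"
  proof (rule ccontr)
    assume "d x \<noteq> 0"
    then obtain n where "B < real n * \<bar>d x\<bar>" using reals_Archimedean3[of "\<bar>d x\<bar>"] by auto
    then show False using bound[of "real n * x"] by (simp add: d_nat abs_mult)
  qed
  then show ?thesis by (simp add: d_def)
qed

text \<open>This is the equality case of the triangle inequality: the integral of |exp - f|^2 is at
  most 2 - 2 |f|^2 = 0, where f is the value of the characteristic function.\<close>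

lemma AE_eq_of_norm_char_fun:
  assumes \<rho>: "\<rho> \<in> prob_D" and u: "u \<in> U" and n: "norm (char_fun \<rho> u) = 1"
  shows "AE \<xi> in \<rho>. exp (pairing u \<xi>) = char_fun \<rho> u"
proof -
  interpret prob_space \<rho> using \<rho> prob_DD by blast
  let ?f = "char_fun \<rho> u" and ?e = "\<lambda>\<xi>. exp (pairing u \<xi>)"
  have ie: "integrable \<rho> (\<lambda>\<xi>. 2 - 2 * Re (?e \<xi> * cnj ?f))"
    using integrable_mult_right[OF integrable_Re[OF integrable_mult_left[OF integrable_exp_pairing[OF \<rho> u]]]]
    by (rule Bochner_Integration.integrable_diff[rotated]) simp
  have le: "(norm (?e \<xi> - ?f))\<^sup>2 \<le> 2 - 2 * Re (?e \<xi> * cnj ?f)" if "\<xi> \<in> D" for \<xi>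
  proof -
    have "(norm (?e \<xi> - ?f))\<^sup>2 = (norm (?e \<xi>))\<^sup>2 - 2 * Re (?e \<xi> * cnj ?f) + (norm ?f)\<^sup>2"
      unfolding cmod_power2 by (simp add: power2_eq_square algebra_simps)
    moreover have "(norm (?e \<xi>))\<^sup>2 \<le> 1"
      using norm_exp_pairing_le[OF u that] by (intro power_le_one) auto
    ultimately show ?thesis using n by simp
  qed
  have "(LINT \<xi>|\<rho>. 2 - 2 * Re (?e \<xi> * cnj ?f)) = 2 - 2 * Re (?f * cnj ?f)"
  proof -
    have "(LINT \<xi>|\<rho>. 2 - 2 * Re (?e \<xi> * cnj ?f)) = 2 - 2 * (LINT \<xi>|\<rho>. Re (?e \<xi> * cnj ?f))"
      using integrable_exp_pairing[OF \<rho> u] prob_space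
      by (subst Bochner_Integration.integral_diff[OF _ integrable_mult_right[OF integrable_Re[OF integrable_mult_left]]]) simp_all
    also have "(LINT \<xi>|\<rho>. Re (?e \<xi> * cnj ?f)) = Re (LINT \<xi>|\<rho>. ?e \<xi> * cnj ?f)"
      using integral_Re[OF integrable_mult_left[OF integrable_exp_pairing[OF \<rho> u]]] by blast
    also have "\<dots> = Re (?f * cnj ?f)"
      by (simp add: char_fun_def)
    finally show ?thesis .
  qed
  also have "?f * cnj ?f = 1" using n complex_norm_square[of ?f] by simp
  also have "2 - 2 * Re 1 = 0" by simp
  finally have int0: "(LINT \<xi>|\<rho>. 2 - 2 * Re (?e \<xi> * cnj ?f)) = 0" .
  have nn: "AE \<xi> in \<rho>. 0 \<le> 2 - 2 * Re (?e \<xi> * cnj ?f)"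
    using le prob_DD(3)[OF \<rho>] zero_le_power2 order_trans by (intro AE_I2) blast
  have "AE \<xi> in \<rho>. 2 - 2 * Re (?e \<xi> * cnj ?f) = 0"
    using integral_nonneg_eq_0_iff_AE[OF ie nn] int0 by simp
  then show ?thesis
  proof (rule AE_mp, intro AE_I2 impI)
    fix \<xi> assume "\<xi> \<in> space \<rho>" and z: "2 - 2 * Re (?e \<xi> * cnj ?f) = 0"
    then have "(norm (?e \<xi> - ?f))\<^sup>2 \<le> 0" using le[of \<xi>] prob_DD(3)[OF \<rho>] by simp
    then show "?e \<xi> = ?f" by simp
  qed
qed

lemma char_fun_add_of_norm_1:
  assumes \<rho>: "\<rho> \<in> prob_D" and u: "u \<in> U" and n: "norm (char_fun \<rho> u) = 1"
  shows "char_fun \<rho> (u + v) = char_fun \<rho> u * char_fun \<rho> v"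
proof -
  have "char_fun \<rho> (u + v) = (LINT \<xi>|\<rho>. char_fun \<rho> u * exp (pairing v \<xi>))"
    unfolding char_fun_def[of \<rho> "u + v"]
  proof (rule integral_cong_AE)
    show "AE \<xi> in \<rho>. exp (pairing (u + v) \<xi>) = char_fun \<rho> u * exp (pairing v \<xi>)"
      using AE_eq_of_norm_char_fun[OF assms] by eventually_elim (simp add: pairing_add exp_add)
  qed (rule prob_D_measurable[OF \<rho>], measurable)+
  then show ?thesis by (simp add: char_fun_def)
qed

text \<open>The predicate \<open>levy_khintchine\<close> puts no condition on the drift and
  therefore does not list it; facts taken from that locale receive \<open>b2 t\<close> by explicit
  instantiation.\<close>

locale sc_semigroup =
  fixes Q :: "real \<Rightarrow> real \<times> real \<Rightarrow> (real \<times> real) measure"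
    and \<psi> :: "real \<Rightarrow> complex \<times> complex \<Rightarrow> complex \<times> complex"
    and \<gamma> :: "real \<Rightarrow> (real \<times> real) measure"
    and b1 b2 a :: "real \<Rightarrow> real"
    and m :: "real \<Rightarrow> (real \<times> real) measure"
  assumes reg: "regular_HA_semigroup Q \<psi>" and SC: "SC_semigroup Q \<gamma>" and wc: "weakly_continuous \<gamma>"
    and LK: "\<And>t. t \<ge> 0 \<Longrightarrow> levy_khintchine (b1 t) (a t) (m t)"
    and char_fun_\<gamma>: "\<And>t u. t \<ge> 0 \<Longrightarrow> u \<in> U \<Longrightarrow>
      char_fun (\<gamma> t) u = exp (levy_khintchine.expo (b1 t) (b2 t) (a t) (m t) u)"
begin

abbreviation "\<phi> t \<equiv> levy_khintchine.expo (b1 t) (b2 t) (a t) (m t)"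
abbreviation "N t \<equiv> levy_khintchine.nrm (b1 t) (b2 t) (a t) (m t)"
abbreviation "E t \<equiv> levy_khintchine.avg_nrm (b1 t) (b2 t) (a t) (m t)"

section \<open>The affine flow and the linearity of its second component\<close>

lemma HA: "HA_semigroup Q \<psi>"
  using reg unfolding regular_HA_semigroup_def by (rule conjunct1)

lemma trans_Q: "transition_semigroup Q"
  using HA unfolding HA_semigroup_def by (rule conjunct1)

lemma Q_kernel: "t \<ge> 0 \<Longrightarrow> Q t \<in> borel_D \<rightarrow>\<^sub>M prob_algebra borel_D"
  by (rule trans_Q[unfolded transition_semigroup_def, THEN conjunct1, rule_format])

lemma Q_prob:
  assumes "t \<ge> 0" "x \<in> D"
  shows "Q t x \<in> prob_D"
  using measurable_space[OF Q_kernel[OF assms(1)], of x] assms(2) by (simp only: space_borel_D)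

lemma Q_zero: "x \<in> D \<Longrightarrow> Q 0 x = return borel_D x"
  using trans_Q[unfolded transition_semigroup_def, THEN conjunct2, THEN conjunct1] by (rule bspec)

lemma char_fun_Q:
  assumes "t \<ge> 0" "x \<in> D" "u \<in> U"
  shows "char_fun (Q t x) u = exp (pairing (\<psi> t u) x)"
proof -
  have "continuous_on U (\<psi> t) \<and> (\<forall>x\<in>D. \<forall>u\<in>U. char_fun (Q t x) u = exp (pairing (\<psi> t u) x))"
    using HA[unfolded HA_semigroup_def, THEN conjunct2, THEN spec, of t] assms(1) by (rule mp)
  then show ?thesis using assms by blast
qed

lemma char_fun_Q_axis:
  assumes "t \<ge> 0" "u \<in> U"
  shows "x \<ge> 0 \<Longrightarrow> char_fun (Q t (x, 0)) u = exp (of_real x * fst (\<psi> t u))"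
    and "char_fun (Q t (0, y)) u = exp (of_real y * snd (\<psi> t u))"
  using assms by (simp_all add: char_fun_Q in_D_iff pairing_def mult.commute)

text \<open>Characteristic functions have modulus at most 1. The starting point (1, 0) gives the
  sign of the first real part; (0, 1) and (0, -1) together force the second real part to be
  0.\<close>

lemma psi_in_U:
  assumes "t \<ge> 0" "u \<in> U"
  shows "\<psi> t u \<in> U"
proof -
  have "norm (char_fun (Q t x) u) \<le> 1" if "x \<in> D" for x
    using assms that by (intro norm_char_fun_le_1 Q_prob)
  from this[of "(1, 0)"] this[of "(0, 1)"] this[of "(0, -1)"] show ?thesis
    using assms by (simp add: char_fun_Q_axis in_D_iff U_def)
qed

lemma Re_psi: "t \<ge> 0 \<Longrightarrow> u \<in> U \<Longrightarrow> Re (fst (\<psi> t u)) \<le> 0" "t \<ge> 0 \<Longrightarrow> u \<in> U \<Longrightarrow> Re (snd (\<psi> t u)) = 0"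
  using psi_in_U[of t u] unfolding U_def by blast+

text \<open>\<open>Q 0 x\<close> is a point mass, which gives exp (x \<psi>) = exp (x u) on both
  axes. All scales \<open>x > 0\<close> are used, so no multiple of 2 pi i is left
  undetermined.\<close>

lemma psi_0_u:
  assumes "u \<in> U"
  shows "\<psi> 0 u = u"
proof (rule prod_eqI)
  have e: "exp (pairing (\<psi> 0 u) x) = exp (pairing u x)" if "x \<in> D" for x
    using char_fun_Q[of 0 x u] assms that by (simp add: Q_zero char_fun_return)
  show "fst (\<psi> 0 u) = fst u"
  proof (rule eq_of_exp_scale_eq)
    fix x :: real assume "x > 0"
    then show "exp (of_real x * fst (\<psi> 0 u)) = exp (of_real x * fst u)"
      using e[of "(x, 0)"] by (simp add: pairing_def in_D_iff mult.commute)
  qed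
  show "snd (\<psi> 0 u) = snd u"
  proof (rule eq_of_exp_scale_eq)
    fix x :: real assume "x > 0"
    then show "exp (of_real x * snd (\<psi> 0 u)) = exp (of_real x * snd u)"
      using e[of "(0, x)"] by (simp add: pairing_def in_D_iff mult.commute)
  qed
qed

lemma psi_t_0:
  assumes "t \<ge> 0"
  shows "\<psi> t 0 = 0"
proof (rule prod_eqI)
  have e: "exp (pairing (\<psi> t 0) x) = 1" if "x \<in> D" for x
    using char_fun_Q[of t x 0] assms that char_fun_zero[OF Q_prob] by simp
  show "fst (\<psi> t 0) = fst 0"
  proof (rule eq_of_exp_scale_eq)
    fix x :: real assume "x > 0"
    then show "exp (of_real x * fst (\<psi> t 0)) = exp (of_real x * fst 0)"
      using e[of "(x, 0)"] by (simp add: pairing_def in_D_iff mult.commute)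
  qed
  show "snd (\<psi> t 0) = snd 0"
  proof (rule eq_of_exp_scale_eq)
    fix x :: real assume "x > 0"
    then show "exp (of_real x * snd (\<psi> t 0)) = exp (of_real x * snd 0)"
      using e[of "(0, x)"] by (simp add: pairing_def in_D_iff mult.commute)
  qed
qed

lemma continuous_on_char_fun_Q:
  assumes "x \<in> D"
  shows "continuous_on ({0..} \<times> U) (\<lambda>p. char_fun (Q (fst p) x) (snd p))"
proof -
  have "weakly_continuous (\<lambda>t. Q t x)" using reg[unfolded regular_HA_semigroup_def, THEN conjunct2, THEN conjunct1] assms by (rule bspec)
  from continuous_on_char_fun[OF Q_prob[OF _ assms] this] show ?thesis
    by (simp add: case_prod_beta)
qed

text \<open>The definition provides continuity in \<open>u\<close> for each fixed time only. Joint
  continuity comes from that of the characteristic functions of \<open>Q t (x, 0)\<close> and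
  \<open>Q t (0, x)\<close>, taken for all \<open>x > 0\<close> so that the logarithms cannot
  wind.\<close>

lemma continuous_on_psi: "continuous_on ({0..} \<times> U) (\<lambda>p. \<psi> (fst p) (snd p))"
proof -
  have p: "fst p \<ge> 0" "snd p \<in> U" if "p \<in> {0..} \<times> U" for p :: "real \<times> complex \<times> complex"
    using that by (simp_all add: mem_Times_iff)
  have "continuous_on ({0..} \<times> U) (\<lambda>p. fst (\<psi> (fst p) (snd p)))"
  proof (rule continuous_on_of_exp_scale)
    fix x :: real assume "x > 0"
    then have "continuous_on ({0..} \<times> U) (\<lambda>p. char_fun (Q (fst p) (x, 0)) (snd p))"
      by (intro continuous_on_char_fun_Q) (simp add: in_D_iff)
    then show "continuous_on ({0..} \<times> U) (\<lambda>p. exp (of_real x * fst (\<psi> (fst p) (snd p))))"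
      by (rule continuous_on_eq) (rule char_fun_Q_axis(1)[OF p less_imp_le[OF \<open>x > 0\<close>]])
  qed (rule Re_psi(1)[OF p])
  moreover have "continuous_on ({0..} \<times> U) (\<lambda>p. snd (\<psi> (fst p) (snd p)))"
  proof (rule continuous_on_of_exp_scale)
    fix x :: real
    have "continuous_on ({0..} \<times> U) (\<lambda>p. char_fun (Q (fst p) (0, x)) (snd p))"
      by (intro continuous_on_char_fun_Q) (simp add: in_D_iff)
    then show "continuous_on ({0..} \<times> U) (\<lambda>p. exp (of_real x * snd (\<psi> (fst p) (snd p))))"
      by (rule continuous_on_eq) (rule char_fun_Q_axis(2)[OF p])
  qed (simp only: Re_psi(2)[OF p] order_refl)
  ultimately have "continuous_on ({0..} \<times> U) (\<lambda>p. (fst (\<psi> (fst p) (snd p)), snd (\<psi> (fst p) (snd p))))"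
    by (rule continuous_on_Pair)
  then show ?thesis unfolding prod.collapse .
qed

lemma continuous_on_psi_compose:
  assumes "continuous_on S f" "continuous_on S g" "\<And>x. x \<in> S \<Longrightarrow> f x \<ge> 0" "\<And>x. x \<in> S \<Longrightarrow> g x \<in> U"
  shows "continuous_on S (\<lambda>x. \<psi> (f x) (g x))"
proof -
  have "(\<lambda>x. (f x, g x)) ` S \<subseteq> {0..} \<times> U"
    using assms(3,4) by auto
  from continuous_on_compose2[OF continuous_on_psi continuous_on_Pair[OF assms(1,2)] this] show ?thesis
    unfolding fst_conv snd_conv .
qed

lemma psi_bounded:
  assumes "T \<ge> 0"
  shows "\<exists>B. \<forall>t\<in>{0..T}. \<forall>u\<in>U. norm u \<le> R \<longrightarrow> norm (\<psi> t u) \<le> B"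
proof -
  have "compact ({0..T} \<times> (U \<inter> cball 0 R))"
    using closed_U by (intro compact_Times compact_Icc closed_Int_compact compact_cball)
  then have "compact ((\<lambda>p. \<psi> (fst p) (snd p)) ` ({0..T} \<times> (U \<inter> cball 0 R)))"
    using continuous_on_psi by (rule compact_continuous_image[rotated, OF _ continuous_on_subset]) auto
  from compact_imp_bounded[OF this] obtain B
    where B: "\<And>p. p \<in> {0..T} \<times> (U \<inter> cball 0 R) \<Longrightarrow> norm (\<psi> (fst p) (snd p)) \<le> B"
    unfolding bounded_iff by blast
  have "norm (\<psi> t u) \<le> B" if "t \<in> {0..T}" "u \<in> U" "norm u \<le> R" for t u
    using B[of "(t, u)"] that by simp
  then show ?thesis by blast
qed

definition z :: "real \<Rightarrow> real" where
  "z t = Im (snd (\<psi> t (0, \<i>)))"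

text \<open>Both \<open>Q t (0, 1)\<close> and \<open>Q t (0, -1)\<close> have characteristic functions of modulus at most one,
  while the product of these functions is one.\<close>

lemma snd_psi:
  assumes t: "t \<ge> 0" and u: "(u1, u2) \<in> U"
  shows "snd (\<psi> t (u1, u2)) = of_real (z t) * u2"
proof -
  have prob: "Q t (0, x) \<in> prob_D" for x
    using t by (intro Q_prob) (simp_all add: in_D_iff)
  have n: "norm (char_fun (Q t (0, x)) u) = 1" if "u \<in> U" for x u
    using Re_psi(2)[OF t that] unfolding char_fun_Q_axis(2)[OF t that] by simp
  have add: "snd (\<psi> t (u + v)) = snd (\<psi> t u) + snd (\<psi> t v)" if "u \<in> U" "v \<in> U" for u v
  proof (rule eq_of_exp_scale_eq)
    fix x :: real
    show "exp (of_real x * snd (\<psi> t (u + v))) = exp (of_real x * (snd (\<psi> t u) + snd (\<psi> t v)))"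
      using char_fun_add_of_norm_1[OF prob that(1) n[OF that(1)], of x v] t that add_in_U
      by (simp add: char_fun_Q_axis distrib_left exp_add)
  qed
  have fst0: "snd (\<psi> t (u1, 0)) = 0" if "Re u1 \<le> 0" for u1
  proof (rule eq_of_exp_scale_eq)
    fix x :: real
    interpret prob_space "Q t (0, x)" using prob prob_DD by blast
    \<comment> \<open>At this frequency the exponential is exp (- fst \<xi>), and modulus 1 forces
      fst \<xi> = 0: the law started on the second axis stays on that axis, so the first frequency
      has no effect.\<close>
    let ?v = "(-1, 0) :: complex \<times> complex"
    have v: "?v \<in> U" "(u1, 0) \<in> U" using that by (simp_all add: in_U_iff)
    have "AE \<xi> in Q t (0, x). exp (pairing (u1, 0) \<xi>) = 1"
      using AE_eq_of_norm_char_fun[OF prob v(1) n[OF v(1)], of x] AE_space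
    proof eventually_elim
      case (elim \<xi>)
      have "norm (exp (pairing ?v \<xi>)) = 1" unfolding elim(1) by (rule n[OF v(1)])
      then have "fst \<xi> = 0" by (simp add: pairing_def)
      then show ?case by (simp add: pairing_def)
    qed
    then have "char_fun (Q t (0, x)) (u1, 0) = (LINT \<xi>|Q t (0, x). 1)"
      unfolding char_fun_def by (intro integral_cong_AE prob_D_measurable[OF prob]) auto
    then show "exp (of_real x * snd (\<psi> t (u1, 0))) = exp (of_real x * 0)"
      using t v prob_space by (simp add: char_fun_Q_axis)
  qed
  define g where "g \<theta> = Im (snd (\<psi> t (0, \<i> * of_real \<theta>)))" for \<theta>
  have iU: "(0, \<i> * of_real \<theta>) \<in> U" for \<theta> by (simp add: in_U_iff)
  have "g \<theta> = \<theta> * g 1" for \<theta>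
  proof (rule additive_continuous_imp_linear)
    show "g (x + y) = g x + g y" for x y
      using add[OF iU[of x] iU[of y]] by (simp add: g_def algebra_simps)
    show "continuous_on UNIV g"
      unfolding g_def
      by (intro continuous_on_Im continuous_on_snd continuous_on_psi_compose t iU) (intro continuous_intros)+
  qed
  moreover have "g 1 = z t" by (simp add: g_def z_def)
  ultimately have g: "g \<theta> = \<theta> * z t" for \<theta> by simp
  have r: "Re u1 \<le> 0" "Re u2 = 0" using u by (simp_all add: in_U_iff)
  have u2: "u2 = \<i> * of_real (Im u2)" using r by (simp add: complex_eq_iff)
  have "snd (\<psi> t (0, u2)) = \<i> * of_real (g (Im u2))"
    using Re_psi(2)[OF t iU[of "Im u2"]] unfolding g_def u2[symmetric]
    by (simp add: complex_eq_iff)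
  moreover have "snd (\<psi> t (u1, u2)) = snd (\<psi> t (u1, 0)) + snd (\<psi> t (0, u2))"
    using add[of "(u1, 0)" "(0, u2)"] r by (simp add: in_U_iff)
  ultimately have "snd (\<psi> t (u1, u2)) = \<i> * of_real (Im u2 * z t)"
    using fst0[OF r(1)] by (simp add: g)
  also have "\<dots> = of_real (z t) * (\<i> * of_real (Im u2))" by simp
  finally show ?thesis unfolding u2[symmetric] .
qed

section \<open>The functional equation of the exponents and continuity in time\<close>

lemma gamma_prob: "t \<ge> 0 \<Longrightarrow> \<gamma> t \<in> prob_D"
  by (rule SC[unfolded SC_semigroup_def, THEN conjunct1, rule_format])

lemma gamma_Q_prob: "r \<ge> 0 \<Longrightarrow> t \<ge> 0 \<Longrightarrow> \<gamma> r \<bind> Q t \<in> prob_D"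
  by (intro bind_in_prob_D gamma_prob Q_kernel)

lemma char_fun_gamma_Q:
  assumes "r \<ge> 0" "t \<ge> 0" "u \<in> U"
  shows "char_fun (\<gamma> r \<bind> Q t) u = exp (\<phi> r (\<psi> t u))"
proof -
  have "char_fun (\<gamma> r \<bind> Q t) u = (LINT x|\<gamma> r. char_fun (Q t x) u)"
    using assms by (intro char_fun_bind gamma_prob Q_kernel)
  also have "\<dots> = char_fun (\<gamma> r) (\<psi> t u)"
    unfolding char_fun_def[of "\<gamma> r"] using assms prob_DD(3)[OF gamma_prob]
    by (intro Bochner_Integration.integral_cong) (auto simp: char_fun_Q)
  also have "\<dots> = exp (\<phi> r (\<psi> t u))"
    by (rule char_fun_\<gamma>[OF assms(1) psi_in_U[OF assms(2,3)]])
  finally show ?thesis .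
qed

lemma phi_t_0: "t \<ge> 0 \<Longrightarrow> \<phi> t 0 = 0"
  using levy_khintchine.expo_zero[OF LK] by simp

lemma continuous_on_phi: "t \<ge> 0 \<Longrightarrow> continuous_on U (\<phi> t)"
  using levy_khintchine.continuous_on_expo[OF LK] by simp

text \<open>The skew convolution equation yields the identity only after exponentiation. Both sides
  are continuous on the connected set \<open>U\<close> and agree at 0, which excludes a multiple of
  2 pi i.\<close>

lemma phi_add:
  assumes r: "r \<ge> 0" and t: "t \<ge> 0" and u: "u \<in> U"
  shows "\<phi> (t + r) u = \<phi> r (\<psi> t u) + \<phi> t u"
proof -
  have "continuous_on U (\<psi> t)"
    using t by (intro continuous_on_psi_compose continuous_on_const continuous_on_id)
  moreover have "\<psi> t ` U \<subseteq> U" using psi_in_U[OF t] by blast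
  ultimately have cpsi: "continuous_on U (\<lambda>u. \<phi> r (\<psi> t u))"
    by (rule continuous_on_compose2[OF continuous_on_phi[OF r]])
  have "\<phi> (t + r) u - (\<phi> r (\<psi> t u) + \<phi> t u) = 0"
  proof (rule zero_of_exp_eq_one_connected[where S = U and p = 0])
    show "connected U" by (rule convex_connected[OF convex_U])
    show "continuous_on U (\<lambda>u. \<phi> (t + r) u - (\<phi> r (\<psi> t u) + \<phi> t u))"
      using r t by (intro continuous_on_diff continuous_on_add cpsi continuous_on_phi) simp_all
    show "exp (\<phi> (t + r) v - (\<phi> r (\<psi> t v) + \<phi> t v)) = 1" if v: "v \<in> U" for v
    proof -
      have "\<gamma> (t + r) = conv_D (\<gamma> r \<bind> Q t) (\<gamma> t)"
        using SC[unfolded SC_semigroup_def, THEN conjunct2, rule_format, OF r t] by (simp only: add.commute)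
      then have "char_fun (\<gamma> (t + r)) v = char_fun (\<gamma> r \<bind> Q t) v * char_fun (\<gamma> t) v"
        using char_fun_conv_D[OF gamma_Q_prob[OF r t] gamma_prob[OF t] v] by simp
      then have "exp (\<phi> (t + r) v) = exp (\<phi> r (\<psi> t v)) * exp (\<phi> t v)"
        using char_fun_\<gamma>[of "t + r" v] char_fun_\<gamma>[of t v] char_fun_gamma_Q[of r t v] r t v by simp
      then show ?thesis by (simp add: exp_diff exp_add)
    qed
    show "\<phi> (t + r) 0 - (\<phi> r (\<psi> t 0) + \<phi> t 0) = 0"
      using phi_t_0[OF r] phi_t_0[OF t] phi_t_0[of "t + r"] r t by (simp add: psi_t_0)
  qed (use u in simp_all)
  then show ?thesis by simp
qed

lemma phi_0_u:
  assumes "u \<in> U"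
  shows "\<phi> 0 u = 0"
proof -
  have "\<phi> (0 + 0) u = \<phi> 0 u + \<phi> 0 u"
    using phi_add[of 0 0 u] assms unfolding psi_0_u[OF assms] by blast
  then show ?thesis unfolding add_0 by (metis add_cancel_left_right)
qed

text \<open>By weak continuity exp (\<phi> r u) is close to 1 uniformly on balls of
  \<open>U\<close>; connectedness of the ball and \<open>\<phi> r 0 = 0\<close> transfer this to the
  logarithm.\<close>

lemma phi_small:
  assumes \<eta>: "\<eta> > 0"
  shows "\<exists>\<delta>>0. \<forall>r\<in>{0..<\<delta>}. \<forall>u\<in>U. norm u \<le> R \<longrightarrow> norm (\<phi> r u) < \<eta>"
proof -
  define e where "e = min (\<eta> / 3) (1 / 3)"
  have e: "e > 0" "e < 1 / 2" "2 * e < \<eta>" using \<eta> by (auto simp: e_def min_def)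
  let ?K = "{0..1::real} \<times> (U \<inter> cball 0 R)"
  have comp: "compact ?K"
    using closed_U by (intro compact_Times compact_Icc closed_Int_compact compact_cball)
  have "continuous_on ?K (\<lambda>(t, u). char_fun (\<gamma> t) u)"
    by (rule continuous_on_subset[OF continuous_on_char_fun[OF gamma_prob wc]]) auto
  then have "uniformly_continuous_on ?K (\<lambda>(t, u). char_fun (\<gamma> t) u)"
    using comp by (rule compact_uniformly_continuous)
  then obtain d where d: "d > 0"
    "\<And>p q. p \<in> ?K \<Longrightarrow> q \<in> ?K \<Longrightarrow> dist q p < d \<Longrightarrow> dist ((\<lambda>(t, u). char_fun (\<gamma> t) u) q) ((\<lambda>(t, u). char_fun (\<gamma> t) u) p) < e"
    unfolding uniformly_continuous_on_def using e(1) by metis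
  show ?thesis
  proof (intro exI[of _ "min d 1"] conjI ballI impI)
    show "0 < min d 1" using d by simp
    fix r u assume r: "r \<in> {0..<min d 1}" and u: "u \<in> U" "norm u \<le> R"
    have "norm (\<phi> r u) \<le> 2 * e"
    proof (rule norm_le_of_exp_near_one[where S = "U \<inter> cball 0 R" and p = 0])
      show "connected (U \<inter> cball 0 R)" by (intro convex_connected convex_Int convex_U convex_cball)
      show "continuous_on (U \<inter> cball 0 R) (\<phi> r)"
        using r by (intro continuous_on_subset[OF continuous_on_phi]) auto
      show "norm (exp (\<phi> r v) - 1) \<le> e" if v: "v \<in> U \<inter> cball 0 R" for v
      proof -
        have "dist (char_fun (\<gamma> r) v) (char_fun (\<gamma> 0) v) < e"
          using d(2)[of "(0, v)" "(r, v)"] r v by (simp add: dist_Pair_Pair dist_real_def)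
        then show ?thesis using r v by (simp add: char_fun_\<gamma> phi_0_u dist_norm)
      qed
      have "0 \<le> R" using u(2) norm_ge_zero order_trans by blast
      then show "0 \<in> U \<inter> cball 0 R" by simp
    qed (use e r u in \<open>auto simp: phi_t_0\<close>)
    then show "norm (\<phi> r u) < \<eta>" using e by simp
  qed
qed

text \<open>On either side of \<open>t\<close> the increment is \<open>\<phi> r\<close> at a flowed
  point, and on a bounded time interval these points stay in one ball, where
  \<open>phi_small\<close> is uniform.\<close>

lemma continuous_on_phi_t:
  assumes u: "u \<in> U"
  shows "continuous_on {0..} (\<lambda>t. \<phi> t u)"
proof (rule continuous_onI)
  fix t e :: real assume t: "t \<in> {0..}" and e: "e > 0"
  obtain R where "\<forall>s\<in>{0..t + 1}. \<forall>v\<in>U. norm v \<le> norm u \<longrightarrow> norm (\<psi> s v) \<le> R"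
    using psi_bounded[of "t + 1" "norm u"] t by auto
  then have R: "\<And>s. s \<in> {0..t + 1} \<Longrightarrow> norm (\<psi> s u) \<le> R"
    using u by blast
  obtain \<delta> where \<delta>: "\<delta> > 0" "\<And>r v. r \<in> {0..<\<delta>} \<Longrightarrow> v \<in> U \<Longrightarrow> norm v \<le> R \<Longrightarrow> norm (\<phi> r v) < e"
    using phi_small[OF e, of R] by auto
  have key: "norm (\<phi> (s + r) u - \<phi> s u) < e" if "s \<in> {0..t + 1}" "r \<in> {0..<\<delta>}" for s r
    using \<delta>(2)[OF that(2) psi_in_U R[OF that(1)]] phi_add[of r s u] that u by simp
  show "\<exists>d>0. \<forall>s\<in>{0..}. dist s t < d \<longrightarrow> dist (\<phi> s u) (\<phi> t u) \<le> e"
  proof (intro exI[of _ "min \<delta> 1"] conjI ballI impI)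
    show "0 < min \<delta> 1" using \<delta> by simp
    fix s assume s: "s \<in> {0..}" "dist s t < min \<delta> 1"
    show "dist (\<phi> s u) (\<phi> t u) \<le> e"
    proof (cases "s \<le> t")
      case True
      then show ?thesis using key[of s "t - s"] s by (simp add: dist_norm norm_minus_commute)
    next
      case False
      then show ?thesis using key[of t "s - t"] s t by (simp add: dist_norm)
    qed
  qed
qed

end

section \<open>Linear bounds for small times\<close>

text \<open>The increments over consecutive spans telescope to a value of \<open>f\<close>, which is
  at most \<open>M\<close>, and there are at least T / r of them. If \<open>A\<close> is not
  positive the claim is trivial, as \<open>M\<close> is nonnegative.\<close>

lemma increment_bound:
  fixes f :: "real \<Rightarrow> real"
  assumes T: "T > 0" and r: "0 < r" "r \<le> T"
    and inc: "\<And>t. 0 \<le> t \<Longrightarrow> t \<le> T \<Longrightarrow> A \<le> f (t + r) - f t"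
    and f0: "f 0 = 0" and M: "\<And>t. 0 \<le> t \<Longrightarrow> t \<le> 2 * T \<Longrightarrow> f t \<le> M"
  shows "A \<le> r * M / T"
proof -
  \<comment> \<open>Then T \<le> n r < T + r \<le> 2 T: every span starts in [0, T] and the last one
    ends before 2 T, which is why \<open>M\<close> bounds \<open>f\<close> on the doubled
    interval.\<close>
  define n where "n = nat \<lceil>T / r\<rceil>"
  have Tr: "T / r \<ge> 1" using r by (simp add: field_simps)
  have n1: "T / r \<le> real n" "real n < T / r + 1"
    using Tr by (auto simp: n_def) linarith+
  then have n: "T \<le> real n * r" "real n * r < T + r" using r by (simp_all add: field_simps)
  have "real n * A = (\<Sum>k<n. A)" by simp
  also have "\<dots> \<le> (\<Sum>k<n. f (real (Suc k) * r) - f (real k * r))"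
  proof (rule sum_mono)
    fix k assume "k \<in> {..<n}"
    then have "real k + 1 \<le> real n" by simp
    then have "real k * r + r \<le> real n * r" using r mult_right_mono[of "real k + 1" "real n" r] by (simp add: distrib_right)
    then have "real k * r \<le> T" using n(2) by linarith
    then show "A \<le> f (real (Suc k) * r) - f (real k * r)"
      using inc[of "real k * r"] r by (simp add: algebra_simps)
  qed
  also have "\<dots> = f (real n * r)" using f0 by (subst sum_lessThan_telescope) simp
  also have "\<dots> \<le> M" using n r by (intro M) auto
  finally have nA: "real n * A \<le> M" .
  have M0: "0 \<le> M" using M[of 0] f0 T by simp
  show ?thesis
  proof (cases "A \<le> 0")
    case True then show ?thesis using M0 r T by (meson divide_nonneg_pos mult_nonneg_nonneg less_imp_le order_trans)
  next
    case False
    have "T / r * A \<le> real n * A" using n1 False by (intro mult_right_mono) auto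
    then have "T / r * A \<le> M" using nA by linarith
    then show ?thesis using T r by (simp add: field_simps)
  qed
qed

lemma norm_fst_snd_le:
  fixes p :: "'a::real_normed_vector \<times> 'b::real_normed_vector"
  shows "norm (fst p) \<le> norm p" "norm (snd p) \<le> norm p"
  using norm_fst_le[of "fst p" "snd p"] norm_snd_le[of "snd p" "fst p"] by simp_all

lemma one_minus_exp_concave:
  fixes l x :: real
  assumes "0 \<le> l" "l \<le> 1"
  shows "l * (1 - exp (- x)) \<le> 1 - exp (- (l * x))"
proof -
  have "convex_on UNIV (exp :: real \<Rightarrow> real)"
    using exp_convex by blast
  from convex_onD[OF this assms, of 0 "- x"] show ?thesis
    by (simp add: algebra_simps)
qed

context sc_semigroup
begin

section \<open>Flow close to the identity and growth of the real parts in time\<close>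

lemma psi_uniform:
  assumes "T \<ge> 0"
  shows "uniformly_continuous_on ({0..T} \<times> (U \<inter> cball 0 R)) (\<lambda>p. \<psi> (fst p) (snd p))"
proof (rule compact_uniformly_continuous)
  show "continuous_on ({0..T} \<times> (U \<inter> cball 0 R)) (\<lambda>p. \<psi> (fst p) (snd p))"
    by (rule continuous_on_subset[OF continuous_on_psi]) auto
  show "compact ({0..T} \<times> (U \<inter> cball 0 R))"
    using closed_U by (intro compact_Times compact_Icc closed_Int_compact compact_cball)
qed

lemma psi_near_initial:
  assumes "\<eta> > 0"
  shows "\<exists>\<delta>>0. \<forall>t\<in>{0..\<delta>}. \<forall>u\<in>U. norm u \<le> R \<longrightarrow> norm (\<psi> t u - u) < \<eta>"
proof -
  obtain d where d: "d > 0" "\<And>p q. p \<in> {0..1} \<times> (U \<inter> cball 0 R) \<Longrightarrow> q \<in> {0..1} \<times> (U \<inter> cball 0 R) \<Longrightarrow>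
      dist q p < d \<Longrightarrow> dist (\<psi> (fst q) (snd q)) (\<psi> (fst p) (snd p)) < \<eta>"
    using psi_uniform[of 1 R] assms unfolding uniformly_continuous_on_def by (metis zero_le_one)
  show ?thesis
  proof (intro exI[of _ "min (d / 2) 1"] conjI ballI impI)
    show "0 < min (d / 2) 1" using d by simp
    fix t u assume t: "t \<in> {0..min (d / 2) 1}" and u: "u \<in> U" "norm u \<le> R"
    have "dist (t, u) (0, u) < d" using t d(1) by (simp add: dist_Pair_Pair dist_real_def)
    from d(2)[OF _ _ this] t u show "norm (\<psi> t u - u) < \<eta>"
      by (simp add: psi_0_u dist_norm)
  qed
qed

lemma psi_near_zero:
  assumes "\<eta> > 0" "T \<ge> 0"
  shows "\<exists>\<delta>>0. \<forall>t\<in>{0..T}. \<forall>u\<in>U. norm u \<le> \<delta> \<longrightarrow> norm (\<psi> t u) < \<eta>"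
proof -
  obtain d where d: "d > 0" "\<And>p q. p \<in> {0..T} \<times> (U \<inter> cball 0 1) \<Longrightarrow> q \<in> {0..T} \<times> (U \<inter> cball 0 1) \<Longrightarrow>
      dist q p < d \<Longrightarrow> dist (\<psi> (fst q) (snd q)) (\<psi> (fst p) (snd p)) < \<eta>"
    using psi_uniform[of T 1] assms unfolding uniformly_continuous_on_def by metis
  show ?thesis
  proof (intro exI[of _ "min (d / 2) 1"] conjI ballI impI)
    show "0 < min (d / 2) 1" using d by simp
    fix t u assume t: "t \<in> {0..T}" and u: "u \<in> U" "norm u \<le> min (d / 2) 1"
    have "dist (t, u) (t, 0) < d" using u(2) d(1) by (simp add: dist_Pair_Pair)
    from d(2)[OF _ _ this] t u show "norm (\<psi> t u) < \<eta>"
      by (simp add: psi_t_0)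
  qed
qed

lemma N_add:
  assumes "r \<ge> 0" "t \<ge> 0" "u \<in> U"
  shows "N (t + r) u = N r (\<psi> t u) + N t u"
  using phi_add[OF assms] levy_khintchine.nrm_def[OF LK] assms by simp

lemma N_nonneg: "t \<ge> 0 \<Longrightarrow> u \<in> U \<Longrightarrow> 0 \<le> N t u"
  by (rule levy_khintchine.nrm_nonneg[OF LK])

lemma N_le_norm: "t \<ge> 0 \<Longrightarrow> N t u \<le> norm (\<phi> t u)"
  by (rule levy_khintchine.nrm_le_norm[OF LK])

lemma N_0: "u \<in> U \<Longrightarrow> N 0 u = 0"
  using levy_khintchine.nrm_def[OF LK, of 0 "b2 0" u] phi_0_u[of u] by simp

lemma N_mono:
  assumes "0 \<le> s" "s \<le> t" "u \<in> U"
  shows "N s u \<le> N t u"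
  using N_add[of "t - s" s u] N_nonneg[of "t - s" "\<psi> s u"] psi_in_U[of s u] assms by simp

lemma continuous_on_N: "t \<ge> 0 \<Longrightarrow> continuous_on U (N t)"
  using levy_khintchine.nrm_def[OF LK, of t "b2 t"] continuous_on_phi[of t]
  by (simp add: fun_eq_iff[symmetric] continuous_on_minus continuous_on_Re)

lemma snd_axis_in_U: "(0, \<i> * of_real y) \<in> U"
  by (simp add: in_U_iff)

lemma fst_axis_in_U: "l \<ge> 0 \<Longrightarrow> (- of_real l, 0) \<in> U"
  by (simp add: in_U_iff)

lemma E_def: "t \<ge> 0 \<Longrightarrow> E t \<epsilon> = (LINT s|unit_unif. N t (0, \<i> * of_real (s * \<epsilon>)))"
  by (rule levy_khintchine.avg_nrm_def[OF LK])

lemma integrable_N_snd: "t \<ge> 0 \<Longrightarrow> integrable unit_unif (\<lambda>s. N t (0, \<i> * of_real (s * \<epsilon>)))"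
  by (rule levy_khintchine.integrable_nrm_snd[OF LK])

lemma E_nonneg: "t \<ge> 0 \<Longrightarrow> 0 \<le> E t \<epsilon>"
  by (rule levy_khintchine.avg_nrm_nonneg[OF LK])

lemma E_mono:
  assumes "0 \<le> s" "s \<le> t"
  shows "E s \<epsilon> \<le> E t \<epsilon>"
proof -
  have t: "0 \<le> t" using assms by simp
  show ?thesis unfolding E_def[OF assms(1)] E_def[OF t]
    by (intro integral_mono integrable_N_snd assms t N_mono snd_axis_in_U)
qed

lemma E_0: "E 0 \<epsilon> = 0"
  unfolding E_def[OF order_refl] N_0[OF snd_axis_in_U] by simp

lemma E_le:
  assumes "t \<ge> 0" "\<epsilon> \<ge> 0" "\<And>y. 0 \<le> y \<Longrightarrow> y \<le> \<epsilon> \<Longrightarrow> N t (0, \<i> * of_real y) \<le> C"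
  shows "E t \<epsilon> \<le> C"
proof -
  have "E t \<epsilon> \<le> (LINT s|unit_unif. C)"
    unfolding E_def[OF assms(1)]
  proof (rule integral_mono[OF integrable_N_snd[OF assms(1)]])
    fix s assume "s \<in> space unit_unif"
    then have "0 \<le> s" "s \<le> 1" by (auto simp: space_restrict_space)
    then show "N t (0, \<i> * of_real (s * \<epsilon>)) \<le> C"
      using assms(2) by (intro assms(3)) (auto intro: mult_left_le_one_le)
  qed simp
  then show ?thesis using unit_unif.prob_space by simp
qed

text \<open>At a real point the characteristic function is a Laplace transform, hence real for every
  starting point (x, 0); so the first component equals its conjugate.\<close>

lemma fst_psi_fst_axis:
  assumes t: "t \<ge> 0" and l: "l \<ge> 0"
  shows "\<exists>k\<ge>0. \<psi> t (- of_real l, 0) = (- of_real k, 0) \<and>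
    (\<forall>x\<ge>0. exp (- (x * k)) = (LINT \<xi>|Q t (x, 0). exp (- (l * fst \<xi>))))"
proof -
  let ?u = "(- of_real l, 0) :: complex \<times> complex"
  have u: "?u \<in> U" using l by (rule fst_axis_in_U)
  let ?c = "fst (\<psi> t ?u)"
  have real: "exp (of_real x * ?c) = of_real (LINT \<xi>|Q t (x, 0). exp (- (l * fst \<xi>)))" if "x \<ge> 0" for x
  proof -
    have "exp (of_real x * ?c) = (LINT \<xi>|Q t (x, 0). exp (pairing ?u \<xi>))"
      using char_fun_Q_axis(1)[OF t u that] by (simp add: char_fun_def)
    also have "\<dots> = (LINT \<xi>|Q t (x, 0). of_real (exp (- (l * fst \<xi>))))"
      by (intro Bochner_Integration.integral_cong refl) (simp add: pairing_def flip: exp_of_real)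
    finally show ?thesis by (simp only: integral_complex_of_real)
  qed
  have "?c = cnj ?c"
  proof (rule eq_of_exp_scale_eq)
    fix x :: real assume "x > 0"
    then have "cnj (exp (of_real x * ?c)) = exp (of_real x * ?c)"
      using real[of x] by simp
    then show "exp (of_real x * ?c) = exp (of_real x * cnj ?c)"
      by (simp add: exp_cnj)
  qed
  then have c: "?c = of_real (Re ?c)" by (simp add: complex_eq_iff)
  show ?thesis
  proof (intro exI[of _ "- Re ?c"] conjI allI impI)
    show "0 \<le> - Re ?c" using Re_psi(1)[OF t u] by simp
    show "\<psi> t ?u = (- of_real (- Re ?c), 0)"
      using c snd_psi[OF t u] by (simp add: prod_eq_iff)
    fix x :: real assume "x \<ge> 0"
    from real[OF this] have "exp (of_real x * of_real (Re ?c)) = complex_of_real (LINT \<xi>|Q t (x, 0). exp (- (l * fst \<xi>)))"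
      using c by simp
    then have "complex_of_real (exp (x * Re ?c)) = complex_of_real (LINT \<xi>|Q t (x, 0). exp (- (l * fst \<xi>)))"
      by (simp flip: exp_of_real)
    then show "exp (- (x * - Re ?c)) = (LINT \<xi>|Q t (x, 0). exp (- (l * fst \<xi>)))"
      by (simp only: of_real_eq_iff) simp
  qed
qed

text \<open>Closeness to the identity up to 1/3 says nothing about small \<open>l\<close>. A bound
  proportional to \<open>l\<close> comes from concavity of 1 - exp (-l x) in \<open>l\<close> under
  \<open>Q t (1, 0)\<close>, anchored at l = 1, where \<open>k1\<close> is at least 2/3 and thus 1 -
  exp (-k1) at least 1/3.\<close>

lemma fst_psi_fst_axis_lower:
  assumes t: "t \<ge> 0" and l: "0 \<le> l" "l \<le> 1" and small: "norm (\<psi> t (-1, 0) - (-1, 0)) < 1 / 3"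
  obtains k where "l / 3 \<le> k" "\<psi> t (- of_real l, 0) = (- of_real k, 0)"
proof -
  obtain k where k: "k \<ge> 0" "\<psi> t (- of_real l, 0) = (- of_real k, 0)"
    "\<forall>x\<ge>0. exp (- (x * k)) = (LINT \<xi>|Q t (x, 0). exp (- (l * fst \<xi>)))"
    using fst_psi_fst_axis[OF t l(1)] by blast
  obtain k1 where k1: "k1 \<ge> 0" "\<psi> t (- of_real 1, 0) = (- of_real k1, 0)"
    "\<forall>x\<ge>0. exp (- (x * k1)) = (LINT \<xi>|Q t (x, 0). exp (- (1 * fst \<xi>)))"
    using fst_psi_fst_axis[OF t zero_le_one] by blast
  have "norm (1 - of_real k1 :: complex) < 1 / 3"
    using small k1(2) by (simp add: norm_Pair)
  then have "\<bar>1 - k1\<bar> < 1 / 3"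
    by (metis norm_of_real of_real_1 of_real_diff)
  then have k1_ge: "2 / 3 \<le> k1" by linarith
  have P: "Q t (1, 0) \<in> prob_D" using t by (intro Q_prob) (simp_all add: in_D_iff)
  interpret prob_space "Q t (1, 0)" using P prob_DD by blast
  have int: "integrable (Q t (1, 0)) (\<lambda>\<xi>. exp (- (c * fst \<xi>)))" if "c \<ge> 0" for c
    using that by (intro integrable_bounded_on_D[OF P, where B = 1]) (auto simp: in_D_iff)
  have I: "(LINT \<xi>|Q t (1, 0). 1 - exp (- (c * fst \<xi>))) = 1 - (LINT \<xi>|Q t (1, 0). exp (- (c * fst \<xi>)))" if "c \<ge> 0" for c
    using int[OF that] prob_space by (subst Bochner_Integration.integral_diff) auto
  have "1 / 3 \<le> min 1 k1 / 2" using k1_ge by simp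
  also have "\<dots> \<le> 1 - exp (- k1)" using k1(1) by (rule one_minus_exp_ge)
  finally have "l * (1 / 3) \<le> l * (1 - exp (- k1))"
    using l(1) by (rule mult_left_mono)
  also have "\<dots> = (LINT \<xi>|Q t (1, 0). l * (1 - exp (- (1 * fst \<xi>))))"
    using k1(3)[rule_format, of 1] I[of 1] by simp
  also have "\<dots> \<le> (LINT \<xi>|Q t (1, 0). 1 - exp (- (l * fst \<xi>)))"
  proof (rule integral_mono)
    show "integrable (Q t (1, 0)) (\<lambda>\<xi>. l * (1 - exp (- (1 * fst \<xi>))))"
      using int[of 1] by simp
    show "integrable (Q t (1, 0)) (\<lambda>\<xi>. 1 - exp (- (l * fst \<xi>)))"
      using int[of l] l by simp
    show "l * (1 - exp (- (1 * fst \<xi>))) \<le> 1 - exp (- (l * fst \<xi>))" for \<xi> :: "real \<times> real"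
      using one_minus_exp_concave[OF l, of "fst \<xi>"] by simp
  qed
  also have "\<dots> = 1 - exp (- k)" using k(3)[rule_format, of 1] I[OF l(1)] by simp
  also have "\<dots> \<le> k" using exp_ge_add_one_self[of "- k"] by simp
  finally have "l / 3 \<le> k" by simp
  then show thesis using k(2) that by blast
qed

end

text \<open>On a short time interval the flow \<open>\<psi>\<close> stays close to the identity, so that the increments of
  \<open>\<phi>\<close> over a time span \<open>r\<close> are comparable with \<open>\<phi> r\<close>; adding up about \<open>T / r\<close> of them shows that
  \<open>\<phi> r\<close> is of order \<open>r\<close>.\<close>

locale sc_semigroup_short = sc_semigroup +
  fixes T :: real
  assumes T_pos: "T > 0"
    and short: "\<And>t u. 0 \<le> t \<Longrightarrow> t \<le> T \<Longrightarrow> u \<in> U \<Longrightarrow> norm u \<le> 1 \<Longrightarrow> norm (\<psi> t u - u) < 1 / 3"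
begin

lemma z_bounds:
  assumes "0 \<le> t" "t \<le> T"
  shows "1 / 2 \<le> z t" "z t \<le> 2"
proof -
  have u: "(0, \<i>) \<in> U" by (simp add: in_U_iff)
  have "norm (snd (\<psi> t (0, \<i>) - (0, \<i>))) < 1 / 3"
    using norm_fst_snd_le(2) short[OF assms u] by (rule order_le_less_trans) (simp add: norm_Pair)
  then have "\<bar>Im (snd (\<psi> t (0, \<i>) - (0, \<i>)))\<bar> < 1 / 3"
    using abs_Im_le_cmod order_le_less_trans by blast
  then show "1 / 2 \<le> z t" "z t \<le> 2" unfolding z_def abs_less_iff by simp_all
qed

lemma fst_psi_le_1:
  assumes "0 \<le> t" "t \<le> T" "\<bar>y\<bar> \<le> 1"
  shows "norm (fst (\<psi> t (0, \<i> * of_real y))) \<le> 1"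
proof -
  let ?d = "\<psi> t (0, \<i> * of_real y) - (0, \<i> * of_real y)"
  have "norm ?d < 1 / 3"
    using short[OF assms(1,2) snd_axis_in_U] assms(3) by (simp add: norm_Pair norm_mult)
  then have "norm (fst ?d) < 1 / 3"
    by (rule order_le_less_trans[OF norm_fst_snd_le(1)])
  then show ?thesis by simp
qed

text \<open>The increment of \<open>N\<close> at time \<open>t\<close> is \<open>N r\<close> at some
  -k with k \<ge> l / 3, hence at least a third of \<open>N r\<close> at -l. The factor
  \<open>N (2 * T)\<close> at the same \<open>l\<close> is kept, since it tends to 0 with
  \<open>l\<close>.\<close>

lemma N_fst_linear:
  assumes r: "0 < r" "r \<le> T" and l: "0 \<le> l" "l \<le> 1"
  shows "N r (- of_real l, 0) \<le> 3 / T * N (2 * T) (- of_real l, 0) * r"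
proof -
  let ?u = "(- of_real l, 0) :: complex \<times> complex"
  have u: "?u \<in> U" using l by (intro fst_axis_in_U)
  have "N r ?u / 3 \<le> r * N (2 * T) ?u / T"
  proof (rule increment_bound[OF T_pos r, where f = "\<lambda>t. N t ?u"])
    fix t assume t: "0 \<le> t" "t \<le> T"
    have "norm (\<psi> t (-1, 0) - (-1, 0)) < 1 / 3"
      using t by (intro short) (simp_all add: in_U_iff norm_Pair)
    from fst_psi_fst_axis_lower[OF t(1) l this] obtain k where k: "l / 3 \<le> k" "\<psi> t ?u = (- of_real k, 0)" .
    have "N r ?u / 3 \<le> N r (- of_real (l / 3), 0)"
      using r l by (intro levy_khintchine.nrm_fst_third[OF LK]) auto
    also have "\<dots> \<le> N r (- of_real k, 0)"
      using r l k by (intro levy_khintchine.nrm_fst_mono[OF LK]) auto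
    also have "\<dots> = N (t + r) ?u - N t ?u"
      using N_add[of r t ?u] r t u k(2) by simp
    finally show "N r ?u / 3 \<le> N (t + r) ?u - N t ?u" .
  next
    show "N 0 ?u = 0" using u by (rule N_0)
    show "N t ?u \<le> N (2 * T) ?u" if "0 \<le> t" "t \<le> 2 * T" for t
      using that u by (intro N_mono)
  qed
  then show ?thesis by (simp add: field_simps)
qed

text \<open>The flow maps (0, i y) to (w, i y z t). The dilation costs the factor 80 of
  \<open>avg_nrm_scale\<close>, and the first coordinate w costs 4 times a first-axis exponent,
  which is already of order \<open>r\<close> by \<open>N_fst_linear\<close>; 12 = 4 * 3.\<close>

lemma E_linear:
  assumes r: "0 < r" "r \<le> T" and \<epsilon>: "0 \<le> \<epsilon>" and \<eta>: "0 \<le> \<eta>" "\<eta> \<le> 1"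
    and fst_le: "\<And>t y. 0 \<le> t \<Longrightarrow> t \<le> T \<Longrightarrow> \<bar>y\<bar> \<le> \<epsilon> \<Longrightarrow> norm (fst (\<psi> t (0, \<i> * of_real y))) \<le> \<eta>"
  shows "E r \<epsilon> \<le> 80 / T * (E (2 * T) \<epsilon> + 12 * N (2 * T) (- of_real \<eta>, 0)) * r"
proof -
  let ?q = "N r (- of_real \<eta>, 0)"
  have r0: "0 \<le> r" using r by simp
  have "E r \<epsilon> / 80 - 4 * ?q \<le> r * E (2 * T) \<epsilon> / T"
  proof (rule increment_bound[OF T_pos r, where f = "\<lambda>t. E t \<epsilon>"])
    fix t assume t: "0 \<le> t" "t \<le> T"
    have tr: "0 \<le> t + r" using t r by simp
    let ?p = "\<lambda>s. (0, \<i> * of_real (s * \<epsilon>)) :: complex \<times> complex"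
    have "E r \<epsilon> / 80 - 4 * ?q \<le> E r (z t * \<epsilon>) - 4 * ?q"
      using levy_khintchine.avg_nrm_scale[OF LK[OF r0] z_bounds(1)[OF t], of "b2 r" \<epsilon>] by simp
    also have "\<dots> = (LINT s|unit_unif. N r (0, \<i> * of_real (s * (z t * \<epsilon>))) - 4 * ?q)"
      using integrable_N_snd[OF r0, of "z t * \<epsilon>"] unit_unif.prob_space
      by (subst Bochner_Integration.integral_diff) (simp_all add: E_def[OF r0])
    also have "\<dots> \<le> (LINT s|unit_unif. N (t + r) (?p s) - N t (?p s))"
    proof (rule integral_mono)
      show "integrable unit_unif (\<lambda>s. N r (0, \<i> * of_real (s * (z t * \<epsilon>))) - 4 * ?q)"
        using integrable_N_snd[OF r0, of "z t * \<epsilon>"] by (simp del: of_real_mult)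
      show "integrable unit_unif (\<lambda>s. N (t + r) (?p s) - N t (?p s))"
        by (intro Bochner_Integration.integrable_diff integrable_N_snd t tr)
      fix s assume "s \<in> space unit_unif"
      then have s: "0 \<le> s" "s \<le> 1" by (auto simp: space_restrict_space)
      have se: "\<bar>s * \<epsilon>\<bar> \<le> \<epsilon>" using s \<epsilon> by (simp add: abs_mult mult_left_le_one_le)
      have v: "\<psi> t (?p s) = (fst (\<psi> t (?p s)), \<i> * of_real (s * (z t * \<epsilon>)))"
        using snd_psi[OF t(1) snd_axis_in_U, of "s * \<epsilon>"] by (simp add: prod_eq_iff)
      have "\<psi> t (?p s) \<in> U" by (intro psi_in_U t snd_axis_in_U)
      then have vU: "(fst (\<psi> t (?p s)), \<i> * of_real (s * (z t * \<epsilon>))) \<in> U" using v by simp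
      have "norm (\<phi> r (\<psi> t (?p s)) - \<phi> r (0, \<i> * of_real (s * (z t * \<epsilon>)))) \<le> 4 * ?q"
        using levy_khintchine.expo_fst_perturb[OF LK[OF r0] vU fst_le[OF t se], of "b2 r"] v by simp
      then have "\<bar>Re (\<phi> r (\<psi> t (?p s)) - \<phi> r (0, \<i> * of_real (s * (z t * \<epsilon>))))\<bar> \<le> 4 * ?q"
        using abs_Re_le_cmod order_trans by blast
      then have "N r (0, \<i> * of_real (s * (z t * \<epsilon>))) - 4 * ?q \<le> N r (\<psi> t (?p s))"
        unfolding levy_khintchine.nrm_def[OF LK[OF r0]] by (simp add: abs_le_iff)
      then show "N r (0, \<i> * of_real (s * (z t * \<epsilon>))) - 4 * ?q \<le> N (t + r) (?p s) - N t (?p s)"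
        using N_add[OF r0 t(1) snd_axis_in_U, of "s * \<epsilon>"] by simp
    qed
    also have "\<dots> = E (t + r) \<epsilon> - E t \<epsilon>"
      unfolding E_def[OF t(1)] E_def[OF tr]
      by (intro Bochner_Integration.integral_diff integrable_N_snd t tr)
    finally show "E r \<epsilon> / 80 - 4 * ?q \<le> E (t + r) \<epsilon> - E t \<epsilon>" .
  next
    show "E 0 \<epsilon> = 0" by (rule E_0)
    show "E t \<epsilon> \<le> E (2 * T) \<epsilon>" if "0 \<le> t" "t \<le> 2 * T" for t
      using that by (rule E_mono)
  qed
  moreover have "4 * ?q \<le> 4 * (3 / T * N (2 * T) (- of_real \<eta>, 0) * r)"
    using N_fst_linear[OF r \<eta>] by simp
  ultimately have "E r \<epsilon> / 80 \<le> r * E (2 * T) \<epsilon> / T + 4 * (3 / T * N (2 * T) (- of_real \<eta>, 0) * r)" by linarith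
  then show ?thesis using T_pos by (simp add: field_simps)
qed

lemma E_1_linear: "\<exists>C\<ge>0. \<forall>r. 0 < r \<and> r \<le> T \<longrightarrow> E r 1 \<le> C * r"
proof (intro exI conjI allI impI)
  show "0 \<le> 80 / T * (E (2 * T) 1 + 12 * N (2 * T) (- of_real 1, 0))"
    using T_pos by (intro mult_nonneg_nonneg add_nonneg_nonneg E_nonneg N_nonneg fst_axis_in_U) auto
  show "E r 1 \<le> 80 / T * (E (2 * T) 1 + 12 * N (2 * T) (- of_real 1, 0)) * r" if "0 < r \<and> r \<le> T" for r
    using that fst_psi_le_1 by (intro E_linear) auto
qed

lemma N_fst_small:
  assumes "\<eta> > 0"
  shows "\<exists>\<delta>>0. \<delta> \<le> 1 \<and> (\<forall>l. 0 \<le> l \<and> l \<le> \<delta> \<longrightarrow> N (2 * T) (- of_real l, 0) \<le> \<eta>)"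
proof -
  have T2: "0 \<le> 2 * T" using T_pos by simp
  obtain d where d: "d > 0" "\<And>u. u \<in> U \<Longrightarrow> dist u 0 < d \<Longrightarrow> dist (N (2 * T) u) (N (2 * T) 0) < \<eta>"
    using continuous_on_N[OF T2] assms unfolding continuous_on_iff by (metis zero_in_U)
  have N0: "N (2 * T) 0 = 0"
    unfolding levy_khintchine.nrm_def[OF LK[OF T2]] using phi_t_0[OF T2] by simp
  show ?thesis
  proof (intro exI[of _ "min (d / 2) 1"] conjI allI impI)
    fix l assume l: "0 \<le> l \<and> l \<le> min (d / 2) 1"
    then have "dist (- of_real l, 0) (0 :: complex \<times> complex) < d"
      using d(1) by (simp add: norm_Pair)
    from d(2)[OF fst_axis_in_U this] l N0 show "N (2 * T) (- of_real l, 0) \<le> \<eta>" by simp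
  qed (use d in auto)
qed

text \<open>Both terms in the constant of \<open>E_linear\<close> become small: a first-axis radius
  \<open>l\<close> is fixed with \<open>N (2 * T)\<close> small there, and then
  \<open>\<epsilon>\<close> is so small that the flow keeps the first coordinate below
  \<open>l\<close> and \<open>E (2 * T) \<epsilon>\<close> is small.\<close>

lemma E_small:
  assumes "\<eta> > 0"
  shows "\<exists>\<delta>>0. \<forall>\<epsilon> r. 0 \<le> \<epsilon> \<and> \<epsilon> \<le> \<delta> \<and> 0 < r \<and> r \<le> T \<longrightarrow> E r \<epsilon> \<le> \<eta> * r"
proof -
  \<comment> \<open>13 = 1 + 12 counts the second-axis term once and the first-axis term twelve
    times.\<close>
  define c where "c = \<eta> * T / (80 * 13)"
  have c: "c > 0" using assms T_pos by (simp add: c_def)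
  have T2: "0 \<le> 2 * T" using T_pos by simp
  obtain l where l: "l > 0" "l \<le> 1" "N (2 * T) (- of_real l, 0) \<le> c"
    using N_fst_small[OF c] less_imp_le by blast
  obtain d1 where d1: "d1 > 0" "\<And>t u. t \<in> {0..T} \<Longrightarrow> u \<in> U \<Longrightarrow> norm u \<le> d1 \<Longrightarrow> norm (\<psi> t u) < l"
    using psi_near_zero[OF l(1) less_imp_le[OF T_pos]] by blast
  obtain d2 where d2: "d2 > 0" "\<And>u. u \<in> U \<Longrightarrow> dist u 0 < d2 \<Longrightarrow> dist (N (2 * T) u) (N (2 * T) 0) < c"
    using continuous_on_N[OF T2] c unfolding continuous_on_iff by (metis zero_in_U)
  have N0: "N (2 * T) 0 = 0"
    unfolding levy_khintchine.nrm_def[OF LK[OF T2]] using phi_t_0[OF T2] by simp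
  show ?thesis
  proof (intro exI[of _ "min d1 (d2 / 2)"] conjI allI impI)
    show "0 < min d1 (d2 / 2)" using d1 d2 by simp
    fix \<epsilon> r assume *: "0 \<le> \<epsilon> \<and> \<epsilon> \<le> min d1 (d2 / 2) \<and> 0 < r \<and> r \<le> T"
    have "E (2 * T) \<epsilon> \<le> c"
    proof (rule E_le[OF T2])
      fix y assume "0 \<le> y" "y \<le> \<epsilon>"
      then have "dist (0, \<i> * of_real y) (0 :: complex \<times> complex) < d2"
        using * d2(1) by (simp add: norm_Pair norm_mult)
      from d2(2)[OF snd_axis_in_U this] show "N (2 * T) (0, \<i> * of_real y) \<le> c" by (simp add: N0)
    qed (use * in simp)
    moreover have "E r \<epsilon> \<le> 80 / T * (E (2 * T) \<epsilon> + 12 * N (2 * T) (- of_real l, 0)) * r"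
    proof (rule E_linear)
      fix t y assume "0 \<le> t" "t \<le> T" "\<bar>y\<bar> \<le> \<epsilon>"
      then have "norm (\<psi> t (0, \<i> * of_real y)) < l"
        using * by (intro d1(2) snd_axis_in_U) (auto simp: norm_Pair norm_mult)
      then show "norm (fst (\<psi> t (0, \<i> * of_real y))) \<le> l"
        using norm_fst_le[of "fst (\<psi> t (0, \<i> * of_real y))" "snd (\<psi> t (0, \<i> * of_real y))"] by simp
    qed (use * l in auto)
    moreover have "80 / T * (E (2 * T) \<epsilon> + 12 * N (2 * T) (- of_real l, 0)) * r \<le> 80 / T * (c + 12 * c) * r"
      using calculation(1) l(3) T_pos * by (intro mult_right_mono mult_left_mono) auto
    moreover have "80 / T * (c + 12 * c) * r = \<eta> * r"
      using T_pos by (simp add: c_def field_simps)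
    ultimately show "E r \<epsilon> \<le> \<eta> * r" by linarith
  qed
qed

text \<open>At the frequency (0, i) the imaginary part of an increment is \<open>b2 r * z t\<close>
  up to an error of order \<open>r\<close>. As \<open>z t\<close> is at least 1/2, the drift
  contributions of successive spans cannot cancel, and their sum is bounded by continuity of
  \<open>\<phi>\<close> in time.\<close>

lemma b2_linear: "\<exists>C\<ge>0. \<forall>r. 0 < r \<and> r \<le> T \<longrightarrow> \<bar>b2 r\<bar> \<le> C * r"
proof -
  obtain CE where CE: "CE \<ge> 0" "\<And>r. 0 < r \<Longrightarrow> r \<le> T \<Longrightarrow> E r 1 \<le> CE * r"
    using E_1_linear by blast
  define CN where "CN = 3 / T * N (2 * T) (- of_real 1, 0)"
  have CN: "N r (- of_real 1, 0) \<le> CN * r" if "0 < r" "r \<le> T" for r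
    using N_fst_linear[OF that, of 1] by (simp add: CN_def)
  have CN0: "0 \<le> CN"
    unfolding CN_def using T_pos by (intro mult_nonneg_nonneg N_nonneg fst_axis_in_U) auto
  define K where "K = 30 * CE + 4 * CN"
  have iU: "(0, \<i>) \<in> U" by (simp add: in_U_iff)
  have "compact ((\<lambda>t. Im (\<phi> t (0, \<i>))) ` {0..2 * T})"
    by (intro compact_continuous_image continuous_on_Im continuous_on_subset[OF continuous_on_phi_t[OF iU]]) auto
  from compact_imp_bounded[OF this] obtain M where "\<And>x. x \<in> (\<lambda>t. Im (\<phi> t (0, \<i>))) ` {0..2 * T} \<Longrightarrow> norm x \<le> M"
    unfolding bounded_iff by blast
  then have M: "\<bar>Im (\<phi> t (0, \<i>))\<bar> \<le> M" if "0 \<le> t" "t \<le> 2 * T" for t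
    using that by auto
  have M0: "0 \<le> M" using M[of 0] T_pos by simp
  have inc: "\<bar>Im (\<phi> (t + r) (0, \<i>)) - Im (\<phi> t (0, \<i>)) - b2 r * z t\<bar> \<le> K * r"
    if t: "0 \<le> t" "t \<le> T" and r: "0 < r" "r \<le> T" for t r
  proof -
    have r0: "0 \<le> r" using r by simp
    let ?w = "fst (\<psi> t (0, \<i>))"
    have v: "\<psi> t (0, \<i>) = (?w, \<i> * of_real (z t))"
      using snd_psi[OF t(1) iU] by (simp add: prod_eq_iff)
    have "norm ?w \<le> 1" using fst_psi_le_1[OF t, of 1] by simp
    moreover have "(?w, \<i> * of_real (z t)) \<in> U" using psi_in_U[OF t(1) iU] v by simp
    ultimately have "norm (\<phi> r (?w, \<i> * of_real (z t)) - \<phi> r (0, \<i> * of_real (z t))) \<le> 4 * N r (- of_real 1, 0)"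
      by (intro levy_khintchine.expo_fst_perturb[OF LK[OF r0]])
    then have "\<bar>Im (\<phi> r (?w, \<i> * of_real (z t)) - \<phi> r (0, \<i> * of_real (z t)))\<bar> \<le> 4 * N r (- of_real 1, 0)"
      using abs_Im_le_cmod order_trans by blast
    moreover have "4 * N r (- of_real 1, 0) \<le> 4 * (CN * r)" using CN[OF r] by simp
    moreover have "\<bar>Im (\<phi> r (0, \<i> * of_real (z t))) - b2 r * z t\<bar> \<le> 30 * E r 1"
      using z_bounds[OF t] by (intro levy_khintchine.Im_expo_snd_le[OF LK[OF r0]]) auto
    moreover have "30 * E r 1 \<le> 30 * (CE * r)" using CE(2)[OF r] by simp
    moreover have "K * r = 30 * (CE * r) + 4 * (CN * r)" by (simp add: K_def algebra_simps)
    moreover have "Im (\<phi> (t + r) (0, \<i>)) - Im (\<phi> t (0, \<i>)) = Im (\<phi> r (?w, \<i> * of_real (z t)))"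
      using phi_add[OF r0 t(1) iU] v by simp
    ultimately show ?thesis by simp
  qed
  have main: "\<bar>b2 r\<bar> \<le> (2 * K + 2 * M / T) * r" if r: "0 < r" "r \<le> T" for r
  proof -
    \<comment> \<open>With \<open>r\<close> fixed, the sign of \<open>b2 r\<close> is the same in
      all spans, so one sign makes every increment bounded below and \<open>increment_bound\<close>
      applies.\<close>
    define \<sigma> :: real where "\<sigma> = (if b2 r \<ge> 0 then 1 else - 1)"
    have \<sigma>: "\<sigma> * b2 r = \<bar>b2 r\<bar>" "\<bar>\<sigma>\<bar> = 1" by (auto simp: \<sigma>_def)
    have "\<bar>b2 r\<bar> / 2 - K * r \<le> r * M / T"
    proof (rule increment_bound[OF T_pos r, where f = "\<lambda>t. \<sigma> * Im (\<phi> t (0, \<i>))"])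
      fix t assume t: "0 \<le> t" "t \<le> T"
      let ?x = "Im (\<phi> (t + r) (0, \<i>)) - Im (\<phi> t (0, \<i>))"
      have "\<bar>\<sigma> * (?x - b2 r * z t)\<bar> \<le> K * r"
        unfolding abs_mult \<sigma>(2) using inc[OF t r] by simp
      moreover have "\<sigma> * (?x - b2 r * z t) = \<sigma> * ?x - \<bar>b2 r\<bar> * z t"
        by (simp add: right_diff_distrib mult.assoc flip: \<sigma>(1))
      moreover have "\<bar>b2 r\<bar> * (1 / 2) \<le> \<bar>b2 r\<bar> * z t"
        using z_bounds(1)[OF t] by (intro mult_left_mono) auto
      ultimately have "\<bar>b2 r\<bar> / 2 - K * r \<le> \<sigma> * ?x" by linarith
      then show "\<bar>b2 r\<bar> / 2 - K * r \<le> \<sigma> * Im (\<phi> (t + r) (0, \<i>)) - \<sigma> * Im (\<phi> t (0, \<i>))"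
        by (simp add: right_diff_distrib)
    next
      show "\<sigma> * Im (\<phi> 0 (0, \<i>)) = 0" using phi_0_u[OF iU] by simp
      show "\<sigma> * Im (\<phi> t (0, \<i>)) \<le> M" if "0 \<le> t" "t \<le> 2 * T" for t
        using M[OF that] \<sigma>(2) abs_le_D1 abs_mult mult_1 by metis
    qed
    then show ?thesis using T_pos by (simp add: field_simps)
  qed
  show ?thesis
    using main M0 CE(1) CN0 T_pos by (intro exI[of _ "2 * K + 2 * M / T"]) (auto simp: K_def)
qed

section \<open>Equicontinuity of the quotients of the exponents by time\<close>

lemma phi_equicontinuous_zero:
  assumes \<eta>: "\<eta> > 0"
  shows "\<exists>\<delta>>0. \<forall>r u. 0 < r \<and> r \<le> T \<and> u \<in> U \<and> norm u \<le> \<delta> \<longrightarrow> norm (\<phi> r u) \<le> \<eta> * r"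
proof -
  obtain CE where CE: "CE \<ge> 0" "\<And>r. 0 < r \<Longrightarrow> r \<le> T \<Longrightarrow> E r 1 \<le> CE * r"
    using E_1_linear by blast
  obtain CB where CB: "CB \<ge> 0" "\<And>r. 0 < r \<Longrightarrow> r \<le> T \<Longrightarrow> \<bar>b2 r\<bar> \<le> CB * r"
    using b2_linear by blast
  \<comment> \<open>The first coordinate and the real part will each contribute \<open>c * r\<close>
    and the imaginary part \<open>2 * c * r\<close>, in total less than
    \<open>\<eta> * r\<close>.\<close>
  define c where "c = \<eta> / 5"
  have c: "c > 0" using \<eta> by (simp add: c_def)
  have c1: "c * T / 12 > 0" "c / 20 > 0" using c T_pos by simp_all
  obtain d1 where d1: "d1 > 0" "d1 \<le> 1" "\<And>l. 0 \<le> l \<and> l \<le> d1 \<Longrightarrow> N (2 * T) (- of_real l, 0) \<le> c * T / 12"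
    using N_fst_small[OF c1(1)] by blast
  obtain d2 where d2: "d2 > 0" "\<And>\<epsilon> r. 0 \<le> \<epsilon> \<Longrightarrow> \<epsilon> \<le> d2 \<Longrightarrow> 0 < r \<Longrightarrow> r \<le> T \<Longrightarrow> E r \<epsilon> \<le> c / 20 * r"
    using E_small[OF c1(2)] by blast
  \<comment> \<open>Frequencies with |y| \<le> e^2 have sqrt |y| \<le> e, the scale at which
    \<open>Im_expo_snd_small\<close> evaluates \<open>E\<close>. The quotient makes the drift term
    and the \<open>E r 1\<close> term together at most \<open>c * r\<close>.\<close>
  define e where "e = min (min d2 1) (c / (CB + 20 * CE + 1))"
  have CC: "CB + 20 * CE + 1 > 0" using CE(1) CB(1) by simp
  have e: "e > 0" "e \<le> d2" "e \<le> 1" "(CB + 20 * CE) * e \<le> c"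
  proof -
    show "e > 0" using d2(1) c CC by (simp add: e_def)
    then have e0: "0 \<le> e" by simp
    show "e \<le> d2" "e \<le> 1" by (simp_all add: e_def)
    have "e \<le> c / (CB + 20 * CE + 1)" by (simp add: e_def)
    then have "(CB + 20 * CE + 1) * e \<le> c" using CC by (simp add: field_simps)
    then show "(CB + 20 * CE) * e \<le> c" using e0 by (simp add: algebra_simps)
  qed
  show ?thesis
  proof (intro exI[of _ "min d1 (e\<^sup>2)"] conjI allI impI)
    show "0 < min d1 (e\<^sup>2)" using d1 e by simp
    fix r u assume *: "0 < r \<and> r \<le> T \<and> u \<in> U \<and> norm u \<le> min d1 (e\<^sup>2)"
    then have r: "0 < r" "r \<le> T" and r0: "0 \<le> r" by auto
    obtain u1 u2 where u: "u = (u1, u2)" by (cases u)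
    have uU: "(u1, u2) \<in> U" using * u by simp
    have n1: "norm u1 \<le> d1" and n2: "norm u2 \<le> e\<^sup>2"
      using * norm_fst_le[of u1 u2] norm_snd_le[of u2 u1] by (auto simp: u)
    define y where "y = Im u2"
    have u2: "u2 = \<i> * of_real y" using uU by (simp add: y_def in_U_iff complex_eq_iff)
    have y: "\<bar>y\<bar> \<le> e\<^sup>2" using n2 by (simp add: u2 norm_mult)
    have sy: "sqrt \<bar>y\<bar> \<le> e" using y e(1) by (metis less_imp_le real_le_lsqrt abs_ge_zero)
    have ye: "\<bar>y\<bar> \<le> e"
    proof -
      have "e\<^sup>2 \<le> e" using e by (simp add: power2_eq_square mult_left_le)
      then show ?thesis using y by simp
    qed
    have y1: "\<bar>y\<bar> \<le> 1" using ye e by simp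
    have A: "norm (\<phi> r (u1, u2) - \<phi> r (0, u2)) \<le> c * r"
    proof -
      have "norm (\<phi> r (u1, u2) - \<phi> r (0, u2)) \<le> 4 * N r (- of_real (norm u1), 0)"
        by (rule levy_khintchine.expo_fst_perturb[OF LK[OF r0] uU order_refl])
      also have "\<dots> \<le> 4 * (3 / T * N (2 * T) (- of_real (norm u1), 0) * r)"
        using N_fst_linear[OF r, of "norm u1"] n1 d1(2) by simp
      also have "\<dots> \<le> 4 * (3 / T * (c * T / 12) * r)"
        using d1(3)[of "norm u1"] n1 T_pos r by (intro mult_left_mono mult_right_mono) auto
      finally show ?thesis using T_pos by simp
    qed
    have B: "N r (0, u2) \<le> c * r"
    proof -
      have "N r (0, u2) \<le> 20 * E r e"
        unfolding u2 by (rule levy_khintchine.nrm_snd_le_avg[OF LK[OF r0] ye])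
      then show ?thesis using d2(2)[OF _ e(2) r] e(1) by simp
    qed
    have C: "\<bar>Im (\<phi> r (0, u2))\<bar> \<le> 2 * c * r"
    proof -
      have "\<bar>Im (\<phi> r (0, u2))\<bar> \<le> \<bar>b2 r\<bar> * \<bar>y\<bar> + 20 * sqrt \<bar>y\<bar> * E r 1 + 10 * E r (sqrt \<bar>y\<bar>)"
        unfolding u2 by (rule levy_khintchine.Im_expo_snd_small[OF LK[OF r0] y1])
      also have "\<dots> \<le> (CB * r) * e + 20 * e * (CE * r) + 10 * (c / 20 * r)"
        using CB(2)[OF r] CE(2)[OF r] d2(2)[OF _ _ r, of "sqrt \<bar>y\<bar>"] sy e ye E_nonneg[OF r0]
        by (intro add_mono mult_mono) auto
      also have "\<dots> = (CB + 20 * CE) * e * r + c / 2 * r" by (simp add: algebra_simps)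
      also have "\<dots> \<le> c * r + c / 2 * r"
        using e(4) r by (intro add_mono mult_right_mono) auto
      also have "\<dots> \<le> 2 * c * r" using c r by simp
      finally show ?thesis .
    qed
    have "norm (\<phi> r (0, u2)) \<le> \<bar>Re (\<phi> r (0, u2))\<bar> + \<bar>Im (\<phi> r (0, u2))\<bar>"
      by (rule cmod_le)
    also have "\<bar>Re (\<phi> r (0, u2))\<bar> = N r (0, u2)"
      using N_nonneg[OF r0 snd_axis_in_U, of y] unfolding levy_khintchine.nrm_def[OF LK[OF r0]] u2 by simp
    finally have "norm (\<phi> r (0, u2)) \<le> 3 * c * r" using B C by simp
    then have "norm (\<phi> r (u1, u2)) \<le> 4 * c * r"
      using A norm_triangle_sub[of "\<phi> r (u1, u2)" "\<phi> r (0, u2)"] by simp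
    also have "\<dots> \<le> \<eta> * r" using r \<eta> by (simp add: c_def)
    finally show "norm (\<phi> r u) \<le> \<eta> * r" by (simp add: u)
  qed
qed

lemma phi_double:
  assumes r: "0 \<le> r" and u: "u \<in> U"
  shows "norm (\<phi> r (2 *\<^sub>R u)) \<le> 4 * norm (\<phi> r u)"
proof -
  have "norm (\<phi> r (u + u) - \<phi> r u - \<phi> r u) \<le> 1 * N r u + N r u / 1"
    by (rule levy_khintchine.expo_add_le[OF LK[OF r] u u]) simp
  then have "norm (\<phi> r (2 *\<^sub>R u) - (\<phi> r u + \<phi> r u)) \<le> 2 * norm (\<phi> r u)"
    using N_le_norm[OF r, of u] by (simp add: scaleR_2 diff_diff_eq)
  then show ?thesis
    using norm_triangle_sub[of "\<phi> r (2 *\<^sub>R u)" "\<phi> r u + \<phi> r u"] norm_triangle_ineq[of "\<phi> r u" "\<phi> r u"] by linarith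
qed

text \<open>A bounded \<open>u\<close> is 2^n times a point of the small ball where
  \<open>phi_equicontinuous_zero\<close> applies, and each doubling costs the factor 4 of
  \<open>phi_double\<close>.\<close>

lemma phi_locally_bounded: "\<exists>C\<ge>0. \<forall>r u. 0 < r \<and> r \<le> T \<and> u \<in> U \<and> norm u \<le> R \<longrightarrow> norm (\<phi> r u) \<le> C * r"
proof -
  obtain \<delta> where \<delta>: "\<delta> > 0" "\<And>r u. 0 < r \<Longrightarrow> r \<le> T \<Longrightarrow> u \<in> U \<Longrightarrow> norm u \<le> \<delta> \<Longrightarrow> norm (\<phi> r u) \<le> 1 * r"
    using phi_equicontinuous_zero[of 1] by auto
  have pow: "norm (\<phi> r u) \<le> 4 ^ n * r" if r: "0 < r" "r \<le> T" and "u \<in> U" "norm u \<le> 2 ^ n * \<delta>" for r u n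
    using that(3,4)
  proof (induction n arbitrary: u)
    case 0
    then show ?case using \<delta>(2)[OF r] by simp
  next
    case (Suc n)
    let ?v = "(1 / 2) *\<^sub>R u"
    have v: "?v \<in> U" using Suc.prems by (intro scaleR_in_U) auto
    have "norm (\<phi> r ?v) \<le> 4 ^ n * r"
      using Suc.prems by (intro Suc.IH[OF v]) simp
    moreover have "norm (\<phi> r (2 *\<^sub>R ?v)) \<le> 4 * norm (\<phi> r ?v)"
      using r by (intro phi_double v) simp
    ultimately show ?case by simp
  qed
  obtain n where n: "R / \<delta> < 2 ^ n" using real_arch_pow[of 2 "R / \<delta>"] by auto
  then have "R \<le> 2 ^ n * \<delta>" using \<delta>(1) by (simp add: field_simps)
  then show ?thesis
    using pow by (intro exI[of _ "4 ^ n"]) (auto intro: order_trans)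
qed

text \<open>\<open>expo_add_le\<close> bounds the cross term by c N r u + N r v / c. Since
  \<open>N r u\<close> is merely of order \<open>r\<close>, the weight \<open>c\<close> is chosen
  small first, and the neighbourhood for \<open>v\<close> is chosen depending on
  \<open>c\<close>.\<close>

lemma phi_equicontinuous_add:
  assumes \<eta>: "\<eta> > 0"
  shows "\<exists>\<delta>>0. \<forall>r u v. 0 < r \<and> r \<le> T \<and> u \<in> U \<and> norm u \<le> R \<and> v \<in> U \<and> norm v \<le> \<delta>
    \<longrightarrow> norm (\<phi> r (u + v) - \<phi> r u) \<le> \<eta> * r"
proof -
  obtain C where C: "C \<ge> 0" "\<And>r u. 0 < r \<Longrightarrow> r \<le> T \<Longrightarrow> u \<in> U \<Longrightarrow> norm u \<le> R \<Longrightarrow> norm (\<phi> r u) \<le> C * r"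
    using phi_locally_bounded by blast
  define c where "c = \<eta> / (2 * (C + 1))"
  have c: "c > 0" using \<eta> C(1) by (simp add: c_def)
  define h where "h = \<eta> / (2 * (1 + 1 / c))"
  have h: "h > 0" using \<eta> c by (simp add: h_def add_pos_pos)
  obtain \<delta> where \<delta>: "\<delta> > 0" "\<And>r u. 0 < r \<Longrightarrow> r \<le> T \<Longrightarrow> u \<in> U \<Longrightarrow> norm u \<le> \<delta> \<Longrightarrow> norm (\<phi> r u) \<le> h * r"
    using phi_equicontinuous_zero[OF h] by blast
  show ?thesis
  proof (intro exI[of _ \<delta>] conjI allI impI \<delta>(1))
    fix r u v assume *: "0 < r \<and> r \<le> T \<and> u \<in> U \<and> norm u \<le> R \<and> v \<in> U \<and> norm v \<le> \<delta>"
    then have r0: "0 \<le> r" by simp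
    have nu: "N r u \<le> C * r" using N_le_norm[OF r0, of u] C(2)[of r u] * by linarith
    have nv: "norm (\<phi> r v) \<le> h * r" using \<delta>(2)[of r v] * by blast
    then have nv': "N r v \<le> h * r" using N_le_norm[OF r0, of v] by linarith
    have "norm (\<phi> r (u + v) - \<phi> r u - \<phi> r v) \<le> c * N r u + N r v / c"
      using * c by (intro levy_khintchine.expo_add_le[OF LK[OF r0]]) auto
    also have "\<dots> \<le> c * (C * r) + h * r / c"
      using nu nv' c by (intro add_mono mult_left_mono divide_right_mono) auto
    finally have "norm (\<phi> r (u + v) - \<phi> r u) \<le> c * (C * r) + h * r / c + h * r"
      using nv norm_triangle_sub[of "\<phi> r (u + v) - \<phi> r u" "\<phi> r v"] by linarith
    also have "\<dots> = c * C * r + h * (1 + 1 / c) * r" by (simp add: algebra_simps)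
    also have "\<dots> \<le> \<eta> / 2 * r + \<eta> / 2 * r"
    proof (intro add_mono mult_right_mono)
      have "c * C \<le> c * (C + 1)" using c by simp
      also have "\<dots> = \<eta> / 2" using C(1) by (simp add: c_def field_simps)
      finally show "c * C \<le> \<eta> / 2" .
      have "1 + 1 / c > 0" using c by (simp add: add_pos_pos)
      then show "h * (1 + 1 / c) \<le> \<eta> / 2" by (simp add: h_def field_simps)
    qed (use r0 in auto)
    finally show "norm (\<phi> r (u + v) - \<phi> r u) \<le> \<eta> * r" by (simp add: field_simps)
  qed
qed

text \<open>The difference of two points of \<open>U\<close> may leave \<open>U\<close>, so the
  additive estimate does not apply to it. Both points are moved inside \<open>U\<close> to a common
  third point instead.\<close>

lemma phi_equicontinuous:
  assumes \<eta>: "\<eta> > 0"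
  shows "\<exists>\<delta>>0. \<forall>r u w. 0 < r \<and> r \<le> T \<and> u \<in> U \<and> norm u \<le> R \<and> w \<in> U \<and> norm w \<le> R \<and> norm (u - w) \<le> \<delta>
    \<longrightarrow> norm (\<phi> r u - \<phi> r w) \<le> \<eta> * r"
proof -
  have h: "\<eta> / 2 > 0" using \<eta> by simp
  obtain \<delta> where \<delta>: "\<delta> > 0" "\<And>r u v. 0 < r \<Longrightarrow> r \<le> T \<Longrightarrow> u \<in> U \<Longrightarrow> norm u \<le> R \<Longrightarrow> v \<in> U \<Longrightarrow> norm v \<le> \<delta>
    \<Longrightarrow> norm (\<phi> r (u + v) - \<phi> r u) \<le> \<eta> / 2 * r"
    using phi_equicontinuous_add[OF h, of R] by blast
  show ?thesis
  proof (intro exI[of _ "\<delta> / 2"] conjI allI impI)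
    show "0 < \<delta> / 2" using \<delta>(1) by simp
    fix r u w assume *: "0 < r \<and> r \<le> T \<and> u \<in> U \<and> norm u \<le> R \<and> w \<in> U \<and> norm w \<le> R \<and> norm (u - w) \<le> \<delta> / 2"
    \<comment> \<open>The common point u + x = w + y has the smaller of the two real parts in its
      first coordinate, so \<open>x\<close> and \<open>y\<close> both lie in \<open>U\<close>. Since
      \<open>y\<close> combines u - w and \<open>x\<close>, half of \<delta> is reserved for
      each.\<close>
    define x where "x = (of_real (min (Re (fst u)) (Re (fst w)) - Re (fst u)) :: complex, 0 :: complex)"
    define y where "y = u + x - w"
    have Re0: "Re (snd u) = 0" "Re (snd w) = 0" using * by (simp_all add: U_def)
    have xU: "x \<in> U" by (simp add: x_def U_def)
    have yU: "y \<in> U" using Re0 by (auto simp: y_def x_def U_def min_def)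
    have "norm x = \<bar>min (Re (fst u)) (Re (fst w)) - Re (fst u)\<bar>"
      by (simp add: x_def norm_Pair del: of_real_diff)
    also have "\<dots> \<le> \<bar>Re (fst (u - w))\<bar>" by (auto simp: min_def)
    also have "\<dots> \<le> norm (u - w)"
      by (rule order_trans[OF abs_Re_le_cmod norm_fst_snd_le(1)])
    finally have nx: "norm x \<le> \<delta> / 2" using * by simp
    have "norm y \<le> norm (u - w) + norm x"
      using norm_triangle_ineq[of "u - w" x] by (simp add: y_def algebra_simps)
    then have ny: "norm y \<le> \<delta>" using nx * by simp
    have "norm (\<phi> r (u + x) - \<phi> r u) \<le> \<eta> / 2 * r"
      using * xU nx \<delta>(1) by (intro \<delta>(2)) auto
    moreover have "norm (\<phi> r (w + y) - \<phi> r w) \<le> \<eta> / 2 * r"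
      using * yU ny by (intro \<delta>(2)) auto
    moreover have "w + y = u + x" by (simp add: y_def)
    moreover have "\<phi> r u - \<phi> r w = (\<phi> r (u + x) - \<phi> r w) - (\<phi> r (u + x) - \<phi> r u)" by simp
    ultimately have "norm (\<phi> r u - \<phi> r w) \<le> \<eta> / 2 * r + \<eta> / 2 * r"
      using norm_triangle_ineq4[of "\<phi> r (u + x) - \<phi> r w" "\<phi> r (u + x) - \<phi> r u"] by simp
    then show "norm (\<phi> r u - \<phi> r w) \<le> \<eta> * r" by (simp add: field_simps)
  qed
qed

end

section \<open>The generator\<close>

context sc_semigroup_short
begin

lemma phi_multiple:
  assumes "r \<ge> 0" "u \<in> U"
  shows "\<phi> (real n * r) u = (\<Sum>k<n. \<phi> r (\<psi> (real k * r) u))"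
proof (induction n)
  case 0
  then show ?case using phi_0_u assms by simp
next
  case (Suc n)
  have "\<phi> (real n * r + r) u = \<phi> r (\<psi> (real n * r) u) + \<phi> (real n * r) u"
    using assms by (intro phi_add) auto
  then show ?case using Suc by (simp add: algebra_simps)
qed

text \<open>Since \<open>\<phi> (n * r) u\<close> is the sum of the \<open>\<phi> r (\<psi> (k * r) u)\<close>, the quotient \<open>\<phi> r u / r\<close> for small
  \<open>r\<close> is close to \<open>\<phi> \<tau> u / \<tau>\<close> for a small fixed \<open>\<tau>\<close>.\<close>

lemma phi_quotient_Cauchy:
  assumes u: "u \<in> U" and \<eta>: "\<eta> > 0"
  shows "\<exists>\<delta>>0. \<exists>c. \<forall>r. 0 < r \<and> r < \<delta> \<longrightarrow> norm (\<phi> r u / of_real r - c) \<le> \<eta>"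
proof -
  have h: "\<eta> / 2 > 0" using \<eta> by simp
  obtain d where d: "d > 0" "\<And>r v w. 0 < r \<Longrightarrow> r \<le> T \<Longrightarrow> v \<in> U \<Longrightarrow> norm v \<le> norm u + 1 \<Longrightarrow> w \<in> U \<Longrightarrow>
      norm w \<le> norm u + 1 \<Longrightarrow> norm (v - w) \<le> d \<Longrightarrow> norm (\<phi> r v - \<phi> r w) \<le> \<eta> / 2 * r"
    using phi_equicontinuous[OF h, of "norm u + 1"] by blast
  obtain \<tau>0 where \<tau>0: "\<tau>0 > 0" "\<And>t. t \<in> {0..\<tau>0} \<Longrightarrow> norm (\<psi> t u - u) < min d 1"
    using psi_near_initial[of "min d 1" "norm u"] u d(1) by auto
  define \<tau> where "\<tau> = min \<tau>0 T"
  have \<tau>: "\<tau> > 0" "\<tau> \<le> T" "\<tau> \<le> \<tau>0" using \<tau>0(1) T_pos by (auto simp: \<tau>_def)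
  let ?g = "\<lambda>s. \<phi> s u / of_real s"
  have "continuous_on {\<tau>..} ?g"
    using \<tau>(1) by (intro continuous_intros continuous_on_subset[OF continuous_on_phi_t[OF u]]) auto
  then obtain e where e: "e > 0" "\<And>s. s \<in> {\<tau>..} \<Longrightarrow> dist s \<tau> < e \<Longrightarrow> dist (?g s) (?g \<tau>) < \<eta> / 2"
    unfolding continuous_on_iff using h by (metis atLeast_iff order_refl)
  show ?thesis
  proof (intro exI[of _ "min e \<tau>"] conjI exI[of _ "?g \<tau>"] allI impI)
    show "0 < min e \<tau>" using e \<tau> by simp
    fix r assume "0 < r \<and> r < min e \<tau>"
    then have r: "0 < r" "r < e" "r < \<tau>" "r \<le> T" using \<tau> by auto
    \<comment> \<open>Then \<tau> \<le> n r < \<tau> + r: the times k r with k < n do not exceed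
      \<tau>0, so the flow is still close to \<open>u\<close>, and n r lies within \<open>e\<close>
      of \<tau>.\<close>
    define n where "n = nat \<lceil>\<tau> / r\<rceil>"
    have Tr: "\<tau> / r > 1" using r by (simp add: field_simps)
    have n1: "\<tau> / r \<le> real n" "real n < \<tau> / r + 1"
      using Tr by (auto simp: n_def) linarith+
    then have n: "\<tau> \<le> real n * r" "real n * r < \<tau> + r" using r by (simp_all add: field_simps)
    have nr: "real n * r > 0" using n \<tau> by simp
    have "\<phi> (real n * r) u - of_nat n * \<phi> r u = (\<Sum>k<n. \<phi> r (\<psi> (real k * r) u) - \<phi> r u)"
      using phi_multiple[of r u n] r u by (simp add: sum_subtractf)
    also have "norm \<dots> \<le> (\<Sum>k<n. \<eta> / 2 * r)"
    proof (rule sum_norm_le)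
      fix k assume "k \<in> {..<n}"
      then have "real k + 1 \<le> real n" by simp
      then have "real k * r + r \<le> real n * r" using r mult_right_mono[of "real k + 1" "real n" r] by (simp add: distrib_right)
      then have k: "real k * r \<in> {0..\<tau>0}" using n(2) \<tau>(3) r by simp
      have near: "norm (\<psi> (real k * r) u - u) < min d 1" by (rule \<tau>0(2)[OF k])
      have "norm (\<psi> (real k * r) u) \<le> norm u + 1"
        using near norm_triangle_sub[of "\<psi> (real k * r) u" u] by simp
      then show "norm (\<phi> r (\<psi> (real k * r) u) - \<phi> r u) \<le> \<eta> / 2 * r"
        using near r u k by (intro d(2) psi_in_U) auto
    qed
    finally have "norm (\<phi> (real n * r) u - of_nat n * \<phi> r u) \<le> \<eta> / 2 * (real n * r)" by (simp add: mult.left_commute)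
    then have "norm ((\<phi> (real n * r) u - of_nat n * \<phi> r u) / of_real (real n * r)) \<le> \<eta> / 2"
      using nr unfolding norm_divide norm_of_real by (simp only: pos_divide_le_eq abs_of_pos)
    moreover have "(\<phi> (real n * r) u - of_nat n * \<phi> r u) / of_real (real n * r) = ?g (real n * r) - ?g r"
      using nr r by (cases "n = 0") (simp_all add: diff_divide_distrib)
    ultimately have A: "norm (?g (real n * r) - ?g r) \<le> \<eta> / 2" by simp
    have B: "norm (?g (real n * r) - ?g \<tau>) \<le> \<eta> / 2"
      using e(2)[of "real n * r"] n r by (simp add: dist_norm)
    have "?g r - ?g \<tau> = (?g (real n * r) - ?g \<tau>) - (?g (real n * r) - ?g r)" by simp
    then have "norm (?g r - ?g \<tau>) \<le> norm (?g (real n * r) - ?g \<tau>) + norm (?g (real n * r) - ?g r)"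
      by (metis norm_triangle_ineq4)
    then show "norm (?g r - ?g \<tau>) \<le> \<eta>" using A B by linarith
  qed
qed

text \<open>One sequence of times suffices to define the value; \<open>F_limit\<close> shows that
  the quotients converge to it along all small times.\<close>

definition F :: "complex \<times> complex \<Rightarrow> complex" where
  "F u = lim (\<lambda>n. \<phi> (T / real (Suc n)) u / of_real (T / real (Suc n)))"

lemma F_limit:
  assumes u: "u \<in> U" and \<eta>: "\<eta> > 0"
  shows "\<exists>\<delta>>0. \<forall>r. 0 < r \<and> r < \<delta> \<longrightarrow> norm (\<phi> r u / of_real r - F u) \<le> \<eta>"
proof -
  let ?r = "\<lambda>n. T / real (Suc n)"
  let ?p = "\<lambda>n. \<phi> (?r n) u / of_real (?r n)"
  have r0: "?r \<longlonglongrightarrow> 0"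
    by (rule LIMSEQ_Suc[OF lim_const_over_n])
  have rpos: "0 < ?r n" for n using T_pos by simp
  have "Cauchy ?p"
  proof (rule metric_CauchyI)
    fix e :: real assume e: "e > 0"
    then have "e / 3 > 0" by simp
    from phi_quotient_Cauchy[OF u this] obtain \<delta> c
      where \<delta>: "\<delta> > 0" "\<And>r. 0 < r \<Longrightarrow> r < \<delta> \<Longrightarrow> norm (\<phi> r u / of_real r - c) \<le> e / 3" by blast
    obtain M where M: "\<And>n. n \<ge> M \<Longrightarrow> ?r n < \<delta>"
      using order_tendstoD(2)[OF r0 \<delta>(1)] unfolding eventually_sequentially by blast
    show "\<exists>M. \<forall>m\<ge>M. \<forall>n\<ge>M. dist (?p m) (?p n) < e"
    proof (intro exI[of _ M] allI impI)
      fix m n assume "M \<le> m" "M \<le> n"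
      then have "dist (?p m) c \<le> e / 3" "dist (?p n) c \<le> e / 3"
        using \<delta>(2)[OF rpos M] by (simp_all only: dist_norm)
      then show "dist (?p m) (?p n) < e" using dist_triangle2[of "?p m" "?p n" c] e by linarith
    qed
  qed
  then have lim: "?p \<longlonglongrightarrow> F u"
    unfolding F_def by (intro convergent_LIMSEQ_iff[THEN iffD1] Cauchy_convergent)
  have "\<eta> / 2 > 0" using \<eta> by simp
  from phi_quotient_Cauchy[OF u this] obtain \<delta> c
    where \<delta>: "\<delta> > 0" "\<And>r. 0 < r \<Longrightarrow> r < \<delta> \<Longrightarrow> norm (\<phi> r u / of_real r - c) \<le> \<eta> / 2" by blast
  have "norm (F u - c) \<le> \<eta> / 2"
  proof (rule tendsto_upperbound[OF tendsto_norm[OF tendsto_diff[OF lim tendsto_const]]])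
    show "\<forall>\<^sub>F n in sequentially. norm (?p n - c) \<le> \<eta> / 2"
      using order_tendstoD(2)[OF r0 \<delta>(1)] by eventually_elim (intro \<delta>(2) rpos)
  qed simp
  then have "norm (\<phi> r u / of_real r - F u) \<le> \<eta>" if "0 < r" "r < \<delta>" for r
    using \<delta>(2)[OF that] norm_triangle_ineq4[of "\<phi> r u / of_real r - c" "F u - c"] by simp
  then show ?thesis using \<delta>(1) by blast
qed

lemma F_limit':
  assumes u: "u \<in> U" and \<eta>: "\<eta> > 0"
  shows "\<exists>\<delta>>0. \<forall>r. 0 < r \<and> r < \<delta> \<longrightarrow> norm (\<phi> r u - of_real r * F u) \<le> \<eta> * r"
proof -
  obtain \<delta> where \<delta>: "\<delta> > 0" "\<And>r. 0 < r \<Longrightarrow> r < \<delta> \<Longrightarrow> norm (\<phi> r u / of_real r - F u) \<le> \<eta>"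
    using F_limit[OF assms] by blast
  have "norm (\<phi> r u - of_real r * F u) \<le> \<eta> * r" if r: "0 < r" "r < \<delta>" for r
  proof -
    have "\<phi> r u - of_real r * F u = of_real r * (\<phi> r u / of_real r - F u)"
      using r by (simp add: field_simps)
    then have "norm (\<phi> r u - of_real r * F u) = r * norm (\<phi> r u / of_real r - F u)"
      using r by (simp add: norm_mult)
    also have "\<dots> \<le> r * \<eta>" using \<delta>(2)[OF r] r by (intro mult_left_mono) auto
    finally show ?thesis by (simp add: mult.commute)
  qed
  then show ?thesis using \<delta>(1) by blast
qed

lemma F_tendsto:
  assumes u: "u \<in> U" and r: "\<And>n. 0 < r n" "r \<longlonglongrightarrow> 0"
  shows "(\<lambda>n. \<phi> (r n) u / of_real (r n)) \<longlonglongrightarrow> F u"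
proof (rule LIMSEQ_I)
  fix e :: real assume "e > 0"
  then have "e / 2 > 0" by simp
  from F_limit[OF u this] obtain \<delta>
    where \<delta>: "\<delta> > 0" "\<And>r. 0 < r \<Longrightarrow> r < \<delta> \<Longrightarrow> norm (\<phi> r u / of_real r - F u) \<le> e / 2" by blast
  have "\<forall>\<^sub>F n in sequentially. norm (\<phi> (r n) u / of_real (r n) - F u) < e"
    using order_tendstoD(2)[OF r(2) \<delta>(1)]
  proof eventually_elim
    case (elim n)
    then show ?case using \<delta>(2)[OF r(1), of n] \<open>e / 2 > 0\<close> by linarith
  qed
  then show "\<exists>n0. \<forall>n\<ge>n0. norm (\<phi> (r n) u / of_real (r n) - F u) < e"
    by (simp add: eventually_sequentially)
qed

lemma F_0: "F 0 = 0"
proof -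
  have lim: "(\<lambda>n. \<phi> (T / real (Suc n)) 0 / of_real (T / real (Suc n))) \<longlonglongrightarrow> F 0"
    using T_pos by (intro F_tendsto LIMSEQ_Suc[OF lim_const_over_n]) auto
  have zero: "\<phi> (T / real (Suc n)) 0 = 0" for n
    using T_pos by (intro phi_t_0) simp
  show ?thesis
    using lim unfolding zero by (simp add: LIMSEQ_const_iff)
qed

lemma continuous_on_F: "continuous_on U F"
proof (rule continuous_onI)
  fix u e assume u: "u \<in> U" and e: "(e::real) > 0"
  obtain d where d: "d > 0" "\<And>r v w. 0 < r \<Longrightarrow> r \<le> T \<Longrightarrow> v \<in> U \<Longrightarrow> norm v \<le> norm u + 1 \<Longrightarrow> w \<in> U \<Longrightarrow>
      norm w \<le> norm u + 1 \<Longrightarrow> norm (v - w) \<le> d \<Longrightarrow> norm (\<phi> r v - \<phi> r w) \<le> e * r"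
    using phi_equicontinuous[OF e, of "norm u + 1"] by blast
  show "\<exists>d>0. \<forall>w\<in>U. dist w u < d \<longrightarrow> dist (F w) (F u) \<le> e"
  proof (intro exI[of _ "min d 1"] conjI ballI impI)
    show "0 < min d 1" using d by simp
    fix w assume w: "w \<in> U" "dist w u < min d 1"
    let ?r = "\<lambda>n. T / real (Suc n)"
    have rpos: "0 < ?r n" "?r n \<le> T" for n using T_pos by (simp_all add: field_simps)
    have nw: "norm w \<le> norm u + 1"
      using w(2) norm_triangle_sub[of w u] by (simp add: dist_norm)
    have lim: "(\<lambda>n. \<phi> (?r n) v / of_real (?r n)) \<longlonglongrightarrow> F v" if "v \<in> U" for v
      using that rpos(1) by (intro F_tendsto LIMSEQ_Suc[OF lim_const_over_n])
    have "norm (F w - F u) \<le> e"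
    proof (rule tendsto_upperbound[OF tendsto_norm[OF tendsto_diff[OF lim[OF w(1)] lim[OF u]]]])
      show "\<forall>\<^sub>F n in sequentially. norm (\<phi> (?r n) w / of_real (?r n) - \<phi> (?r n) u / of_real (?r n)) \<le> e"
      proof (intro always_eventually allI)
        fix n
        have "norm (\<phi> (?r n) w - \<phi> (?r n) u) \<le> e * ?r n"
          using w nw u rpos by (intro d(2)) (auto simp: dist_norm)
        then show "norm (\<phi> (?r n) w / of_real (?r n) - \<phi> (?r n) u / of_real (?r n)) \<le> e"
          using rpos(1)[of n] unfolding diff_divide_distrib[symmetric] norm_divide norm_of_real
          by (simp only: pos_divide_le_eq abs_of_pos)
      qed
    qed simp
    then show "dist (F w) (F u) \<le> e" by (simp add: dist_norm)
  qed
qed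

text \<open>To the right of \<open>t\<close> the increment is \<open>\<phi> r\<close> at the fixed
  point \<open>\<psi> t u\<close>, and the limit defining \<open>F\<close> applies. To the left the
  base point \<open>\<psi> s u\<close> moves with \<open>s\<close>; equicontinuity, uniform in
  \<open>r\<close> after division by \<open>r\<close>, replaces it by
  \<open>\<psi> t u\<close>.\<close>

lemma phi_has_vector_derivative:
  assumes u: "u \<in> U" and t: "t \<ge> 0"
  shows "((\<lambda>t. \<phi> t u) has_vector_derivative F (\<psi> t u)) (at t within {0..})"
  unfolding has_vector_derivative_def has_derivative_within_alt
proof (intro conjI allI impI)
  show "bounded_linear (\<lambda>x. x *\<^sub>R F (\<psi> t u))" by (rule bounded_linear_scaleR_left)
  fix e :: real assume e: "e > 0"
  let ?v = "\<psi> t u"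
  have vU: "?v \<in> U" by (intro psi_in_U t u)
  have h: "e / 2 > 0" using e by simp
  obtain d1 where d1: "d1 > 0" "\<And>r. 0 < r \<Longrightarrow> r < d1 \<Longrightarrow> norm (\<phi> r ?v - of_real r * F ?v) \<le> e / 2 * r"
    using F_limit'[OF vU h] by blast
  obtain d2 where d2: "d2 > 0" "\<And>r v w. 0 < r \<Longrightarrow> r \<le> T \<Longrightarrow> v \<in> U \<Longrightarrow> norm v \<le> norm ?v + 1 \<Longrightarrow> w \<in> U \<Longrightarrow>
      norm w \<le> norm ?v + 1 \<Longrightarrow> norm (v - w) \<le> d2 \<Longrightarrow> norm (\<phi> r v - \<phi> r w) \<le> e / 2 * r"
    using phi_equicontinuous[OF h, of "norm ?v + 1"] by blast
  have "continuous_on {0..} (\<lambda>s. \<psi> s u)"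
    using u by (intro continuous_on_psi_compose continuous_on_id continuous_on_const) auto
  then obtain d3 where d3: "d3 > 0" "\<And>s. s \<in> {0..} \<Longrightarrow> dist s t < d3 \<Longrightarrow> dist (\<psi> s u) ?v < min d2 1"
    unfolding continuous_on_iff using t d2(1) by (metis atLeast_iff min_less_iff_conj zero_less_one)
  show "\<exists>d>0. \<forall>s\<in>{0..}. norm (s - t) < d \<longrightarrow> norm (\<phi> s u - \<phi> t u - (s - t) *\<^sub>R F ?v) \<le> e * norm (s - t)"
  proof (intro exI[of _ "min (min d1 d3) T"] conjI ballI impI)
    show "0 < min (min d1 d3) T" using d1 d3 T_pos by simp
    fix s assume s: "s \<in> {0..}" "norm (s - t) < min (min d1 d3) T"
    consider "s = t" | "s > t" | "s < t" by linarith
    then show "norm (\<phi> s u - \<phi> t u - (s - t) *\<^sub>R F ?v) \<le> e * norm (s - t)"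
    proof cases
      case 2
      then have "\<phi> s u - \<phi> t u = \<phi> (s - t) ?v"
        using phi_add[of "s - t" t u] t u by simp
      moreover have "norm (\<phi> (s - t) ?v - of_real (s - t) * F ?v) \<le> e / 2 * (s - t)"
        using 2 s by (intro d1(2)) auto
      moreover have "e / 2 * (s - t) \<le> e * (s - t)" using 2 e by simp
      ultimately show ?thesis using 2 by (simp add: scaleR_conv_of_real)
    next
      case 3
      define r where "r = t - s"
      have r: "0 < r" "r < d1" "r \<le> T" using 3 s by (auto simp: r_def)
      let ?w = "\<psi> s u"
      have wU: "?w \<in> U" using s u by (intro psi_in_U) auto
      have "\<phi> t u - \<phi> s u = \<phi> r ?w"
        using phi_add[of r s u] r s u by (simp add: r_def)
      moreover have dw: "norm (?w - ?v) < min d2 1"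
        using d3(2)[OF s(1)] s(2) by (simp add: dist_norm)
      moreover have "norm ?w \<le> norm ?v + 1"
        using dw norm_triangle_sub[of ?w ?v] by simp
      then have "norm (\<phi> r ?w - \<phi> r ?v) \<le> e / 2 * r"
        using r wU vU dw by (intro d2(2)) auto
      moreover have "norm (\<phi> r ?v - of_real r * F ?v) \<le> e / 2 * r"
        by (rule d1(2)[OF r(1,2)])
      moreover have "\<phi> s u - \<phi> t u - (s - t) *\<^sub>R F ?v = - ((\<phi> r ?w - \<phi> r ?v) + (\<phi> r ?v - of_real r * F ?v))"
        using \<open>\<phi> t u - \<phi> s u = \<phi> r ?w\<close> by (simp add: r_def scaleR_conv_of_real algebra_simps)
      ultimately have "norm (\<phi> s u - \<phi> t u - (s - t) *\<^sub>R F ?v) \<le> e / 2 * r + e / 2 * r"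
        using norm_triangle_ineq[of "\<phi> r ?w - \<phi> r ?v" "\<phi> r ?v - of_real r * F ?v"] 
        by (simp only: norm_minus_cancel)
      then show ?thesis using 3 by (simp add: r_def)
    qed simp
  qed
qed

lemma phi_has_integral:
  assumes u: "u \<in> U" and t: "t \<ge> 0"
  shows "((\<lambda>s. F (\<psi> s u)) has_integral \<phi> t u) {0..t}"
proof -
  have "((\<lambda>s. F (\<psi> s u)) has_integral \<phi> t u - \<phi> 0 u) {0..t}"
  proof (rule fundamental_theorem_of_calculus[OF t])
    fix s assume "s \<in> {0..t}"
    then have s: "0 \<le> s" by simp
    show "((\<lambda>t. \<phi> t u) has_vector_derivative F (\<psi> s u)) (at s within {0..t})"
      by (rule has_vector_derivative_within_subset[OF phi_has_vector_derivative[OF u s]]) auto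
  qed
  then show ?thesis using phi_0_u[OF u] by simp
qed

end

section \<open>Uniqueness of characteristic functions\<close>

text \<open>The value at 0 is the total mass. Measures of mass 0 are trivial; all others are
  normalised to probability measures, where Levy uniqueness applies.\<close>

lemma finite_measure_eq_of_char:
  fixes \<mu> \<nu> :: "real measure"
  assumes fin: "finite_measure \<mu>" "finite_measure \<nu>" and sets: "sets \<mu> = sets borel" "sets \<nu> = sets borel"
    and char: "\<And>t. char \<mu> t = char \<nu> t"
  shows "\<mu> = \<nu>"
proof -
  interpret \<mu>: finite_measure \<mu> by fact
  interpret \<nu>: finite_measure \<nu> by fact
  have space: "space \<mu> = UNIV" "space \<nu> = UNIV"
    using sets_eq_imp_space_eq[OF sets(1)] sets_eq_imp_space_eq[OF sets(2)] by simp_all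
  define c where "c = measure \<mu> UNIV"
  have c': "c = measure \<nu> UNIV"
    using char[of 0] space by (simp add: char_def c_def)
  show ?thesis
  proof (cases "c = 0")
    case True
    have "emeasure \<mu> UNIV = 0" "emeasure \<nu> UNIV = 0"
      using True c' by (simp_all add: \<mu>.emeasure_eq_measure \<nu>.emeasure_eq_measure c_def)
    then have "emeasure \<mu> A = 0" "emeasure \<nu> A = 0" if "A \<in> sets borel" for A
      using emeasure_mono[of A UNIV \<mu>] emeasure_mono[of A UNIV \<nu>] sets by (simp_all add: le_zero_eq)
    then show ?thesis using sets by (intro measure_eqI) auto
  next
    case False
    then have c: "c > 0" by (simp add: c_def zero_less_measure_iff)
    let ?n = "\<lambda>M. density M (\<lambda>_. ennreal (1 / c))"
    have dist: "real_distribution (?n M)" if "finite_measure M" "sets M = sets borel" "measure M UNIV = c" for M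
    proof -
      interpret finite_measure M by fact
      have "space M = UNIV" using sets_eq_imp_space_eq[OF that(2)] by simp
      then have "emeasure (?n M) (space (?n M)) = ennreal (1 / c) * ennreal c"
        using that by (simp add: emeasure_density nn_integral_cmult emeasure_eq_measure)
      also have "\<dots> = 1" using c by (simp flip: ennreal_mult)
      finally have "prob_space (?n M)" by (rule prob_spaceI)
      then show ?thesis using that by (simp add: real_distribution_def real_distribution_axioms_def)
    qed
    have char_n: "char (?n M) t = of_real (1 / c) * char M t" if "sets M = sets borel" for M t
    proof -
      have [measurable_cong]: "sets M = sets borel" by fact
      have "char (?n M) t = (CLINT x|M. (1 / c) *\<^sub>R iexp (t * x))"
        unfolding char_def using c by (subst integral_density) auto
      then show ?thesis unfolding char_def by (simp add: scaleR_conv_of_real)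
    qed
    have "?n \<mu> = ?n \<nu>"
      using dist[OF fin(1) sets(1)] dist[OF fin(2) sets(2)] c' char char_n sets
      by (intro Levy_uniqueness) (auto simp: c_def)
    have renorm: "M = density (?n M) (\<lambda>_. ennreal c)" if "sets M = sets borel" for M :: "real measure"
    proof -
      have "density (?n M) (\<lambda>_. ennreal c) = density M (\<lambda>x. ennreal (1 / c) * ennreal c)"
        by (intro density_density_eq) auto
      also have "\<dots> = density M (\<lambda>_. 1)" using c by (simp flip: ennreal_mult)
      finally show ?thesis by (simp add: density_1)
    qed
    show ?thesis using renorm[OF sets(1)] renorm[OF sets(2)] \<open>?n \<mu> = ?n \<nu>\<close> by simp
  qed
qed

text \<open>Uniqueness in two dimensions is reduced to one dimension by weighting the marginal of the first
  coordinate with the nonnegative densities \<open>1 + cos (\<theta> * y)\<close> and \<open>1 + sin (\<theta> * y)\<close> of the second.\<close>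

lemma
  fixes w :: "real \<times> real \<Rightarrow> real" and p :: "real \<times> real \<Rightarrow> real"
  assumes \<rho>: "\<rho> \<in> prob_D" and w [measurable]: "w \<in> borel_measurable borel" and p [measurable]: "p \<in> borel_measurable borel"
    and wb: "\<And>x. 0 \<le> w x" "\<And>x. w x \<le> B"
  shows weighted_marginal_finite: "finite_measure (distr (density \<rho> w) borel p)"
    and weighted_marginal_integral: "\<And>g :: real \<Rightarrow> 'b::{banach, second_countable_topology}. g \<in> borel_measurable borel \<Longrightarrow>
      (LINT x|distr (density \<rho> w) borel p. g x) = (LINT \<xi>|\<rho>. w \<xi> *\<^sub>R g (p \<xi>))"
proof -
  interpret prob_space \<rho> using \<rho> prob_DD by blast
  have wm [measurable]: "w \<in> borel_measurable \<rho>" and pm [measurable]: "p \<in> borel_measurable \<rho>"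
    using w p by (auto intro!: prob_D_measurable[OF \<rho>])
  have "emeasure (density \<rho> w) (space (density \<rho> w)) = (\<integral>\<^sup>+ x. w x \<partial>\<rho>)"
    by (simp add: emeasure_density cong: nn_integral_cong)
  also have "\<dots> \<le> (\<integral>\<^sup>+ x. B \<partial>\<rho>)"
    using wb by (intro nn_integral_mono ennreal_leI)
  also have "\<dots> < \<infinity>" by (simp add: emeasure_space_1)
  finally have fin: "finite_measure (density \<rho> w)" by (intro finite_measureI) simp
  then show "finite_measure (distr (density \<rho> w) borel p)"
    using pm by (intro finite_measure.finite_measure_distr) simp_all
  fix g :: "real \<Rightarrow> 'b" assume [measurable]: "g \<in> borel_measurable borel"
  have "(LINT x|distr (density \<rho> w) borel p. g x) = (LINT \<xi>|density \<rho> w. g (p \<xi>))"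
    by (subst integral_distr) auto
  also have "\<dots> = (LINT \<xi>|\<rho>. w \<xi> *\<^sub>R g (p \<xi>))"
    using wb by (subst integral_density) auto
  finally show "(LINT x|distr (density \<rho> w) borel p. g x) = (LINT \<xi>|\<rho>. w \<xi> *\<^sub>R g (p \<xi>))" .
qed

lemma prob_D_eq_of_char_fun:
  assumes \<rho>: "\<rho> \<in> prob_D" "\<rho>' \<in> prob_D" and eq: "\<And>u. u \<in> U \<Longrightarrow> char_fun \<rho> u = char_fun \<rho>' u"
  shows "\<rho> = \<rho>'"
proof -
  interpret r: prob_space \<rho> using \<rho> prob_DD by blast
  interpret r': prob_space \<rho>' using \<rho> prob_DD by blast
  have [measurable]: "fst \<in> borel_measurable (borel :: (real \<times> real) measure)" "snd \<in> borel_measurable (borel :: (real \<times> real) measure)"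
    by (intro borel_measurable_continuous_onI continuous_intros)+
  define e :: "real \<Rightarrow> real \<Rightarrow> real \<times> real \<Rightarrow> complex" where "e s t \<xi> = iexp (s * fst \<xi> + t * snd \<xi>)" for s t \<xi>
  have e_meas [measurable]: "e s t \<in> borel_measurable borel" for s t
    unfolding e_def by measurable
  have e_int: "integrable M (e s t)" if "M \<in> prob_D" for M s t
    by (rule integrable_bounded_on_D[OF that e_meas, where B = 1]) (simp add: e_def)
  have e_eq: "(LINT \<xi>|\<rho>. e s t \<xi>) = (LINT \<xi>|\<rho>'. e s t \<xi>)" for s t
    using eq[of "(\<i> * of_real s, \<i> * of_real t)"]
    by (simp add: char_fun_def in_U_iff pairing_def e_def algebra_simps)
  \<comment> \<open>The phase treats cosine and sine at once: \<alpha> = - pi / 2 turns the cosine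
    into the sine. The summand 1 makes the density nonnegative.\<close>
  define c where "c M t \<alpha> = distr (density M (\<lambda>\<xi>. 1 + cos (t * snd \<xi> + \<alpha>))) borel fst" for M :: "(real \<times> real) measure" and t \<alpha>
  have cosb: "0 \<le> 1 + cos x" "1 + cos x \<le> 2" for x :: real
    using cos_ge_minus_one[of x] cos_le_one[of x] by linarith+
  have c_eq: "c \<rho> t \<alpha> = c \<rho>' t \<alpha>" for t \<alpha>
  proof (rule finite_measure_eq_of_char)
    have fin: "finite_measure (c M t \<alpha>)" if "M \<in> prob_D" for M
      unfolding c_def by (rule weighted_marginal_finite[OF that _ _ cosb]) measurable
    show "finite_measure (c \<rho> t \<alpha>)" "finite_measure (c \<rho>' t \<alpha>)"
      using fin \<rho> by blast+
    have ch: "char (c M t \<alpha>) s = (LINT \<xi>|M. e s 0 \<xi>) + (iexp \<alpha> / 2) * (LINT \<xi>|M. e s t \<xi>) + (iexp (- \<alpha>) / 2) * (LINT \<xi>|M. e s (- t) \<xi>)"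
      if M: "M \<in> prob_D" for M s
    proof -
      have pw: "(1 + cos (t * snd \<xi> + \<alpha>)) *\<^sub>R iexp (s * fst \<xi>) = e s 0 \<xi> + (iexp \<alpha> / 2) * e s t \<xi> + (iexp (- \<alpha>) / 2) * e s (- t) \<xi>" for \<xi>
      proof -
        have "complex_of_real (cos (t * snd \<xi> + \<alpha>)) = (iexp (t * snd \<xi> + \<alpha>) + iexp (- (t * snd \<xi> + \<alpha>))) / 2"
          unfolding cos_of_real[symmetric] cos_exp_eq by (simp only: of_real_minus mult_minus_right)
        moreover have "iexp (t * snd \<xi> + \<alpha>) * iexp (s * fst \<xi>) = iexp \<alpha> * e s t \<xi>"
          "iexp (- (t * snd \<xi> + \<alpha>)) * iexp (s * fst \<xi>) = iexp (- \<alpha>) * e s (- t) \<xi>"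
          unfolding e_def exp_add[symmetric] by (rule arg_cong[where f = exp], simp add: algebra_simps)+
        moreover have "iexp (s * fst \<xi>) = e s 0 \<xi>" by (simp add: e_def)
        ultimately show ?thesis
          by (simp only: scaleR_conv_of_real of_real_add of_real_1 distrib_right add_divide_distrib mult_1_left
              times_divide_eq_left add.assoc)
      qed
      have "char (c M t \<alpha>) s = (LINT \<xi>|M. (1 + cos (t * snd \<xi> + \<alpha>)) *\<^sub>R iexp (s * fst \<xi>))"
        unfolding char_def c_def by (rule weighted_marginal_integral[OF M _ _ cosb]) measurable
      also have "\<dots> = (LINT \<xi>|M. e s 0 \<xi>) + (iexp \<alpha> / 2) * (LINT \<xi>|M. e s t \<xi>) + (iexp (- \<alpha>) / 2) * (LINT \<xi>|M. e s (- t) \<xi>)"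
        unfolding pw using e_int[OF M] by (simp add: Bochner_Integration.integral_add)
      finally show ?thesis .
    qed
    show "char (c \<rho> t \<alpha>) s = char (c \<rho>' t \<alpha>) s" for s
      unfolding ch[OF \<rho>(1)] ch[OF \<rho>(2)] e_eq ..
  qed (simp_all add: c_def)
  have step1: "(LINT \<xi>|\<rho>. indicator A (fst \<xi>) * cos (t * snd \<xi> + \<alpha>)) = (LINT \<xi>|\<rho>'. indicator A (fst \<xi>) * cos (t * snd \<xi> + \<alpha>))"
    (is "?c \<rho> = ?c \<rho>'") if [measurable]: "A \<in> sets borel" for A :: "real set" and t \<alpha>
  proof -
    have I: "(LINT x|c M t \<alpha>. indicator A x) = (LINT \<xi>|M. (1 + cos (t * snd \<xi> + \<alpha>)) *\<^sub>R indicator A (fst \<xi>) :: real)"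
      if M: "M \<in> prob_D" for M t \<alpha>
      unfolding c_def by (rule weighted_marginal_integral[OF M _ _ cosb]) measurable
    have J: "(LINT \<xi>|M. (1 + cos (t * snd \<xi> + \<alpha>)) *\<^sub>R indicator A (fst \<xi>) :: real)
      = (LINT \<xi>|M. indicator A (fst \<xi>)) + (LINT \<xi>|M. indicator A (fst \<xi>) * cos (t * snd \<xi> + \<alpha>))" if M: "M \<in> prob_D" for M t \<alpha>
    proof -
      have "integrable M (\<lambda>\<xi>. indicator A (fst \<xi>) :: real)"
        by (rule integrable_bounded_on_D[OF M, where B = 1]) (auto split: split_indicator)
      moreover have "integrable M (\<lambda>\<xi>. indicator A (fst \<xi>) * cos (t * snd \<xi> + \<alpha>))"
        by (rule integrable_bounded_on_D[OF M, where B = 1]) (auto split: split_indicator)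
      ultimately have "(LINT \<xi>|M. indicator A (fst \<xi>) + indicator A (fst \<xi>) * cos (t * snd \<xi> + \<alpha>)) = (LINT \<xi>|M. indicator A (fst \<xi>)) + (LINT \<xi>|M. indicator A (fst \<xi>) * cos (t * snd \<xi> + \<alpha>))"
        by (rule Bochner_Integration.integral_add)
      then show ?thesis by (simp add: algebra_simps)
    qed
    have both: "(LINT \<xi>|\<rho>. indicator A (fst \<xi>)) + (LINT \<xi>|\<rho>. indicator A (fst \<xi>) * cos (t * snd \<xi> + \<alpha>))
      = (LINT \<xi>|\<rho>'. indicator A (fst \<xi>)) + (LINT \<xi>|\<rho>'. indicator A (fst \<xi>) * cos (t * snd \<xi> + \<alpha>))" for t \<alpha>
      using J[OF \<rho>(1)] J[OF \<rho>(2)] I[OF \<rho>(1)] I[OF \<rho>(2)] c_eq by metis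
    \<comment> \<open>For t = 0 and \<alpha> = pi / 2 the cosine vanishes, which isolates the plain
      first marginal; subtracting it removes the summand 1 from the density.\<close>
    have "(LINT \<xi>|\<rho>. indicator A (fst \<xi>)) = (LINT \<xi>|\<rho>'. indicator A (fst \<xi>) :: real)"
      using both[of 0 "pi / 2"] by simp
    then show "?c \<rho> = ?c \<rho>'" using both[of t \<alpha>] by simp
  qed
  have rect: "emeasure \<rho> ((A \<times> B) \<inter> D) = emeasure \<rho>' ((A \<times> B) \<inter> D)"
    if A [measurable]: "A \<in> sets borel" and B: "B \<in> sets borel" for A B :: "real set"
  proof -
    \<comment> \<open>Now the roles are exchanged: the first coordinate is restricted to
      \<open>A\<close>, and \<open>step1\<close> supplies the Fourier transform of the resulting
      measure in the second coordinate.\<close>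
    define d where "d M = distr (density M (\<lambda>\<xi>. indicator A (fst \<xi>) :: real)) borel snd" for M :: "(real \<times> real) measure"
    have "d \<rho> = d \<rho>'"
    proof (rule finite_measure_eq_of_char)
      show "finite_measure (d \<rho>)" "finite_measure (d \<rho>')"
        unfolding d_def by (rule weighted_marginal_finite[where B = 1]; use \<rho> in \<open>auto split: split_indicator\<close>)+
      have ch: "char (d M) t = of_real (LINT \<xi>|M. indicator A (fst \<xi>) * cos (t * snd \<xi> + 0)) + \<i> * of_real (LINT \<xi>|M. indicator A (fst \<xi>) * cos (t * snd \<xi> + (- (pi / 2))))"
        if M: "M \<in> prob_D" for M t
      proof -
        have "char (d M) t = (LINT \<xi>|M. (indicator A (fst \<xi>) :: real) *\<^sub>R iexp (t * snd \<xi>))"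
          unfolding char_def d_def by (rule weighted_marginal_integral[OF M, where B = 1]) (auto split: split_indicator)
        also have "\<dots> = (LINT \<xi>|M. of_real (indicator A (fst \<xi>) * cos (t * snd \<xi> + 0)) + \<i> * of_real (indicator A (fst \<xi>) * cos (t * snd \<xi> + (- (pi / 2)))))"
          by (intro Bochner_Integration.integral_cong refl)
            (auto simp: complex_eq_iff Re_exp Im_exp cos_diff split: split_indicator)
        also have "\<dots> = (LINT \<xi>|M. of_real (indicator A (fst \<xi>) * cos (t * snd \<xi> + 0))) + (LINT \<xi>|M. \<i> * of_real (indicator A (fst \<xi>) * cos (t * snd \<xi> + (- (pi / 2)))))"
          by (intro Bochner_Integration.integral_add integrable_bounded_on_D[OF M, where B = 1])
            (auto simp: norm_mult split: split_indicator)
        finally show ?thesis by (simp only: integral_mult_right_zero integral_complex_of_real)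
      qed
      show "char (d \<rho>) t = char (d \<rho>') t" for t
        unfolding ch[OF \<rho>(1)] ch[OF \<rho>(2)] step1[OF A] ..
    qed (simp_all add: d_def)
    have em: "emeasure (d M) B = emeasure M ((A \<times> B) \<inter> D)" if M: "M \<in> prob_D" for M
    proof -
      have sm [measurable]: "snd \<in> borel_measurable M" "fst \<in> borel_measurable M"
        by (auto intro!: prob_D_measurable[OF M])
      have "emeasure (d M) B = emeasure (density M (\<lambda>\<xi>. indicator A (fst \<xi>) :: real)) (snd -` B \<inter> space M)"
        unfolding d_def using B by (subst emeasure_distr) auto
      also have "\<dots> = (\<integral>\<^sup>+ \<xi>. ennreal (indicator A (fst \<xi>)) * indicator (snd -` B \<inter> space M) \<xi> \<partial>M)"
        using B by (subst emeasure_density) auto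
      also have "\<dots> = (\<integral>\<^sup>+ \<xi>. indicator ((A \<times> B) \<inter> D) \<xi> \<partial>M)"
        using prob_DD(3)[OF M] by (intro nn_integral_cong) (auto split: split_indicator)
      also have "\<dots> = emeasure M ((A \<times> B) \<inter> D)"
      proof (intro nn_integral_indicator sets_on_D[OF prob_DD(2)[OF M]])
        have "A \<times> B \<in> sets (borel \<Otimes>\<^sub>M borel)" using A B by simp
        then show "(A \<times> B) \<inter> D \<in> sets borel" unfolding borel_prod by (rule sets.Int[OF _ D_in_sets])
      qed simp
      finally show ?thesis .
    qed
    show ?thesis using em[OF \<rho>(1)] em[OF \<rho>(2)] unfolding \<open>d \<rho> = d \<rho>'\<close> by simp
  qed
  \<comment> \<open>Both laws are pushed from \<open>D\<close> to the whole plane, where the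
    rectangles form a generating family closed under intersection.\<close>
  have distr: "distr \<rho> (borel \<Otimes>\<^sub>M borel) (\<lambda>x. x) = distr \<rho>' (borel \<Otimes>\<^sub>M borel) (\<lambda>x. x)"
  proof (rule measure_eqI_generator_eq[OF Int_stable_pair_measure_generator[of borel borel]])
    have id: "(\<lambda>x. x) \<in> M \<rightarrow>\<^sub>M (borel \<Otimes>\<^sub>M borel :: (real \<times> real) measure)" if "M \<in> prob_D" for M
      using prob_D_measurable[OF that, of "\<lambda>x. x"] by (simp add: borel_prod)
    have em: "emeasure (distr M (borel \<Otimes>\<^sub>M borel) (\<lambda>x. x)) X = emeasure M (X \<inter> D)"
      if M: "M \<in> prob_D" and X: "X \<in> sets (borel \<Otimes>\<^sub>M borel)" for M and X :: "(real \<times> real) set"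
      using emeasure_distr[OF id[OF M] X] prob_DD(3)[OF M] by simp
    let ?E = "{a \<times> b |a b. a \<in> sets borel \<and> b \<in> sets (borel :: real measure)} :: (real \<times> real) set set"
    show "?E \<subseteq> Pow (space borel \<times> space borel)" by auto
    show "sets (distr \<rho> (borel \<Otimes>\<^sub>M borel) (\<lambda>x. x)) = sigma_sets (space borel \<times> space borel) ?E"
      "sets (distr \<rho>' (borel \<Otimes>\<^sub>M borel) (\<lambda>x. x)) = sigma_sets (space borel \<times> space borel) ?E"
      by (simp_all only: sets_distr sets_pair_measure)
    show "emeasure (distr \<rho> (borel \<Otimes>\<^sub>M borel) (\<lambda>x. x)) X = emeasure (distr \<rho>' (borel \<Otimes>\<^sub>M borel) (\<lambda>x. x)) X" if X: "X \<in> ?E" for X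
    proof -
      from X obtain a b where ab: "X = a \<times> b" "a \<in> sets borel" "b \<in> sets borel" by auto
      then have "X \<in> sets (borel \<Otimes>\<^sub>M borel)" by simp
      then have "emeasure (distr M (borel \<Otimes>\<^sub>M borel) (\<lambda>x. x)) X = emeasure M ((a \<times> b) \<inter> D)" if "M \<in> prob_D" for M
        using em[OF that] ab(1) by simp
      then show ?thesis using \<rho> rect[OF ab(2,3)] by simp
    qed
    have "(UNIV :: (real \<times> real) set) \<in> ?E"
      by (intro CollectI exI[of _ UNIV] conjI) simp_all
    then show "range (\<lambda>_::nat. UNIV) \<subseteq> ?E" by blast
    show "(\<Union>i::nat. UNIV) = (space borel \<times> space borel :: (real \<times> real) set)" by simp
    show "emeasure (distr \<rho> (borel \<Otimes>\<^sub>M borel) (\<lambda>x. x)) UNIV \<noteq> \<infinity>" for i :: nat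
      using finite_measure.emeasure_finite[OF r.finite_measure_distr[OF id[OF \<rho>(1)]]] by simp
  qed
  show ?thesis
  proof (rule measure_eqI)
    show "sets \<rho> = sets \<rho>'" using prob_DD(2)[OF \<rho>(1)] prob_DD(2)[OF \<rho>(2)] by simp
    fix X assume "X \<in> sets \<rho>"
    then have "X \<in> sets borel" "X \<subseteq> D"
      unfolding prob_DD(2)[OF \<rho>(1)] by (auto simp: sets_restrict_space intro!: sets.Int D_in_sets)
    then have X: "X \<in> sets (borel \<Otimes>\<^sub>M borel)" "X \<subseteq> D"
      unfolding borel_prod by simp_all
    have id: "(\<lambda>x. x) \<in> M \<rightarrow>\<^sub>M (borel \<Otimes>\<^sub>M borel :: (real \<times> real) measure)" if "M \<in> prob_D" for M
      using prob_D_measurable[OF that, of "\<lambda>x. x"] by (simp add: borel_prod)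
    have "emeasure M X = emeasure (distr M (borel \<Otimes>\<^sub>M borel) (\<lambda>x. x)) X" if M: "M \<in> prob_D" for M
      using emeasure_distr[OF id[OF M] X(1)] prob_DD(3)[OF M] X(2) by (simp add: Int_absorb2)
    from this[OF \<rho>(1)] this[OF \<rho>(2)] show "emeasure \<rho> X = emeasure \<rho>' X" unfolding distr by simp
  qed
qed

section \<open>Limits of characteristic functions\<close>

text \<open>A Schoenberg-type curve: a continuous map of the line onto the plane with a measurable section that
  is bounded on bounded sets. Through it, tightness and Helly selection pass from the line to the plane.\<close>

definition tri :: "real \<Rightarrow> real" where
  "tri t = arccos (cos (pi * t)) / pi"

text \<open>\<open>tri\<close> is the distance to the nearest even integer, so this function has
  period 2; on [0, 1] it is 0 up to 1/3 and 1 from 2/3 on. On Cantor points it turns the leading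
  ternary digit 0 or 2 into 0 or 1.\<close>

definition plateau :: "real \<Rightarrow> real" where
  "plateau t = max 0 (min 1 (3 * tri t - 1))"

definition ternary :: "(nat \<Rightarrow> real) \<Rightarrow> real" where
  "ternary d = (\<Sum>j. 2 * d j / 3 ^ Suc j)"

definition binary_digit :: "real \<Rightarrow> nat \<Rightarrow> real" where
  "binary_digit x k = of_int \<lfloor>2 ^ Suc k * x\<rfloor> - 2 * of_int \<lfloor>2 ^ k * x\<rfloor>"

text \<open>Coordinates of Schoenberg's space-filling curve: at a Cantor point, the ternary digits
  at the even places (i = 0) or the odd places (i = 1) become the binary digits of the
  value.\<close>

definition curve :: "nat \<Rightarrow> real \<Rightarrow> real" where
  "curve i t = (\<Sum>k. plateau (3 ^ (2 * k + i) * t) / 2 ^ Suc k)"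

definition interleave :: "real \<Rightarrow> real \<Rightarrow> nat \<Rightarrow> real" where
  "interleave x y j = (if even j then binary_digit x (j div 2) else binary_digit y (j div 2))"

text \<open>The factor t - tri t equals 2 N on [2 N, 2 N + 1] and is continuous in between, so
  successive unit intervals carry the unit-square curve rescaled to larger and larger squares around
  0.\<close>

definition plane_curve :: "real \<Rightarrow> real \<times> real" where
  "plane_curve t = ((t - tri t) * (2 * curve 0 t - 1), (t - tri t) * (2 * curve 1 t - 1))"

text \<open>Even, to agree with a constant stretch of t - tri t, and strictly larger than both
  coordinates, so that the rescaled coordinates lie in [0, 1) and have binary expansions.\<close>

definition plane_radius :: "real \<times> real \<Rightarrow> real" where
  "plane_radius x = 2 * of_int (\<lceil>max \<bar>fst x\<bar> \<bar>snd x\<bar>\<rceil> + 1)"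

definition plane_section :: "real \<times> real \<Rightarrow> real" where
  "plane_section x = plane_radius x +
     ternary (interleave ((fst x / plane_radius x + 1) / 2) ((snd x / plane_radius x + 1) / 2))"

section \<open>Digits, and the curve as a left inverse of its section\<close>

lemma tri_even_add:
  fixes i :: int
  assumes "0 \<le> x" "x \<le> 1"
  shows "tri (2 * of_int i + x) = x"
proof -
  have "cos (pi * (2 * of_int i + x)) = cos (pi * x + of_int i * (2 * pi))"
    by (simp add: algebra_simps)
  also have "\<dots> = cos (pi * x)"
    by (simp add: cos_add mult.commute[of "of_int i"] cos_int_2pin sin_int_2pin)
  finally show ?thesis
    using assms by (simp add: tri_def arccos_cos mult_left_le)
qed

lemma plateau_even_add:
  fixes i :: int
  assumes "0 \<le> x" "x \<le> 1"
  shows "plateau (2 * of_int i + x) = max 0 (min 1 (3 * x - 1))"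
  using tri_even_add[OF assms] by (simp add: plateau_def)

lemma continuous_tri: "continuous_on A tri"
  unfolding tri_def by (intro continuous_intros) auto

lemma plateau_bounds: "0 \<le> plateau t" "plateau t \<le> 1"
  by (auto simp: plateau_def)

lemma continuous_plateau: "continuous_on A plateau"
  unfolding plateau_def by (intro continuous_intros continuous_tri)

lemma summable_ternary:
  assumes "\<And>j. d j \<in> {0, 1}"
  shows "summable (\<lambda>j. 2 * d j / 3 ^ Suc j :: real)"
proof (rule summable_comparison_test')
  show "summable (\<lambda>j. 2 / 3 * (1 / 3) ^ j :: real)"
    by (intro summable_mult summable_geometric) simp
  show "norm (2 * d j / 3 ^ Suc j) \<le> 2 / 3 * (1 / 3) ^ j" if "j \<ge> 0" for j
    using assms[of j] by (auto simp: power_one_over divide_simps)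
qed

lemma ternary_step:
  assumes "\<And>j. d j \<in> {0, 1}"
  shows "3 * ternary d = 2 * d 0 + ternary (\<lambda>j. d (Suc j))"
proof -
  have "ternary d = (\<Sum>j. 2 * d (Suc j) / 3 ^ Suc (Suc j)) + 2 * d 0 / 3 ^ Suc 0"
    unfolding ternary_def by (subst suminf_split_head[OF summable_ternary[OF assms]]) simp
  also have "(\<lambda>j. 2 * d (Suc j) / 3 ^ Suc (Suc j)) = (\<lambda>j. (2 * d (Suc j) / 3 ^ Suc j) / 3)"
    by (simp add: fun_eq_iff)
  also have "(\<Sum>j. (2 * d (Suc j) / 3 ^ Suc j) / 3) = ternary (\<lambda>j. d (Suc j)) / 3"
    unfolding ternary_def by (rule suminf_divide[OF summable_ternary]) (use assms in auto)
  finally show ?thesis by simp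
qed

lemma ternary_bounds:
  assumes "\<And>j. d j \<in> {0, 1}"
  shows "0 \<le> ternary d" "ternary d \<le> 1"
proof -
  have d: "0 \<le> d j" "d j \<le> 1" for j using assms[of j] by auto
  show "0 \<le> ternary d"
    unfolding ternary_def by (rule suminf_nonneg[OF summable_ternary[OF assms]]) (use d in auto)
  have "(\<lambda>j. 2 / 3 * (1 / 3) ^ j :: real) sums (2 / 3 * (1 / (1 - 1 / 3)))"
    by (intro sums_mult geometric_sums) simp
  then have s: "(\<lambda>j. 2 / 3 * (1 / 3) ^ j :: real) sums 1" by simp
  have "ternary d \<le> (\<Sum>j. 2 / 3 * (1 / 3) ^ j)"
    unfolding ternary_def
  proof (rule suminf_le[OF _ summable_ternary[OF assms] sums_summable[OF s]])
    show "2 * d j / 3 ^ Suc j \<le> 2 / 3 * (1 / 3) ^ j" for j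
      using d[of j] by (simp add: power_one_over divide_simps)
  qed
  then show "ternary d \<le> 1" using sums_unique[OF s] by simp
qed

text \<open>Multiplication by 3 moves the leading digit, 0 or 2, in front of the point. Everything
  shifted out is an even integer, invisible to functions of period 2.\<close>

lemma ternary_shift:
  assumes "\<And>j. d j \<in> {0, 1}"
  shows "\<exists>i::int. 3 ^ k * ternary d = 2 * of_int i + ternary (\<lambda>j. d (j + k))"
proof (induction k)
  case 0
  show ?case by (intro exI[of _ 0]) simp
next
  case (Suc k)
  then obtain i :: int where i: "3 ^ k * ternary d = 2 * of_int i + ternary (\<lambda>j. d (j + k))" by blast
  have "3 * ternary (\<lambda>j. d (j + k)) = 2 * d k + ternary (\<lambda>j. d (j + Suc k))"
    using ternary_step[of "\<lambda>j. d (j + k)"] assms by simp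
  moreover obtain e :: int where "d k = of_int e"
    using assms[of k] by (metis insertE of_int_0 of_int_1 singletonD)
  ultimately have "3 ^ Suc k * ternary d = 2 * of_int (3 * i + e) + ternary (\<lambda>j. d (j + Suc k))"
    using i by simp
  then show ?case by blast
qed

text \<open>After the shift by \<open>k\<close> places the remaining ternary number starts with the
  digit 2 d k: it is at most 1/3 or at least 2/3, where \<open>plateau\<close> is exactly 0 or
  1.\<close>

lemma plateau_ternary:
  fixes n :: int
  assumes "\<And>j. d j \<in> {0, 1}"
  shows "plateau (3 ^ k * (2 * of_int n + ternary d)) = d k"
proof -
  obtain i :: int where i: "3 ^ k * ternary d = 2 * of_int i + ternary (\<lambda>j. d (j + k))"
    using ternary_shift[of d k] assms by blast
  let ?x = "ternary (\<lambda>j. d (j + k))"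
  have x: "0 \<le> ?x" "?x \<le> 1" using ternary_bounds[of "\<lambda>j. d (j + k)"] assms by auto
  have "0 \<le> ternary (\<lambda>j. d (Suc j + k))" "ternary (\<lambda>j. d (Suc j + k)) \<le> 1"
    using ternary_bounds[of "\<lambda>j. d (Suc j + k)"] assms by auto
  moreover have "3 * ?x = 2 * d k + ternary (\<lambda>j. d (Suc j + k))"
    using ternary_step[of "\<lambda>j. d (j + k)"] assms by simp
  moreover have "plateau (3 ^ k * (2 * of_int n + ternary d)) = max 0 (min 1 (3 * ?x - 1))"
  proof -
    have "3 ^ k * (2 * of_int n + ternary d) = 2 * of_int (3 ^ k * n + i) + ?x"
      using i by (simp add: algebra_simps)
    then show ?thesis using plateau_even_add[OF x] by metis
  qed
  ultimately show ?thesis using assms[of k] by auto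
qed

lemma binary_digit: "binary_digit x k \<in> {0, 1}"
proof -
  define y where "y = 2 ^ k * x"
  have "\<lfloor>2 * y\<rfloor> = 2 * \<lfloor>y\<rfloor> \<or> \<lfloor>2 * y\<rfloor> = 2 * \<lfloor>y\<rfloor> + 1"
    by linarith
  then have "real_of_int \<lfloor>2 * y\<rfloor> - 2 * of_int \<lfloor>y\<rfloor> \<in> {0, 1}" by auto
  then show ?thesis by (simp add: binary_digit_def y_def mult.assoc)
qed

text \<open>The partial sums telescope to floor (2^n x) / 2^n, which is within 2^(-n) of
  \<open>x\<close>.\<close>

lemma binary_expansion:
  assumes "0 \<le> x" "x < 1"
  shows "(\<lambda>k. binary_digit x k / 2 ^ Suc k) sums x"
proof -
  let ?f = "\<lambda>n. of_int \<lfloor>2 ^ n * x\<rfloor> / 2 ^ n :: real"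
  have eq: "binary_digit x k / 2 ^ Suc k = ?f (Suc k) - ?f k" for k
    by (simp add: binary_digit_def diff_divide_distrib)
  have "?f \<longlonglongrightarrow> x"
  proof (rule tendsto_sandwich)
    have "(\<lambda>n. x - (1 / 2) ^ n) \<longlonglongrightarrow> x - 0"
      by (intro tendsto_intros LIMSEQ_power_zero) simp
    then show "(\<lambda>n. x - (1 / 2) ^ n) \<longlonglongrightarrow> x" by simp
    show "\<forall>\<^sub>F n in sequentially. x - (1 / 2) ^ n \<le> ?f n"
    proof (intro always_eventually allI)
      fix n
      have "2 ^ n * x - 1 \<le> of_int \<lfloor>2 ^ n * x\<rfloor>" by linarith
      then have "(2 ^ n * x - 1) / 2 ^ n \<le> ?f n" by (rule divide_right_mono) simp
      then show "x - (1 / 2) ^ n \<le> ?f n" by (simp add: diff_divide_distrib power_one_over)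
    qed
    show "\<forall>\<^sub>F n in sequentially. ?f n \<le> x"
      by (intro always_eventually allI) (simp add: field_simps)
  qed simp
  moreover have "\<lfloor>x\<rfloor> = 0" using assms by linarith
  then have "?f 0 = 0" by simp
  ultimately have "(\<lambda>k. ?f (Suc k) - ?f k) sums (x - 0)"
    using telescope_sums[of ?f x] by simp
  then show ?thesis unfolding eq by simp
qed

lemma continuous_curve: "continuous_on UNIV (curve i)"
proof (rule uniform_limit_theorem)
  show "uniform_limit UNIV (\<lambda>n t. \<Sum>k<n. plateau (3 ^ (2 * k + i) * t) / 2 ^ Suc k) (curve i) sequentially"
    unfolding curve_def
  proof (rule Weierstrass_m_test)
    show "summable (\<lambda>k. (1 / 2) ^ k :: real)" by (rule summable_geometric) simp
    show "norm (plateau (3 ^ (2 * k + i) * t) / 2 ^ Suc k) \<le> (1 / 2) ^ k" for k t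
      using plateau_bounds[of "3 ^ (2 * k + i) * t"] by (simp add: power_one_over divide_simps)
  qed
  show "\<forall>\<^sub>F n in sequentially. continuous_on UNIV (\<lambda>t. \<Sum>k<n. plateau (3 ^ (2 * k + i) * t) / 2 ^ Suc k)"
    by (intro always_eventually allI continuous_intros continuous_on_compose2[OF continuous_plateau]) auto
qed simp

lemma continuous_plane_curve: "continuous_on UNIV plane_curve"
  unfolding plane_curve_def by (intro continuous_intros continuous_tri continuous_curve)

lemma interleave: "interleave x y j \<in> {0, 1}"
  using binary_digit by (simp add: interleave_def)

lemma plane_radius: "\<bar>fst x\<bar> < plane_radius x" "\<bar>snd x\<bar> < plane_radius x" "plane_radius x > 0"
proof -
  define c where "c = max \<bar>fst x\<bar> \<bar>snd x\<bar>"
  have c: "\<bar>fst x\<bar> \<le> c" "\<bar>snd x\<bar> \<le> c" by (simp_all add: c_def)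
  have "c < of_int (\<lceil>c\<rceil> + 1)" by linarith
  moreover have "plane_radius x = 2 * of_int (\<lceil>c\<rceil> + 1)" by (simp only: plane_radius_def c_def)
  moreover have "0 \<le> c" by (simp add: c_def)
  moreover have "p < 2 * q" if "p < q" "0 \<le> p" for p q :: real using that by linarith
  ultimately have r: "c < plane_radius x" by metis
  show "\<bar>fst x\<bar> < plane_radius x" using c r by linarith
  show "\<bar>snd x\<bar> < plane_radius x" using c r by linarith
  show "plane_radius x > 0" using r \<open>0 \<le> c\<close> by linarith
qed

lemma plane_curve_section: "plane_curve (plane_section x) = x"
proof -
  let ?n = "plane_radius x"
  let ?x = "(fst x / ?n + 1) / 2" and ?y = "(snd x / ?n + 1) / 2"
  let ?d = "interleave ?x ?y"
  obtain N :: int where N: "?n = 2 * of_int N" unfolding plane_radius_def by blast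
  have t: "plane_section x = 2 * of_int N + ternary ?d" by (simp add: plane_section_def N)
  have d: "?d j \<in> {0, 1}" for j by (rule interleave)
  have unit: "0 \<le> (c / ?n + 1) / 2" "(c / ?n + 1) / 2 < 1" if "\<bar>c\<bar> < ?n" for c
  proof -
    have "\<bar>c / ?n\<bar> < 1" using that plane_radius(3)[of x] by (simp add: abs_divide)
    then have "- 1 < c / ?n \<and> c / ?n < 1" unfolding abs_less_iff by linarith
    then show "0 \<le> (c / ?n + 1) / 2" "(c / ?n + 1) / 2 < 1" by simp_all
  qed
  have rad: "plane_section x - tri (plane_section x) = ?n"
    unfolding t using tri_even_add[OF ternary_bounds[OF d]] by (simp add: N)
  have "curve 0 (plane_section x) = (\<Sum>k. binary_digit ?x k / 2 ^ Suc k)"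
    unfolding curve_def t plateau_ternary[OF d] by (simp add: interleave_def)
  also have "\<dots> = ?x"
    using sums_unique[OF binary_expansion[OF unit[OF plane_radius(1)]]] by simp
  finally have c0: "curve 0 (plane_section x) = ?x" .
  have "curve 1 (plane_section x) = (\<Sum>k. binary_digit ?y k / 2 ^ Suc k)"
    unfolding curve_def t plateau_ternary[OF d] by (simp add: interleave_def)
  also have "\<dots> = ?y"
    using sums_unique[OF binary_expansion[OF unit[OF plane_radius(2)]]] by simp
  finally have c1: "curve 1 (plane_section x) = ?y" .
  show ?thesis
  proof -
    have "?n * (2 * ((c / ?n + 1) / 2) - 1) = c" for c
      using plane_radius(3)[of x] by (simp add: algebra_simps)
    then show ?thesis unfolding plane_curve_def rad c0 c1 by (simp only: prod.collapse)
  qed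
qed

lemma measurable_plane_section [measurable]: "plane_section \<in> borel_measurable borel"
proof -
  have rad [measurable]: "plane_radius \<in> borel_measurable borel"
    unfolding plane_radius_def by measurable
  have bd [measurable]: "(\<lambda>x. binary_digit (g x) k) \<in> borel_measurable borel"
    if [measurable]: "g \<in> borel_measurable borel" for g :: "real \<times> real \<Rightarrow> real" and k
    unfolding binary_digit_def by measurable
  show ?thesis
    unfolding plane_section_def ternary_def interleave_def by measurable
qed

text \<open>Boundedness on bounded sets carries tightness over to the line; strict positivity fits
  the half-open intervals in the notion of tightness.\<close>

lemma plane_section_bounds:
  assumes "\<bar>fst x\<bar> \<le> K" "\<bar>snd x\<bar> \<le> K"
  shows "0 < plane_section x" "plane_section x \<le> 2 * (K + 2) + 1"
proof -
  have t: "0 \<le> ternary (interleave a b)" "ternary (interleave a b) \<le> 1" for a b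
    using ternary_bounds[of "interleave a b"] interleave by blast+
  show "0 < plane_section x"
    unfolding plane_section_def using plane_radius(3)[of x] t(1) by (intro add_pos_nonneg)
  have "plane_radius x \<le> 2 * (K + 2)"
  proof -
    define c where "c = max \<bar>fst x\<bar> \<bar>snd x\<bar>"
    have "c \<le> K" using assms by (simp add: c_def)
    then have "of_int (\<lceil>c\<rceil> + 1) \<le> K + 2" by linarith
    then show ?thesis unfolding plane_radius_def c_def by simp
  qed
  then show "plane_section x \<le> 2 * (K + 2) + 1"
    unfolding plane_section_def using t(2) by (rule add_mono)
qed

section \<open>Tightness and the continuity theorem\<close>

lemma indicator_le: "(x \<in> A \<Longrightarrow> 1 \<le> c) \<Longrightarrow> 0 \<le> c \<Longrightarrow> indicator A x \<le> (c :: real)"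
  by (simp add: indicator_def)

lemma sets_large:
  "{\<xi>. c < fst \<xi>} \<in> sets (borel :: (real \<times> real) measure)"
  "{\<xi>. c < \<bar>snd \<xi>\<bar>} \<in> sets (borel :: (real \<times> real) measure)"
  by (intro borel_open open_Collect_less continuous_intros)+

text \<open>A Chebyshev bound: for x > 1 / \<delta> the function 1 - exp (-\<delta> x) is at least
  1/2, and its integral is read off the characteristic function on the first axis.\<close>

lemma prob_fst_large:
  assumes \<rho>: "\<rho> \<in> prob_D" and \<delta>: "\<delta> > 0"
  shows "measure \<rho> {\<xi>\<in>D. fst \<xi> > 1 / \<delta>} \<le> 2 * norm (char_fun \<rho> (- of_real \<delta>, 0) - 1)"
proof -
  interpret prob_space \<rho> using \<rho> prob_DD by blast
  let ?A = "{\<xi>\<in>D. fst \<xi> > 1 / \<delta>}" and ?u = "(- of_real \<delta>, 0) :: complex \<times> complex"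
  have u: "?u \<in> U" using \<delta> by (simp add: in_U_iff)
  have int: "integrable \<rho> (\<lambda>\<xi>. 1 - Re (exp (pairing ?u \<xi>)))"
    using integrable_exp_pairing[OF \<rho> u] by simp
  have A: "?A \<in> sets \<rho>"
  proof (rule sets_on_D[OF prob_DD(2)[OF \<rho>]])
    have "?A = D \<inter> {\<xi>. fst \<xi> > 1 / \<delta>}" by auto
    then show "?A \<in> sets borel" using sets_large(1) by simp
  qed auto
  have "measure \<rho> ?A = (LINT \<xi>|\<rho>. indicator ?A \<xi>)" using A by simp
  also have "\<dots> \<le> (LINT \<xi>|\<rho>. 2 * (1 - Re (exp (pairing ?u \<xi>))))"
  proof (rule integral_mono)
    show "integrable \<rho> (indicator ?A :: _ \<Rightarrow> real)" using A by (intro integrable_real_indicator) (auto simp: emeasure_eq_measure)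
    show "integrable \<rho> (\<lambda>\<xi>. 2 * (1 - Re (exp (pairing ?u \<xi>))))" using int by (rule integrable_mult_right)
    fix \<xi> assume "\<xi> \<in> space \<rho>"
    then have \<xi>: "\<xi> \<in> D" using prob_DD(3)[OF \<rho>] by simp
    have Re: "Re (exp (pairing ?u \<xi>)) = exp (- (\<delta> * fst \<xi>))" by (simp add: pairing_def Re_exp)
    have ge: "min 1 (\<delta> * fst \<xi>) / 2 \<le> 1 - exp (- (\<delta> * fst \<xi>))"
      using \<xi> \<delta> by (intro one_minus_exp_ge) (simp add: in_D_iff)
    show "indicator ?A \<xi> \<le> 2 * (1 - Re (exp (pairing ?u \<xi>)))"
      unfolding Re
    proof (rule indicator_le)
      assume "\<xi> \<in> ?A"
      then have "1 \<le> \<delta> * fst \<xi>" using \<delta> by (simp add: field_simps)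
      from min_absorb1[OF this] show "1 \<le> 2 * (1 - exp (- (\<delta> * fst \<xi>)))" using ge by simp
    qed (use \<xi> \<delta> in \<open>simp add: in_D_iff\<close>)
  qed
  also have "\<dots> = 2 * (1 - Re (char_fun \<rho> ?u))"
    using integrable_exp_pairing[OF \<rho> u] prob_space by (simp add: char_fun_def)
  also have "\<dots> \<le> 2 * norm (char_fun \<rho> ?u - 1)"
    using abs_Re_le_cmod[of "char_fun \<rho> ?u - 1"] by simp
  finally show ?thesis .
qed

text \<open>A Chebyshev bound with \<open>wt\<close>, which is at least 1/10 beyond 1; its integral
  is the average of 1 - Re of the characteristic function over the frequencies up to
  \<open>\<delta>\<close>.\<close>

lemma prob_snd_large:
  assumes \<rho>: "\<rho> \<in> prob_D" and \<delta>: "\<delta> > 0"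
    and \<eta>: "\<And>y. 0 \<le> y \<Longrightarrow> y \<le> \<delta> \<Longrightarrow> norm (char_fun \<rho> (0, \<i> * of_real y) - 1) \<le> \<eta>"
  shows "measure \<rho> {\<xi>\<in>D. \<bar>snd \<xi>\<bar> > 1 / \<delta>} \<le> 10 * \<eta>"
proof -
  interpret prob_space \<rho> using \<rho> prob_DD by blast
  let ?A = "{\<xi>\<in>D. \<bar>snd \<xi>\<bar> > 1 / \<delta>}"
  have sf: "sigma_finite_measure \<rho>" ..
  have int: "integrable \<rho> (\<lambda>\<xi>. min 1 ((snd \<xi>)\<^sup>2))"
    by (rule integrable_bounded_on_D[OF \<rho>, where B = 1]) auto
  note swap = integral_one_minus_cos_swap[OF sf prob_DD(2)[OF \<rho>] int, of "\<lambda>_. 1" 1 \<delta>, simplified]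
  note intI = integrable_integral_one_minus_cos[OF sf prob_DD(2)[OF \<rho>] int, of "\<lambda>_. 1" 1 \<delta>, simplified]
  note intw = integrable_wt[OF sf prob_DD(2)[OF \<rho>] int, of "\<lambda>_. 1" 1 \<delta>, simplified]
  have A: "?A \<in> sets \<rho>"
  proof (rule sets_on_D[OF prob_DD(2)[OF \<rho>]])
    have "?A = D \<inter> {\<xi>. \<bar>snd \<xi>\<bar> > 1 / \<delta>}" by auto
    then show "?A \<in> sets borel" using sets_large(2) by simp
  qed auto
  have "measure \<rho> ?A = (LINT \<xi>|\<rho>. indicator ?A \<xi>)" using A by simp
  also have "\<dots> \<le> (LINT \<xi>|\<rho>. 10 * wt (\<delta> * snd \<xi>))"
  proof (rule integral_mono)
    show "integrable \<rho> (indicator ?A :: _ \<Rightarrow> real)" using A by (intro integrable_real_indicator) (auto simp: emeasure_eq_measure)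
    show "integrable \<rho> (\<lambda>\<xi>. 10 * wt (\<delta> * snd \<xi>))" using intw by simp
    fix \<xi> :: "real \<times> real"
    show "indicator ?A \<xi> \<le> 10 * wt (\<delta> * snd \<xi>)"
    proof (rule indicator_le)
      assume "\<xi> \<in> ?A"
      then have "1 \<le> \<bar>\<delta> * snd \<xi>\<bar>" using \<delta> by (simp add: abs_mult field_simps)
      then have "1 \<le> (\<delta> * snd \<xi>)\<^sup>2" using abs_le_square_iff[of 1 "\<delta> * snd \<xi>"] by simp
      from min_absorb1[OF this] show "1 \<le> 10 * wt (\<delta> * snd \<xi>)" using wt_lower[of "\<delta> * snd \<xi>"] by simp
    qed (use wt_nonneg in simp)
  qed
  also have "\<dots> = 10 * (LINT s|unit_unif. LINT \<xi>|\<rho>. 1 - cos (s * (\<delta> * snd \<xi>)))"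
    unfolding swap by simp
  also have "\<dots> \<le> 10 * (LINT s|unit_unif. \<eta>)"
  proof (intro mult_left_mono integral_mono intI)
    fix s assume "s \<in> space unit_unif"
    then have s: "0 \<le> s" "s \<le> 1" by (auto simp: space_restrict_space)
    let ?u = "(0, \<i> * of_real (s * \<delta>))"
    have u: "?u \<in> U" by (simp add: in_U_iff)
    have Re: "Re (exp (pairing ?u \<xi>)) = cos (s * (\<delta> * snd \<xi>))" for \<xi>
      by (simp add: pairing_def Re_exp mult.assoc)
    have "(LINT \<xi>|\<rho>. 1 - cos (s * (\<delta> * snd \<xi>))) = 1 - Re (char_fun \<rho> ?u)"
      using integrable_exp_pairing[OF \<rho> u] prob_space integrable_Re[OF integrable_exp_pairing[OF \<rho> u]]
      unfolding char_fun_def by (simp only: Re[symmetric]) (simp add: Bochner_Integration.integral_diff)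
    also have "\<dots> \<le> norm (char_fun \<rho> ?u - 1)"
      using abs_Re_le_cmod[of "char_fun \<rho> ?u - 1"] by simp
    also have "\<dots> \<le> \<eta>" using s \<delta> by (intro \<eta>) (auto simp: mult_left_le_one_le)
    finally show "(LINT \<xi>|\<rho>. 1 - cos (s * (\<delta> * snd \<xi>))) \<le> \<eta>" .
  qed auto
  also have "\<dots> = 10 * \<eta>" using unit_unif.prob_space by simp
  finally show ?thesis .
qed

text \<open>A continuity theorem of Levy type. Images under the section are tight on the line, so a
  subsequence converges weakly, and the continuous curve maps the limit back to the plane.
  Continuity of the section is not at issue: only functions composed with the curve are integrated,
  and the curve undoes the section.\<close>

lemma prob_D_limit:
  assumes \<rho>: "\<And>k::nat. \<rho> k \<in> prob_D"
    and conv: "\<And>u. u \<in> U \<Longrightarrow> (\<lambda>k. char_fun (\<rho> k) u) \<longlonglongrightarrow> f u"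
    and equi: "\<And>\<eta>. \<eta> > 0 \<Longrightarrow> \<exists>\<delta>>0. \<forall>k. \<forall>u\<in>U. norm u \<le> \<delta> \<longrightarrow> norm (char_fun (\<rho> k) u - 1) \<le> \<eta>"
  shows "\<exists>\<nu>\<in>prob_D. \<forall>u\<in>U. char_fun \<nu> u = f u"
proof -
  have ms [measurable]: "plane_section \<in> borel_measurable (\<rho> k)" for k
    by (rule prob_D_measurable[OF \<rho>]) simp
  define l where "l k = distr (\<rho> k) borel plane_section" for k
  have l_int: "(LINT t|l k. g (plane_curve t)) = (LINT \<xi>|\<rho> k. g \<xi>)"
    if g: "continuous_on UNIV g" for g :: "real \<times> real \<Rightarrow> 'b::{banach, second_countable_topology}" and k
  proof -
    have "continuous_on UNIV (\<lambda>t. g (plane_curve t))"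
      by (rule continuous_on_compose2[OF g continuous_plane_curve]) auto
    then have "(\<lambda>t. g (plane_curve t)) \<in> borel_measurable borel" by (rule borel_measurable_continuous_onI)
    then show ?thesis
      unfolding l_def by (subst integral_distr[OF ms]) (simp_all add: plane_curve_section)
  qed
  have l_dist: "real_distribution (l k)" for k
  proof -
    interpret prob_space "\<rho> k" using \<rho> prob_DD by blast
    have "prob_space (l k)" unfolding l_def by (rule prob_space_distr[OF ms])
    then show ?thesis by (simp add: real_distribution_def real_distribution_axioms_def l_def)
  qed
  have "tight l"
    unfolding tight_def
  proof (intro conjI allI impI l_dist)
    fix e :: real assume e: "e > 0"
    \<comment> \<open>The two coordinates contribute 2 e / 24 and 10 e / 24, so the mass outside the
      interval is at most e / 2.\<close>
    have e24: "e / 24 > 0" using e by simp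
    obtain \<delta> where \<delta>: "\<delta> > 0" "\<And>k u. u \<in> U \<Longrightarrow> norm u \<le> \<delta> \<Longrightarrow> norm (char_fun (\<rho> k) u - 1) \<le> e / 24"
      using equi[OF e24] by blast
    let ?K = "1 / \<delta>" 
    let ?b = "2 * (?K + 2) + 1"
    show "\<exists>a b. a < b \<and> (\<forall>k. 1 - e < measure (l k) {a<..b})"
    proof (rule exI[of _ 0], rule exI[of _ ?b], intro conjI allI)
      show "0 < ?b" using \<delta>(1) by (simp add: add_pos_pos)
      fix k
      interpret prob_space "\<rho> k" using \<rho> prob_DD by blast
      let ?A = "{\<xi>\<in>D. fst \<xi> > ?K}" and ?B = "{\<xi>\<in>D. \<bar>snd \<xi>\<bar> > ?K}"
      let ?S = "plane_section -` {0<..?b} \<inter> space (\<rho> k)"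
      have S: "?S \<in> events" by (rule measurable_sets[OF ms]) simp
      have A: "?A \<in> events" "?B \<in> events"
      proof -
        have "?A = D \<inter> {\<xi>. fst \<xi> > ?K}" "?B = D \<inter> {\<xi>. \<bar>snd \<xi>\<bar> > ?K}" by auto
        then have "?A \<in> sets borel" "?B \<in> sets borel" using sets_large by simp_all
        then show "?A \<in> events" "?B \<in> events" by (auto intro!: sets_on_D[OF prob_DD(2)[OF \<rho>]])
      qed
      have "space (\<rho> k) \<subseteq> ?S \<union> (?A \<union> ?B)"
      proof
        fix \<xi> assume \<xi>: "\<xi> \<in> space (\<rho> k)"
        then have D: "\<xi> \<in> D" using prob_DD(3)[OF \<rho>] by simp
        show "\<xi> \<in> ?S \<union> (?A \<union> ?B)"
        proof (cases "\<xi> \<in> ?A \<union> ?B")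
          case False
          then have "\<bar>fst \<xi>\<bar> \<le> ?K" "\<bar>snd \<xi>\<bar> \<le> ?K" using D by (auto simp: in_D_iff not_less)
          from plane_section_bounds[OF this] \<xi> show ?thesis by (simp only: Un_iff Int_iff vimage_eq greaterThanAtMost_iff simp_thms)
        qed simp
      qed
      then have "prob (space (\<rho> k)) \<le> prob (?S \<union> (?A \<union> ?B))"
        using S A by (intro finite_measure_mono) auto
      also have "\<dots> \<le> prob ?S + (prob ?A + prob ?B)"
        using S A by (intro order_trans[OF measure_Un_le] add_left_mono measure_Un_le) auto
      finally have "1 \<le> prob ?S + (prob ?A + prob ?B)" using prob_space by simp
      moreover have "prob ?A \<le> 2 * (e / 24)"
        using \<delta>(1) by (intro order_trans[OF prob_fst_large[OF \<rho> \<delta>(1)]] mult_left_mono \<delta>(2)) (auto simp: in_U_iff norm_Pair)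
      moreover have "prob ?B \<le> 10 * (e / 24)"
        using \<delta>(1) by (intro prob_snd_large[OF \<rho> \<delta>(1)] \<delta>(2)) (auto simp: in_U_iff norm_Pair norm_mult)
      moreover have "measure (l k) {0<..?b} = prob ?S"
        unfolding l_def by (rule measure_distr[OF ms]) simp
      ultimately show "1 - e < measure (l k) {0<..?b}" using e by linarith
    qed
  qed
  from tight_imp_convergent_subsubsequence[OF this, of "\<lambda>n. n"] obtain r M
    where r: "strict_mono (r :: nat \<Rightarrow> nat)" and M: "real_distribution M" and w: "weak_conv_m (l \<circ> (\<lambda>n. n) \<circ> r) M"
    by (auto simp: strict_mono_def)
  interpret M: real_distribution M by fact
  have wconv: "(\<lambda>n. LINT \<xi>|\<rho> (r n). g \<xi>) \<longlonglongrightarrow> (LINT t|M. g (plane_curve t))"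
    if g: "continuous_on UNIV g" and B: "\<And>\<xi>. norm (g \<xi>) \<le> B" for g :: "real \<times> real \<Rightarrow> complex" and B
  proof -
    have "continuous_on UNIV (\<lambda>t. g (plane_curve t))"
      by (rule continuous_on_compose2[OF g continuous_plane_curve]) auto
    then have c: "isCont (\<lambda>t. g (plane_curve t)) x" for x
      by (simp add: continuous_on_eq_continuous_at)
    have "(\<lambda>n. LINT t|(l \<circ> (\<lambda>n. n) \<circ> r) n. g (plane_curve t)) \<longlonglongrightarrow> (LINT t|M. g (plane_curve t))"
      by (rule weak_conv_imp_integral_bdd_continuous_conv[OF _ M w c B]) (simp add: l_dist)
    then show ?thesis by (simp add: l_int[OF g])
  qed
  have mc [measurable]: "plane_curve \<in> borel_measurable borel"
    by (rule borel_measurable_continuous_onI[OF continuous_plane_curve])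
  then have mcM [measurable]: "plane_curve \<in> borel_measurable M" by simp
  have supp: "AE t in M. plane_curve t \<in> D"
  proof -
    \<comment> \<open>A bounded continuous function that is 0 exactly on \<open>D\<close>: its
      integral is 0 along the sequence, hence in the limit, so the limit law gives no mass to the
      complement of \<open>D\<close>.\<close>
    define g where "g \<xi> = min 1 (max 0 (- fst \<xi>))" for \<xi> :: "real \<times> real"
    have gc: "continuous_on UNIV g" unfolding g_def by (intro continuous_intros)
    have gb: "0 \<le> g \<xi>" "g \<xi> \<le> 1" for \<xi> by (auto simp: g_def)
    have gm [measurable]: "g \<in> borel_measurable borel" by (rule borel_measurable_continuous_onI[OF gc])
    have "(\<lambda>n. LINT \<xi>|\<rho> (r n). complex_of_real (g \<xi>)) \<longlonglongrightarrow> (LINT t|M. complex_of_real (g (plane_curve t)))"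
      using gb by (intro wconv[of "\<lambda>\<xi>. complex_of_real (g \<xi>)" 1] continuous_on_of_real gc) simp
    moreover have "(LINT \<xi>|\<rho> k. complex_of_real (g \<xi>)) = 0" for k
    proof -
      have "(LINT \<xi>|\<rho> k. complex_of_real (g \<xi>)) = (LINT \<xi>|\<rho> k. 0)"
        using prob_DD(3)[OF \<rho>] by (intro Bochner_Integration.integral_cong refl) (simp add: g_def in_D_iff)
      then show ?thesis by simp
    qed
    ultimately have "complex_of_real (LINT t|M. g (plane_curve t)) = 0"
      by (simp add: LIMSEQ_const_iff)
    then have z: "(LINT t|M. g (plane_curve t)) = 0" by simp
    have "integrable M (\<lambda>t. g (plane_curve t))"
      using gb by (intro M.integrable_const_bound[where B = 1]) auto
    then have "AE t in M. g (plane_curve t) = 0"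
      using z gb integral_nonneg_eq_0_iff_AE by blast
    then show ?thesis by eventually_elim (auto simp: g_def in_D_iff min_def max_def split: if_splits)
  qed
  define \<nu> where "\<nu> = restrict_space (distr M borel plane_curve) D"
  have "emeasure (distr M borel plane_curve) D = emeasure M (plane_curve -` D \<inter> space M)"
    by (rule emeasure_distr) simp_all
  also have "\<dots> = emeasure M (space M)"
  proof (rule emeasure_eq_AE)
    show "AE t in M. t \<in> plane_curve -` D \<inter> space M \<longleftrightarrow> t \<in> space M"
      using supp by eventually_elim auto
    show "plane_curve -` D \<inter> space M \<in> M.events" by (rule measurable_sets[OF mcM D_in_sets])
  qed simp
  also have "\<dots> = 1" by (rule M.emeasure_space_1)
  finally have "prob_space \<nu>"
    unfolding \<nu>_def by (intro prob_spaceI) (simp add: space_restrict_space emeasure_restrict_space)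
  then have \<nu>: "\<nu> \<in> prob_D"
    by (simp add: space_prob_algebra \<nu>_def sets_restrict_space)
  have "char_fun \<nu> u = f u" if u: "u \<in> U" for u
  proof -
    \<comment> \<open>Off \<open>D\<close> the exponential may be unbounded; replacing the first
      coordinate by its positive part gives a bounded continuous function on the plane that is
      unchanged on \<open>D\<close>.\<close>
    define g where "g \<xi> = exp (pairing u (max 0 (fst \<xi>), snd \<xi>))" for \<xi>
    have gc: "continuous_on UNIV g" unfolding g_def by (intro continuous_intros)
    have gb: "norm (g \<xi>) \<le> 1" for \<xi>
      unfolding g_def by (intro norm_exp_pairing_le u) (simp add: in_D_iff)
    have gD: "g \<xi> = exp (pairing u \<xi>)" if "\<xi> \<in> D" for \<xi>
      using that by (simp add: g_def in_D_iff max_absorb2)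
    have gm [measurable]: "g \<in> borel_measurable borel" by (rule borel_measurable_continuous_onI[OF gc])
    have "char_fun \<nu> u = (LINT t|M. indicator D (plane_curve t) *\<^sub>R exp (pairing u (plane_curve t)))"
      unfolding char_fun_def \<nu>_def
      by (subst integral_restrict_space, simp, subst integral_distr[OF mcM]) simp_all
    also have "\<dots> = (LINT t|M. g (plane_curve t))"
    proof (rule integral_cong_AE)
      show "AE t in M. indicator D (plane_curve t) *\<^sub>R exp (pairing u (plane_curve t)) = g (plane_curve t)"
        using supp by eventually_elim (simp add: gD)
    qed measurable
    finally have "char_fun \<nu> u = (LINT t|M. g (plane_curve t))" .
    moreover have "(\<lambda>n. LINT \<xi>|\<rho> (r n). g \<xi>) \<longlonglongrightarrow> (LINT t|M. g (plane_curve t))"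
      by (rule wconv[OF gc gb])
    moreover have "(LINT \<xi>|\<rho> k. g \<xi>) = char_fun (\<rho> k) u" for k
      unfolding char_fun_def using prob_DD(3)[OF \<rho>] gD by (intro Bochner_Integration.integral_cong) auto
    ultimately have "(\<lambda>n. char_fun (\<rho> (r n)) u) \<longlonglongrightarrow> char_fun \<nu> u" by simp
    moreover have "(\<lambda>n. char_fun (\<rho> (r n)) u) \<longlonglongrightarrow> f u"
      using LIMSEQ_subseq_LIMSEQ[OF conv[OF u] r] by (simp add: o_def)
    ultimately show ?thesis by (rule LIMSEQ_unique)
  qed
  then show ?thesis using \<nu> by blast
qed

section \<open>Lipschitz continuity of the drift\<close>

inductive trig_poly :: "(real \<Rightarrow> complex) \<Rightarrow> bool" where
  cis: "trig_poly (\<lambda>x. cis (y * x))"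
| add: "trig_poly f \<Longrightarrow> trig_poly g \<Longrightarrow> trig_poly (\<lambda>x. f x + g x)"
| scale: "trig_poly f \<Longrightarrow> trig_poly (\<lambda>x. c * f x)"

lemma trig_poly_const: "trig_poly (\<lambda>_. c)"
  using trig_poly.scale[OF trig_poly.cis[of 0], of c] by simp

lemma trig_poly_mult:
  assumes "trig_poly f" "trig_poly g"
  shows "trig_poly (\<lambda>x. f x * g x)"
  using assms(1)
proof induction
  case (cis y)
  show ?case
    using assms(2)
  proof induction
    case (cis y')
    have "(\<lambda>x. cis (y * x) * cis (y' * x)) = (\<lambda>x. cis ((y + y') * x))"
      by (simp add: cis_mult distrib_right)
    then show ?case using trig_poly.cis by metis
  next
    case (add f g)
    from trig_poly.add[OF add.IH] show ?case by (simp add: distrib_left)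
  next
    case (scale f c)
    from trig_poly.scale[OF scale.IH, of c] show ?case by (simp add: mult_ac)
  qed
next
  case (add f g)
  from trig_poly.add[OF add.IH] show ?case by (simp add: distrib_right)
next
  case (scale f c)
  from trig_poly.scale[OF scale.IH, of c] show ?case by (simp add: mult_ac)
qed

text \<open>A linear functional on the circle is a combination of cis t and cis (-t); sums and
  products stay within trigonometric polynomials.\<close>

lemma trig_poly_of_polynomial:
  assumes "real_polynomial_function g"
  shows "trig_poly (\<lambda>x. complex_of_real (g (cis (y * x))))"
  using assms
proof induction
  case (linear f)
  interpret bounded_linear f by fact
  have f: "complex_of_real (f (cis t)) = (of_real (f 1) / 2 + of_real (f \<i>) / (2 * \<i>)) * cis t
      + (of_real (f 1) / 2 - of_real (f \<i>) / (2 * \<i>)) * cis (- t)" for t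
  proof -
    have "cis t = cos t *\<^sub>R 1 + sin t *\<^sub>R \<i>" by (simp add: complex_eq_iff)
    then have "f (cis t) = cos t * f 1 + sin t * f \<i>" by (simp add: add scaleR)
    then show ?thesis by (simp add: complex_eq_iff field_simps)
  qed
  show ?case
    unfolding f using trig_poly.cis[of "- y"]
    by (intro trig_poly.add trig_poly.scale trig_poly.cis) simp
next
  case (const c)
  show ?case by (rule trig_poly_const)
next
  case (add f g)
  from trig_poly.add[OF add.IH] show ?case by simp
next
  case (mult f g)
  from trig_poly_mult[OF mult.IH] show ?case by simp
qed

lemma borel_measurable_trig_poly: "trig_poly f \<Longrightarrow> f \<in> borel_measurable borel"
proof (induction rule: trig_poly.induct)
  case (cis y)
  show ?case by (intro borel_measurable_continuous_onI continuous_intros)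
qed simp_all

text \<open>The line is wrapped around a circle of radius R, with \<open>k\<close> multiplied by the
  cut-off Re z = cos (x / R), which vanishes at the border of the right half circle and makes
  \<open>K R\<close> continuous. Stone-Weierstrass approximates \<open>K R\<close> up to 1 / R; as R
  grows the cut-off tends to 1 at each fixed \<open>x\<close>. The uniform bound is meant for
  dominated convergence.\<close>

lemma trig_poly_approx:
  fixes k :: "real \<Rightarrow> real"
  assumes k: "continuous_on UNIV k" and B: "\<And>x. \<bar>k x\<bar> \<le> B"
  shows "\<exists>f. (\<forall>n::nat. trig_poly (f n)) \<and> (\<forall>n x. norm (f n x) \<le> B + 1) \<and> (\<forall>x. (\<lambda>n. f n x) \<longlonglongrightarrow> of_real (k x))"
proof -
  define K where "K R z = (if Re z \<le> 0 then 0 else k (R * Im (Ln z)) * Re z)" for R z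
  have Kc: "continuous_on (sphere 0 1) (K R)" for R
    unfolding K_def
  proof (rule continuous_on_cases_le)
    show "continuous_on {z \<in> sphere 0 1. 0 \<le> Re z} (\<lambda>z. k (R * Im (Ln z)) * Re z)"
    proof (intro continuous_on_mult continuous_on_compose2[OF k] continuous_intros)
      fix z assume "z \<in> {z \<in> sphere 0 1. 0 \<le> Re z}"
      then have "0 \<le> Re z" "norm z = 1" by auto
      then show "z \<notin> \<real>\<^sub>\<le>\<^sub>0" by (auto simp: complex_nonpos_Reals_iff cmod_def)
    qed auto
  qed (auto intro!: continuous_intros)
  have Kb: "\<bar>K R z\<bar> \<le> B" if "norm z = 1" for R z
  proof -
    have "0 \<le> B" using B[of 0] by linarith
    moreover have "\<bar>k (R * Im (Ln z)) * Re z\<bar> \<le> B * 1"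
      unfolding abs_mult using B abs_Re_le_cmod[of z] that \<open>0 \<le> B\<close> by (intro mult_mono) auto
    ultimately show ?thesis by (simp add: K_def)
  qed
  have "\<exists>g. real_polynomial_function g \<and> (\<forall>z\<in>sphere 0 1. \<bar>K (real (Suc n)) z - g z\<bar> < 1 / real (Suc n))" for n
    using Stone_Weierstrass_real_polynomial_function[OF compact_sphere Kc, of "1 / real (Suc n)"]
    by (metis of_nat_0_less_iff zero_less_Suc zero_less_divide_1_iff)
  then obtain g where g: "\<And>n. real_polynomial_function (g n)"
    "\<And>n z. z \<in> sphere 0 1 \<Longrightarrow> \<bar>K (real (Suc n)) z - g n z\<bar> < 1 / real (Suc n)" by metis
  define f where "f n x = complex_of_real (g n (cis (1 / real (Suc n) * x)))" for n x
  have le1: "1 / real (Suc n) \<le> 1" for n by simp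
  show ?thesis
  proof (intro exI[of _ f] conjI allI)
    show "trig_poly (f n)" for n
      unfolding f_def by (rule trig_poly_of_polynomial[OF g(1)])
    fix n x
    let ?z = "cis (1 / real (Suc n) * x)"
    have "\<bar>K (real (Suc n)) ?z - g n ?z\<bar> < 1 / real (Suc n)" by (rule g(2)) simp
    then show "norm (f n x) \<le> B + 1"
      using Kb[of ?z "real (Suc n)"] le1[of n] unfolding f_def norm_of_real norm_cis by linarith
  next
    fix x :: real
    have inv0: "(\<lambda>n. 1 / real (Suc n)) \<longlonglongrightarrow> 0" by (rule LIMSEQ_Suc[OF lim_1_over_n])
    then have small: "(\<lambda>n. 1 / real (Suc n) * x) \<longlonglongrightarrow> 0" by (rule tendsto_mult_left_zero)
    have "\<forall>\<^sub>F n in sequentially. K (real (Suc n)) (cis (1 / real (Suc n) * x)) = k x * cos (1 / real (Suc n) * x)"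
    proof -
      have "\<forall>\<^sub>F n in sequentially. \<bar>1 / real (Suc n) * x\<bar> < 1"
        using order_tendstoD(2)[OF tendsto_rabs[OF small], of 1] by simp
      then show ?thesis
      proof eventually_elim
        case (elim n)
        let ?t = "1 / real (Suc n) * x"
        have t: "- pi < ?t" "?t < pi" "- (pi / 2) < ?t" "?t < pi / 2"
          using elim pi_gt3 by (simp_all only: abs_less_iff) linarith+
        have "Ln (cis ?t) = \<i> * of_real ?t"
          unfolding cis_conv_exp using t by (intro Ln_exp) auto
        moreover have "cos ?t > 0" using t by (intro cos_gt_zero_pi) auto
        ultimately show ?case by (simp add: K_def)
      qed
    qed
    moreover have "(\<lambda>n. k x * cos (1 / real (Suc n) * x)) \<longlonglongrightarrow> k x * cos 0"
      by (intro tendsto_intros small)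
    ultimately have lim: "(\<lambda>n. K (real (Suc n)) (cis (1 / real (Suc n) * x))) \<longlonglongrightarrow> k x"
      by (simp add: tendsto_cong)
    have "(\<lambda>n. K (real (Suc n)) (cis (1 / real (Suc n) * x)) - g n (cis (1 / real (Suc n) * x))) \<longlonglongrightarrow> 0"
    proof (rule tendsto_rabs_zero_cancel, rule tendsto_sandwich[OF _ _ tendsto_const inv0])
      show "\<forall>\<^sub>F n in sequentially. \<bar>K (real (Suc n)) (cis (1 / real (Suc n) * x)) - g n (cis (1 / real (Suc n) * x))\<bar> \<le> 1 / real (Suc n)"
        using g(2) by (intro always_eventually allI less_imp_le) simp
    qed simp
    from tendsto_diff[OF lim this] have "(\<lambda>n. g n (cis (1 / real (Suc n) * x))) \<longlonglongrightarrow> k x" by simp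
    then show "(\<lambda>n. f n x) \<longlonglongrightarrow> of_real (k x)" unfolding f_def by (rule tendsto_of_real)
  qed
qed

text \<open>The correction between \<open>trunc\<close> and the sine, divided by the averaged 1 -
  cos. The numerator is of third order at 0 and \<open>wt\<close> of second order, so 0 is the
  continuous value there.\<close>

definition trunc_ratio :: "real \<Rightarrow> real" where
  "trunc_ratio x = (if x = 0 then 0 else (trunc x - sin x) / wt x)"

lemma wt_pos: "x \<noteq> 0 \<Longrightarrow> wt x > 0"
  using wt_lower[of x] by (smt (verit) divide_pos_pos min_def zero_less_power2)

lemma trunc_ratio_wt: "trunc_ratio x * wt x = trunc x - sin x"
  using wt_pos[of x] by (auto simp: trunc_ratio_def trunc_def)

lemma trunc_ratio_small:
  assumes "\<bar>x\<bar> \<le> 1"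
  shows "\<bar>trunc_ratio x\<bar> \<le> 2 * \<bar>x\<bar>"
proof (cases "x = 0")
  case False
  have w: "x\<^sup>2 / 10 \<le> wt x" using wt_lower[of x] assms abs_square_le_1[of x] by simp
  have "\<bar>trunc x - sin x\<bar> \<le> \<bar>x\<bar> ^ 3 / 6"
    using iexp_bounds(2)[of x] assms by (simp add: trunc_id abs_minus_commute)
  also have "\<dots> = \<bar>x\<bar> * x\<^sup>2 / 6" by (simp add: power3_eq_cube power2_eq_square)
  also have "\<dots> \<le> 2 * \<bar>x\<bar> * (x\<^sup>2 / 10)" by (simp add: divide_simps)
  also have "\<dots> \<le> 2 * \<bar>x\<bar> * wt x" using w by (intro mult_left_mono) auto
  finally show ?thesis using False wt_pos[OF False] by (simp add: trunc_ratio_def abs_divide divide_le_eq)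
qed (simp add: trunc_ratio_def)

lemma trunc_ratio_bound: "\<bar>trunc_ratio x\<bar> \<le> 20"
proof (cases "\<bar>x\<bar> \<le> 1")
  case True
  then show ?thesis using trunc_ratio_small[OF True] by simp
next
  case False
  then have w: "1 / 10 \<le> wt x" using wt_lower[of x] abs_square_le_1[of x] by simp
  have "\<bar>trunc x - sin x\<bar> \<le> 2"
    using abs_trunc_le(1)[of x] abs_sin_le_one[of x] by linarith
  also have "\<dots> \<le> 20 * wt x" using w by simp
  finally show ?thesis using False wt_pos[of x] by (auto simp: trunc_ratio_def abs_divide divide_le_eq)
qed

lemma continuous_trunc_ratio: "continuous_on UNIV trunc_ratio"
proof (rule continuous_at_imp_continuous_on, rule ballI)
  fix x :: real
  show "isCont trunc_ratio x"
  proof (cases "x = 0")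
    case True
    have "(trunc_ratio \<longlongrightarrow> 0) (at 0)"
    proof (rule Lim_null_comparison)
      show "\<forall>\<^sub>F x in at 0. norm (trunc_ratio x) \<le> 2 * \<bar>x\<bar>"
        unfolding eventually_at by (intro exI[of _ 1]) (auto intro!: trunc_ratio_small)
      show "((\<lambda>x::real. 2 * \<bar>x\<bar>) \<longlongrightarrow> 0) (at 0)"
        by (rule tendsto_eq_intros refl | simp)+
    qed
    then show ?thesis using True by (simp add: isCont_def trunc_ratio_def)
  next
    case False
    have "isCont trunc x"
      using continuous_on_trunc[OF continuous_on_id, of UNIV] by (simp add: continuous_on_eq_continuous_at)
    then have "isCont (\<lambda>y. (trunc y - sin y) / wt y) x"
      using isCont_wt[OF False] wt_pos[OF False] by (intro continuous_intros) auto
    moreover have "\<forall>\<^sub>F y in nhds x. trunc_ratio y = (trunc y - sin y) / wt y"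
      using t1_space_nhds[OF False] by eventually_elim (simp add: trunc_ratio_def)
    moreover note isCont_cong[OF this]
    ultimately show ?thesis by simp
  qed
qed

text \<open>The second difference in frequency space multiplies a measure by \<open>1 - cos (s * x)\<close> and kills the
  linear terms of a characteristic exponent.\<close>

definition sec_diff :: "real \<Rightarrow> (real \<Rightarrow> complex) \<Rightarrow> real \<Rightarrow> complex" where
  "sec_diff s g y = g y - (g (y + s) + g (y - s)) / 2"

lemma sec_diff_integral:
  assumes "\<And>y. integrable M (g y)"
  shows "(LINT \<xi>|M. sec_diff s (\<lambda>y. g y \<xi>) y) = sec_diff s (\<lambda>y. LINT \<xi>|M. g y \<xi>) y"
  unfolding sec_diff_def using assms by (simp add: Bochner_Integration.integral_diff Bochner_Integration.integral_add)

lemma sec_diff_sum: "sec_diff s (\<lambda>y. \<Sum>j\<in>A. g j y) y = (\<Sum>j\<in>A. sec_diff s (g j) y)"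
  by (simp add: sec_diff_def sum_subtractf sum.distrib flip: sum_divide_distrib)

lemma sec_diff_diff: "sec_diff s (\<lambda>y. g y - h y) y = sec_diff s g y - sec_diff s h y"
  by (simp add: sec_diff_def field_simps)

lemma sec_diff_minus_const: "sec_diff s (\<lambda>y. g y - c) y = sec_diff s g y"
  by (simp add: sec_diff_def field_simps)

lemma sec_diff_cis: "cis (y * x) * of_real (1 - cos (s * x)) = sec_diff s (\<lambda>y. cis (y * x)) y"
proof -
  have "complex_of_real (cos (s * x)) = (cis (s * x) + cis (- (s * x))) / 2"
    by (simp add: complex_eq_iff)
  then show ?thesis by (simp add: sec_diff_def cis_mult algebra_simps add_divide_distrib)
qed

lemma sec_diff_exp_pairing:
  "cis (y * snd \<xi>) * of_real (1 - cos (s * snd \<xi>)) = sec_diff s (\<lambda>y. exp (pairing (0, \<i> * of_real y) \<xi>)) y"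
  unfolding sec_diff_cis by (simp add: cis_conv_exp pairing_def mult.assoc)

lemma sec_diff_char_fun:
  assumes \<rho>: "\<rho> \<in> prob_D"
  shows "(LINT \<xi>|\<rho>. cis (y * snd \<xi>) * of_real (1 - cos (s * snd \<xi>))) = sec_diff s (\<lambda>y. char_fun \<rho> (0, \<i> * of_real y)) y"
proof -
  have "integrable \<rho> (\<lambda>\<xi>. exp (pairing (0, \<i> * of_real y) \<xi>))" for y
    by (rule integrable_exp_pairing[OF \<rho>]) (simp add: in_U_iff)
  then show ?thesis
    unfolding sec_diff_exp_pairing char_fun_def by (rule sec_diff_integral)
qed

section \<open>Smoothed jump measures and their Fourier transforms\<close>

context levy_khintchine
begin

text \<open>The integral of \<open>f\<close> against a finite measure on the line: the second
  marginal of \<open>m\<close> with density 1 - cos (s y), plus an atom \<open>a * s^2\<close> at 0,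
  which is the second difference of the Gaussian term.\<close>

definition smoothed :: "real \<Rightarrow> (real \<Rightarrow> complex) \<Rightarrow> complex" where
  "smoothed s f = of_real (a * s\<^sup>2) * f 0 + (LINT \<xi>|m. f (snd \<xi>) * of_real (1 - cos (s * snd \<xi>)))"

lemma integrable_smoothed:
  assumes [measurable]: "f \<in> borel_measurable borel" and B: "\<And>x. norm (f x) \<le> B"
  shows "integrable m (\<lambda>\<xi>. f (snd \<xi>) * complex_of_real (1 - cos (s * snd \<xi>)))"
proof (rule integrable_m_bound)
  show "integrable m (\<lambda>\<xi>. B * (1 * (1 - cos (s * snd \<xi>))))"
    by (intro integrable_mult_right integrable_cos[where B = 1]) auto
  show "norm (f (snd \<xi>) * complex_of_real (1 - cos (s * snd \<xi>))) \<le> B * (1 * (1 - cos (s * snd \<xi>)))" for \<xi> :: "real \<times> real"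
    using B[of "snd \<xi>"] cos_le_one[of "s * snd \<xi>"]
    unfolding norm_mult norm_of_real by (simp add: mult_right_mono)
qed measurable

lemma sec_diff_integrand:
  "sec_diff s (\<lambda>y. integrand (0, \<i> * of_real y) \<xi>) y = cis (y * snd \<xi>) * of_real (1 - cos (s * snd \<xi>))"
  unfolding sec_diff_exp_pairing by (simp add: sec_diff_def integrand_def algebra_simps add_divide_distrib diff_divide_distrib)

lemma smoothed_cis: "smoothed s (\<lambda>x. cis (y * x)) = sec_diff s (\<lambda>y. expo (0, \<i> * of_real y)) y"
proof -
  have I: "integrable m (integrand (0, \<i> * of_real y))" for y
    by (rule integrable_integrand) (simp add: in_U_iff)
  have "(LINT \<xi>|m. cis (y * snd \<xi>) * of_real (1 - cos (s * snd \<xi>))) = sec_diff s (\<lambda>y. LINT \<xi>|m. integrand (0, \<i> * of_real y) \<xi>) y"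
    unfolding sec_diff_integrand[symmetric] using I by (rule sec_diff_integral)
  then show ?thesis
    by (simp add: smoothed_def sec_diff_def expo_def power2_eq_square field_simps)
qed

lemma smoothed_tendsto:
  assumes f: "\<And>n. f n \<in> borel_measurable borel" "\<And>n x. norm (f n x) \<le> B" "\<And>x. (\<lambda>n. f n x) \<longlonglongrightarrow> g x"
  shows "(\<lambda>n. smoothed s (f n)) \<longlonglongrightarrow> smoothed s g"
proof -
  have g [measurable]: "g \<in> borel_measurable borel"
    by (rule borel_measurable_LIMSEQ_metric[OF f(1,3)])
  have "(\<lambda>n. LINT \<xi>|m. f n (snd \<xi>) * complex_of_real (1 - cos (s * snd \<xi>))) \<longlonglongrightarrow> (LINT \<xi>|m. g (snd \<xi>) * complex_of_real (1 - cos (s * snd \<xi>)))"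
  proof (rule integral_dominated_convergence)
    show "integrable m (\<lambda>\<xi>. B * (1 * (1 - cos (s * snd \<xi>))))"
      by (intro integrable_mult_right integrable_cos[where B = 1]) auto
    show "AE \<xi> in m. norm (f n (snd \<xi>) * complex_of_real (1 - cos (s * snd \<xi>))) \<le> B * (1 * (1 - cos (s * snd \<xi>)))" for n
      using f(2)[of n] unfolding norm_mult norm_of_real by (intro AE_I2) (simp add: mult_right_mono)
    show "AE \<xi> in m. (\<lambda>n. f n (snd \<xi>) * complex_of_real (1 - cos (s * snd \<xi>))) \<longlonglongrightarrow> g (snd \<xi>) * complex_of_real (1 - cos (s * snd \<xi>))"
      by (intro AE_I2 tendsto_intros f(3))
    show "(\<lambda>\<xi>. g (snd \<xi>) * complex_of_real (1 - cos (s * snd \<xi>))) \<in> borel_measurable m"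
      by (rule measurable_m) measurable
    have [measurable]: "f n \<in> borel_measurable borel" for n by (rule f(1))
    show "(\<lambda>\<xi>. f n (snd \<xi>) * complex_of_real (1 - cos (s * snd \<xi>))) \<in> borel_measurable m" for n
      by (rule measurable_m) measurable
  qed
  then show ?thesis unfolding smoothed_def by (intro tendsto_intros f(3))
qed

lemma smoothed_add:
  assumes "f \<in> borel_measurable borel" "\<And>x. norm (f x) \<le> A" "g \<in> borel_measurable borel" "\<And>x. norm (g x) \<le> B"
  shows "smoothed s (\<lambda>x. f x + g x) = smoothed s f + smoothed s g"
proof -
  have "(LINT \<xi>|m. (f (snd \<xi>) + g (snd \<xi>)) * complex_of_real (1 - cos (s * snd \<xi>)))
    = (LINT \<xi>|m. f (snd \<xi>) * complex_of_real (1 - cos (s * snd \<xi>))) + (LINT \<xi>|m. g (snd \<xi>) * complex_of_real (1 - cos (s * snd \<xi>)))"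
    unfolding distrib_right
    by (rule Bochner_Integration.integral_add[OF integrable_smoothed[OF assms(1,2)] integrable_smoothed[OF assms(3,4)]])
  then show ?thesis unfolding smoothed_def by (simp only: distrib_left add_ac)
qed

lemma smoothed_scale: "smoothed s (\<lambda>x. c * f x) = c * smoothed s f"
  unfolding smoothed_def mult.assoc integral_mult_right_zero distrib_left by (simp only: mult_ac)

lemma smoothed_real:
  fixes k :: "real \<Rightarrow> real"
  assumes "k 0 = 0"
  shows "smoothed s (\<lambda>x. of_real (k x)) = of_real (LINT \<xi>|m. k (snd \<xi>) * (1 - cos (s * snd \<xi>)))"
  using assms by (simp only: smoothed_def of_real_0 mult_zero_right add_0 flip: of_real_mult integral_complex_of_real)

text \<open>At frequency 1 the compensated integral is that of sin - \<open>trunc\<close>. Since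
  \<open>wt\<close> averages 1 - cos (s y) over s in [0, 1], the correction is an average of
  smoothed integrals of the bounded function \<open>trunc_ratio\<close>.\<close>

lemma b2_eq: "b2 = Im (expo (0, \<i>)) + (LINT \<xi>|m. trunc_ratio (snd \<xi>) * wt (snd \<xi>))"
proof -
  have "(LINT \<xi>|m. sin (1 * snd \<xi>) - 1 * trunc (snd \<xi>)) = (LINT \<xi>|m. - (trunc_ratio (snd \<xi>) * wt (snd \<xi>)))"
    by (simp add: trunc_ratio_wt)
  also have "\<dots> = - (LINT \<xi>|m. trunc_ratio (snd \<xi>) * wt (snd \<xi>))"
    by (rule Bochner_Integration.integral_minus)
  finally show ?thesis using Im_expo_snd[of 1] by simp
qed

end

lemma norm_exp_minus_one_minus_le:
  fixes w :: complex
  assumes "norm w \<le> 1"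
  shows "norm (exp w - 1 - w) \<le> 3 * (norm w)\<^sup>2"
proof -
  have "norm (exp w - 1 - w) \<le> exp \<bar>Re w\<bar> * (norm w)\<^sup>2"
    using Taylor_exp[of w 1] by (simp add: power2_eq_square algebra_simps)
  also have "\<dots> \<le> 3 * (norm w)\<^sup>2"
  proof (rule mult_right_mono)
    have "exp \<bar>Re w\<bar> \<le> exp 1" using abs_Re_le_cmod[of w] assms by simp
    also have "\<dots> \<le> 3" by (rule exp_le)
    finally show "exp \<bar>Re w\<bar> \<le> 3" .
  qed simp
  finally show ?thesis .
qed

section \<open>Growth of the smoothed measures in time\<close>

context sc_semigroup_short
begin

abbreviation "vaxis y \<equiv> (0, \<i> * complex_of_real y)"

abbreviation "SM t \<equiv> levy_khintchine.smoothed (a t) (m t)"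

lemma phi_increment_bound:
  assumes "S \<ge> 0"
  shows "\<exists>C\<ge>0. \<forall>t r u. 0 \<le> t \<and> t \<le> S \<and> 0 < r \<and> r \<le> T \<and> u \<in> U \<and> norm u \<le> R \<longrightarrow> norm (\<phi> r (\<psi> t u)) \<le> C * r"
proof -
  obtain B where B: "\<forall>t\<in>{0..S}. \<forall>u\<in>U. norm u \<le> R \<longrightarrow> norm (\<psi> t u) \<le> B"
    using psi_bounded[OF assms] by blast
  obtain C where C: "C \<ge> 0" "\<And>r u. 0 < r \<Longrightarrow> r \<le> T \<Longrightarrow> u \<in> U \<Longrightarrow> norm u \<le> B \<Longrightarrow> norm (\<phi> r u) \<le> C * r"
    using phi_locally_bounded[of B] by blast
  have "norm (\<phi> r (\<psi> t u)) \<le> C * r" if "0 \<le> t \<and> t \<le> S \<and> 0 < r \<and> r \<le> T \<and> u \<in> U \<and> norm u \<le> R" for t r u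
    using that B by (intro C(2) psi_in_U) auto
  then show ?thesis using C(1) by blast
qed

text \<open>Increments of \<open>\<phi>\<close> in time are limits of \<open>\<Sum>\<^sub>j (char_fun \<kappa>\<^sub>j - 1)\<close> for probability measures \<open>\<kappa>\<^sub>j\<close>;
  hence the smoothed measures increase in time.\<close>

definition slice :: "real \<Rightarrow> real \<Rightarrow> nat \<Rightarrow> nat \<Rightarrow> (real \<times> real) measure" where
  "slice t r n j = \<gamma> (r / real (Suc n)) \<bind> Q (t + real j * (r / real (Suc n)))"

lemma slice_prob: "t \<ge> 0 \<Longrightarrow> r \<ge> 0 \<Longrightarrow> slice t r n j \<in> prob_D"
  unfolding slice_def by (intro gamma_Q_prob) auto

text \<open>The exponents \<open>w n j\<close> of the slices telescope to the increment exactly.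
  Replacing each by exp (w) - 1 costs at most 3 (C h)^2; with n + 1 slices of length h = r / (n + 1)
  the total error is 3 C^2 r h, which tends to 0.\<close>

lemma slice_sum_tendsto:
  assumes t: "t \<ge> 0" and r: "0 < r" "r \<le> T" and u: "u \<in> U"
  shows "(\<lambda>n. \<Sum>j<Suc n. (char_fun (slice t r n j) u - 1)) \<longlonglongrightarrow> \<phi> (t + r) u - \<phi> t u"
proof -
  obtain C where C: "C \<ge> 0" "\<And>s \<rho>. 0 \<le> s \<Longrightarrow> s \<le> t + r \<Longrightarrow> 0 < \<rho> \<Longrightarrow> \<rho> \<le> T \<Longrightarrow> norm (\<phi> \<rho> (\<psi> s u)) \<le> C * \<rho>"
  proof -
    have "0 \<le> t + r" using t r by simp
    from phi_increment_bound[OF this, of "norm u"] show ?thesis using that u by blast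
  qed
  define h where "h n = r / real (Suc n)" for n
  define w where "w n j = \<phi> (h n) (\<psi> (t + real j * h n) u)" for n j
  have h: "0 < h n" "h n \<le> T" for n
  proof -
    show "0 < h n" using r by (simp add: h_def)
    have "h n \<le> r / 1" unfolding h_def using r by (intro divide_left_mono) auto
    then show "h n \<le> T" using r by simp
  qed
  have hn: "real (Suc n) * h n = r" for n by (simp add: h_def)
  have sum_w: "(\<Sum>j<Suc n. w n j) = \<phi> (t + r) u - \<phi> t u" for n
  proof -
    have "w n j = \<phi> (t + real (Suc j) * h n) u - \<phi> (t + real j * h n) u" for j
      using phi_add[of "h n" "t + real j * h n" u] t u less_imp_le[OF h(1)[of n]] by (simp add: w_def algebra_simps)
    then have "(\<Sum>j<Suc n. w n j) = \<phi> (t + real (Suc n) * h n) u - \<phi> (t + real 0 * h n) u"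
      by (simp only: sum_lessThan_telescope[of "\<lambda>j. \<phi> (t + real j * h n) u"])
    then show ?thesis unfolding hn by simp
  qed
  have wb: "norm (w n j) \<le> C * h n" if "j < Suc n" for n j
  proof -
    have "real j * h n \<le> real (Suc n) * h n"
      using that h(1)[of n] by (intro mult_right_mono) auto
    then show ?thesis unfolding w_def using t h[of n] hn[of n] by (intro C(2)) auto
  qed
  have cf: "char_fun (slice t r n j) u = exp (w n j)" for n j
    unfolding slice_def w_def h_def using t r u by (intro char_fun_gamma_Q) auto
  have h0: "h \<longlonglongrightarrow> 0" unfolding h_def by (rule LIMSEQ_Suc[OF lim_const_over_n])
  have "(\<lambda>n. (\<Sum>j<Suc n. exp (w n j) - 1) - (\<phi> (t + r) u - \<phi> t u)) \<longlonglongrightarrow> 0"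
  proof (rule Lim_null_comparison)
    have "(\<lambda>n. C * h n) \<longlonglongrightarrow> C * 0" by (intro tendsto_intros h0)
    then have "\<forall>\<^sub>F n in sequentially. C * h n < 1"
      using order_tendstoD(2)[of _ "C * 0" sequentially 1] by simp
    then show "\<forall>\<^sub>F n in sequentially. norm ((\<Sum>j<Suc n. exp (w n j) - 1) - (\<phi> (t + r) u - \<phi> t u)) \<le> 3 * C\<^sup>2 * r * h n"
    proof eventually_elim
      case (elim n)
      have "(\<Sum>j<Suc n. exp (w n j) - 1) - (\<phi> (t + r) u - \<phi> t u) = (\<Sum>j<Suc n. exp (w n j) - 1 - w n j)"
        unfolding sum_w[symmetric, of n] by (rule sum_subtractf[symmetric])
      also have "norm \<dots> \<le> (\<Sum>j<Suc n. 3 * (C * h n)\<^sup>2)"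
      proof (rule sum_norm_le)
        fix j assume "j \<in> {..<Suc n}"
        then have b: "norm (w n j) \<le> C * h n" by (intro wb) simp
        then have "norm (exp (w n j) - 1 - w n j) \<le> 3 * (norm (w n j))\<^sup>2"
          using elim by (intro norm_exp_minus_one_minus_le) simp
        also have "\<dots> \<le> 3 * (C * h n)\<^sup>2" using b by (intro mult_left_mono power_mono) auto
        finally show "norm (exp (w n j) - 1 - w n j) \<le> 3 * (C * h n)\<^sup>2" .
      qed
      also have "\<dots> = 3 * C\<^sup>2 * (real (Suc n) * h n) * h n" by (simp add: power2_eq_square)
      also have "\<dots> = 3 * C\<^sup>2 * r * h n" unfolding hn ..
      finally show ?case .
    qed
    have "(\<lambda>n. 3 * C\<^sup>2 * r * h n) \<longlonglongrightarrow> 3 * C\<^sup>2 * r * 0" by (intro tendsto_intros h0)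
    then show "(\<lambda>n. 3 * C\<^sup>2 * r * h n) \<longlonglongrightarrow> 0" by simp
  qed
  then show ?thesis unfolding cf by (rule LIM_zero_cancel)
qed

definition slice_smoothed :: "real \<Rightarrow> real \<Rightarrow> real \<Rightarrow> (real \<Rightarrow> complex) \<Rightarrow> nat \<Rightarrow> complex" where
  "slice_smoothed s t r f n = (\<Sum>j<Suc n. LINT \<xi>|slice t r n j. f (snd \<xi>) * of_real (1 - cos (s * snd \<xi>)))"

lemma trig_poly_bounded: "trig_poly f \<Longrightarrow> \<exists>B. \<forall>x. norm (f x) \<le> B"
proof (induction rule: trig_poly.induct)
  case (cis y)
  show ?case by (intro exI[of _ 1]) simp
next
  case (add f g)
  then obtain A B where "\<And>x. norm (f x) \<le> A" "\<And>x. norm (g x) \<le> B" by blast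
  then show ?case by (intro exI[of _ "A + B"] allI norm_triangle_le add_mono)
next
  case (scale f c)
  then obtain A where "\<And>x. norm (f x) \<le> A" by blast
  then show ?case by (intro exI[of _ "norm c * A"]) (simp add: norm_mult mult_left_mono)
qed

lemma integrable_slice:
  assumes \<rho>: "\<rho> \<in> prob_D" and f [measurable]: "f \<in> borel_measurable borel" and B: "\<And>x. norm (f x) \<le> B"
  shows "integrable \<rho> (\<lambda>\<xi>. f (snd \<xi>) * complex_of_real (1 - cos (s * snd \<xi>)))"
proof (rule integrable_bounded_on_D[OF \<rho>])
  fix \<xi> :: "real \<times> real"
  have "norm (f (snd \<xi>) * complex_of_real (1 - cos (s * snd \<xi>))) \<le> B * 2"
    unfolding norm_mult norm_of_real using B[of "snd \<xi>"] cos_ge_minus_one[of "s * snd \<xi>"] order_trans[OF norm_ge_zero B]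
    by (intro mult_mono) auto
  then show "norm (f (snd \<xi>) * complex_of_real (1 - cos (s * snd \<xi>))) \<le> B * 2" .
qed measurable

text \<open>For a single frequency this is the second difference of
  \<open>slice_sum_tendsto\<close>, in which the constants -1 disappear; linearity extends it to
  sums and multiples.\<close>

lemma slice_smoothed_tendsto:
  assumes t: "t \<ge> 0" and r: "0 < r" "r \<le> T" and f: "trig_poly f"
  shows "slice_smoothed s t r f \<longlonglongrightarrow> SM (t + r) s f - SM t s f"
  using f
proof induction
  case (cis y)
  have tr: "0 \<le> t + r" "0 \<le> r" using t r by simp_all
  let ?G = "\<lambda>n y. \<Sum>j<Suc n. (char_fun (slice t r n j) (vaxis y) - 1)"
  have eq: "slice_smoothed s t r (\<lambda>x. cis (y * x)) n = sec_diff s (?G n) y" for n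
    unfolding slice_smoothed_def sec_diff_char_fun[OF slice_prob[OF t tr(2)]] sec_diff_sum sec_diff_minus_const ..
  have lim: "(\<lambda>n. ?G n y) \<longlonglongrightarrow> \<phi> (t + r) (vaxis y) - \<phi> t (vaxis y)" for y
    by (rule slice_sum_tendsto[OF t r snd_axis_in_U])
  have "(\<lambda>n. sec_diff s (?G n) y) \<longlonglongrightarrow> sec_diff s (\<lambda>y. \<phi> (t + r) (vaxis y) - \<phi> t (vaxis y)) y"
    unfolding sec_diff_def by (intro tendsto_diff tendsto_divide tendsto_add tendsto_const lim) simp
  moreover have "sec_diff s (\<lambda>y. \<phi> (t + r) (vaxis y) - \<phi> t (vaxis y)) y = SM (t + r) s (\<lambda>x. cis (y * x)) - SM t s (\<lambda>x. cis (y * x))"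
    unfolding levy_khintchine.smoothed_cis[OF LK[OF tr(1)], of _ _ "b2 (t + r)"] levy_khintchine.smoothed_cis[OF LK[OF t], of _ _ "b2 t"]
    by (rule sec_diff_diff)
  ultimately show ?case unfolding eq by simp
next
  case (add f g)
  have tr: "0 \<le> t + r" "0 \<le> r" using t r by simp_all
  obtain A where A: "\<And>x. norm (f x) \<le> A" using trig_poly_bounded[OF add.hyps(1)] by blast
  obtain B where B: "\<And>x. norm (g x) \<le> B" using trig_poly_bounded[OF add.hyps(2)] by blast
  note AB = A B
  note fm = borel_measurable_trig_poly[OF add.hyps(1)] borel_measurable_trig_poly[OF add.hyps(2)]
  have S: "SM t' s (\<lambda>x. f x + g x) = SM t' s f + SM t' s g" if "t' \<ge> 0" for t'
    by (rule levy_khintchine.smoothed_add[OF LK[OF that] fm(1) AB(1) fm(2) AB(2)])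
  have L: "slice_smoothed s t r (\<lambda>x. f x + g x) n = slice_smoothed s t r f n + slice_smoothed s t r g n" for n
    unfolding slice_smoothed_def sum.distrib[symmetric] distrib_right
    by (intro sum.cong refl Bochner_Integration.integral_add integrable_slice[OF slice_prob[OF t tr(2)] fm(1) AB(1)]
        integrable_slice[OF slice_prob[OF t tr(2)] fm(2) AB(2)])
  show ?case unfolding S[OF tr(1)] S[OF t] L add_diff_add by (rule tendsto_add[OF add.IH])
next
  case (scale f c)
  have tr: "0 \<le> t + r" using t r by simp
  have S: "SM t' s (\<lambda>x. c * f x) = c * SM t' s f" if "t' \<ge> 0" for t'
    by (rule levy_khintchine.smoothed_scale[OF LK[OF that]])
  have L: "slice_smoothed s t r (\<lambda>x. c * f x) n = c * slice_smoothed s t r f n" for n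
    unfolding slice_smoothed_def mult.assoc integral_mult_right_zero sum_distrib_left ..
  show ?case unfolding S[OF tr] S[OF t] L right_diff_distrib[symmetric]
    by (rule tendsto_mult[OF tendsto_const scale.IH])
qed

text \<open>Before the limit both sides are integrals against positive measures, for which |f| \<le>
  B gives the inequality at once. The limit \<open>n\<close> to infinity preserves it, although only
  trigonometric polynomials can be tested.\<close>

lemma smoothed_increment_trig:
  assumes t: "t \<ge> 0" and r: "0 < r" "r \<le> T" and f: "trig_poly f" and B: "\<And>x. norm (f x) \<le> B"
  shows "norm (SM (t + r) s f - SM t s f) \<le> B * norm (SM (t + r) s (\<lambda>_. 1) - SM t s (\<lambda>_. 1))"
proof -
  have r0: "0 \<le> r" using r by simp
  have one: "trig_poly (\<lambda>_. 1)" by (rule trig_poly_const)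
  have "norm (slice_smoothed s t r f n) \<le> B * norm (slice_smoothed s t r (\<lambda>_. 1) n)" for n
  proof -
    let ?I = "\<lambda>j. LINT \<xi>|slice t r n j. 1 - cos (s * snd \<xi>)"
    have I: "(LINT \<xi>|slice t r n j. 1 * complex_of_real (1 - cos (s * snd \<xi>))) = of_real (?I j)" for j
      by (simp only: mult_1 integral_complex_of_real)
    have nn: "0 \<le> ?I j" for j by (rule integral_nonneg_AE) simp
    have "norm (slice_smoothed s t r f n) \<le> (\<Sum>j<Suc n. B * ?I j)"
      unfolding slice_smoothed_def
    proof (rule sum_norm_le)
      fix j
      have P: "slice t r n j \<in> prob_D" by (rule slice_prob[OF t r0])
      have i1: "integrable (slice t r n j) (\<lambda>\<xi>. 1 - cos (s * snd \<xi>))"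
        using integrable_Re[OF integrable_slice[OF P, of "\<lambda>_. 1" 1 s]] by simp
      have "norm (LINT \<xi>|slice t r n j. f (snd \<xi>) * complex_of_real (1 - cos (s * snd \<xi>))) \<le> (LINT \<xi>|slice t r n j. B * (1 - cos (s * snd \<xi>)))"
      proof (rule norm_integral_le_on_D[OF P])
        show "integrable (slice t r n j) (\<lambda>\<xi>. B * (1 - cos (s * snd \<xi>)))" using i1 by (rule integrable_mult_right)
        show "norm (f (snd \<xi>) * complex_of_real (1 - cos (s * snd \<xi>))) \<le> B * (1 - cos (s * snd \<xi>))" for \<xi> :: "real \<times> real"
          unfolding norm_mult norm_of_real using B[of "snd \<xi>"] by (simp add: mult_right_mono)
      qed
      then show "norm (LINT \<xi>|slice t r n j. f (snd \<xi>) * complex_of_real (1 - cos (s * snd \<xi>))) \<le> B * ?I j" by simp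
    qed
    also have "\<dots> = B * (\<Sum>j<Suc n. ?I j)" by (rule sum_distrib_left[symmetric])
    also have "(\<Sum>j<Suc n. ?I j) = norm (complex_of_real (\<Sum>j<Suc n. ?I j))"
      using nn by (simp only: norm_of_real abs_of_nonneg sum_nonneg)
    also have "complex_of_real (\<Sum>j<Suc n. ?I j) = slice_smoothed s t r (\<lambda>_. 1) n"
      unfolding slice_smoothed_def I by (rule of_real_sum)
    finally show ?thesis .
  qed
  then show ?thesis
    by (intro LIMSEQ_le[OF tendsto_norm[OF slice_smoothed_tendsto[OF t r f]]
          tendsto_mult[OF tendsto_const tendsto_norm[OF slice_smoothed_tendsto[OF t r one]]]]) blast
qed

text \<open>Uniformly bounded trigonometric polynomials converge pointwise to \<open>k\<close>, and
  the smoothed measures are finite. The constant B + 1 is the bound of the approximants.\<close>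

lemma smoothed_increment:
  fixes k :: "real \<Rightarrow> real"
  assumes t: "t \<ge> 0" and r: "0 < r" "r \<le> T" and k: "continuous_on UNIV k" "\<And>x. \<bar>k x\<bar> \<le> B"
  shows "norm (SM (t + r) s (\<lambda>x. of_real (k x)) - SM t s (\<lambda>x. of_real (k x)))
    \<le> (B + 1) * norm (SM (t + r) s (\<lambda>_. 1) - SM t s (\<lambda>_. 1))"
proof -
  obtain f where f: "\<And>n::nat. trig_poly (f n)" "\<And>n x. norm (f n x) \<le> B + 1" "\<And>x. (\<lambda>n. f n x) \<longlonglongrightarrow> of_real (k x)"
    using trig_poly_approx[OF k] by blast
  have lim: "(\<lambda>n. SM t' s (f n)) \<longlonglongrightarrow> SM t' s (\<lambda>x. of_real (k x))" if "t' \<ge> 0" for t'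
    using f by (intro levy_khintchine.smoothed_tendsto[OF LK[OF that]] borel_measurable_trig_poly)
  have tr: "0 \<le> t + r" using t r by simp
  show ?thesis
    by (rule tendsto_upperbound[OF tendsto_norm[OF tendsto_diff[OF lim[OF tr] lim[OF t]]]])
      (use smoothed_increment_trig[OF t r f(1,2)] in auto)
qed

text \<open>By \<open>b2_eq\<close> the increment consists of an increment of Im \<phi> at (0, i)
  and an average of smoothed increments of \<open>trunc_ratio\<close>. The latter are at most 21 =
  20 + 1 times the increase of total mass, again an increment of \<phi>.\<close>

lemma b2_increment:
  assumes "S \<ge> 0"
  shows "\<exists>C\<ge>0. \<forall>t r. 0 \<le> t \<and> t \<le> S \<and> 0 < r \<and> r \<le> T \<longrightarrow> \<bar>b2 (t + r) - b2 t\<bar> \<le> C * r"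
proof -
  obtain C where C: "C \<ge> 0" "\<And>t r u. 0 \<le> t \<Longrightarrow> t \<le> S \<Longrightarrow> 0 < r \<Longrightarrow> r \<le> T \<Longrightarrow> u \<in> U \<Longrightarrow> norm u \<le> 1 \<Longrightarrow> norm (\<phi> r (\<psi> t u)) \<le> C * r"
    using phi_increment_bound[OF assms, of 1] by blast
  have main: "\<bar>b2 (t + r) - b2 t\<bar> \<le> (C + 21 * C) * r" if t: "0 \<le> t" "t \<le> S" and r: "0 < r" "r \<le> T" for t r
  proof -
    have tr: "0 \<le> t + r" "0 \<le> r" using t r by simp_all
    let ?k = trunc_ratio
    have k0: "?k 0 = 0" by (simp add: trunc_ratio_def)
    have km: "?k \<in> borel_measurable borel" by (rule borel_measurable_continuous_onI[OF continuous_trunc_ratio])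
    have phi: "norm (\<phi> (t + r) u - \<phi> t u) \<le> C * r" if "u \<in> U" "norm u \<le> 1" for u
      using phi_add[OF tr(2) t(1) that(1)] C(2)[OF t r that] by simp
    have one: "norm (SM (t + r) s (\<lambda>_. 1) - SM t s (\<lambda>_. 1)) \<le> C * r" if s: "0 \<le> s" "s \<le> 1" for s
    proof -
      \<comment> \<open>The total mass is the Fourier transform at 0, that is, the second difference
        of \<open>\<phi> t'\<close> at 0 with step \<open>s\<close>.\<close>
      have e: "SM t' s (\<lambda>_. 1) = - (\<phi> t' (vaxis s) + \<phi> t' (vaxis (- s))) / 2" if t': "t' \<ge> 0" for t'
      proof -
        have "SM t' s (\<lambda>_. 1) = SM t' s (\<lambda>x. cis (0 * x))" by simp
        also have "\<dots> = sec_diff s (\<lambda>y. \<phi> t' (vaxis y)) 0"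
          by (rule levy_khintchine.smoothed_cis[OF LK[OF t']])
        also have "\<phi> t' (vaxis 0) = 0" using phi_t_0[OF t'] by (simp add: zero_prod_def)
        then have "sec_diff s (\<lambda>y. \<phi> t' (vaxis y)) 0 = - (\<phi> t' (vaxis s) + \<phi> t' (vaxis (- s))) / 2"
          unfolding sec_diff_def by (simp only: add_0 diff_0 minus_divide_left)
        finally show ?thesis .
      qed
      have eq: "SM (t + r) s (\<lambda>_. 1) - SM t s (\<lambda>_. 1)
          = - ((\<phi> (t + r) (vaxis s) - \<phi> t (vaxis s)) + (\<phi> (t + r) (vaxis (- s)) - \<phi> t (vaxis (- s)))) / 2"
        unfolding e[OF tr(1)] e[OF t(1)] by (simp add: field_simps)
      have "norm (vaxis s) \<le> 1" "norm (vaxis (- s)) \<le> 1" using s by (simp_all add: norm_Pair norm_mult)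
      then have "norm ((\<phi> (t + r) (vaxis s) - \<phi> t (vaxis s)) + (\<phi> (t + r) (vaxis (- s)) - \<phi> t (vaxis (- s)))) \<le> C * r + C * r"
        by (intro norm_triangle_mono phi snd_axis_in_U)
      then show ?thesis unfolding eq norm_divide norm_minus_cancel by simp
    qed
    define J where "J t' s = (LINT \<xi>|m t'. ?k (snd \<xi>) * (1 - cos (s * (1 * snd \<xi>))))" for t' s
    have Jdiff: "\<bar>J (t + r) s - J t s\<bar> \<le> 21 * C * r" if s: "0 \<le> s" "s \<le> 1" for s
    proof -
      have "SM t' s (\<lambda>x. of_real (?k x)) = of_real (J t' s)" if "t' \<ge> 0" for t'
        using levy_khintchine.smoothed_real[OF LK[OF that], of ?k s] k0 by (simp add: J_def)
      then have "norm (complex_of_real (J (t + r) s) - of_real (J t s)) \<le> (20 + 1) * norm (SM (t + r) s (\<lambda>_. 1) - SM t s (\<lambda>_. 1))"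
        using smoothed_increment[OF t(1) r continuous_trunc_ratio trunc_ratio_bound, of s] t tr by simp
      also have "\<dots> \<le> 21 * (C * r)" using one[OF s] by simp
      finally show ?thesis by (simp flip: of_real_diff)
    qed
    have sw: "integrable unit_unif (J t')" "(LINT s|unit_unif. J t' s) = (LINT \<xi>|m t'. ?k (snd \<xi>) * wt (snd \<xi>))" if "t' \<ge> 0" for t'
      using levy_khintchine.integrable_integral_cos[OF LK[OF that] km trunc_ratio_bound, of 1]
        levy_khintchine.integral_cos_swap[OF LK[OF that] km trunc_ratio_bound, of 1]
      by (simp_all add: J_def[abs_def])
    have "\<bar>(LINT s|unit_unif. J (t + r) s) - (LINT s|unit_unif. J t s)\<bar> = \<bar>LINT s|unit_unif. J (t + r) s - J t s\<bar>"
      using sw(1) t tr by (simp add: Bochner_Integration.integral_diff)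
    also have "\<dots> \<le> (LINT s|unit_unif. 21 * C * r)"
    proof (rule order_trans[OF integral_abs_bound], rule integral_mono)
      show "integrable unit_unif (\<lambda>s. \<bar>J (t + r) s - J t s\<bar>)"
        using sw(1) t tr by (intro integrable_abs Bochner_Integration.integrable_diff) auto
      show "\<bar>J (t + r) s - J t s\<bar> \<le> 21 * C * r" if "s \<in> space unit_unif" for s
        using that by (intro Jdiff) (auto simp: space_restrict_space)
    qed simp
    also have "\<dots> = 21 * C * r" using unit_unif.prob_space by simp
    finally have A: "\<bar>(LINT s|unit_unif. J (t + r) s) - (LINT s|unit_unif. J t s)\<bar> \<le> 21 * C * r" .
    have iU: "(0, \<i>) \<in> U" "norm (0 :: complex, \<i>) \<le> 1" by (simp_all add: in_U_iff norm_Pair)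
    have "b2 (t + r) - b2 t = Im (\<phi> (t + r) (0, \<i>) - \<phi> t (0, \<i>)) + ((LINT s|unit_unif. J (t + r) s) - (LINT s|unit_unif. J t s))"
      using levy_khintchine.b2_eq[OF LK[OF tr(1)], of "b2 (t + r)"] levy_khintchine.b2_eq[OF LK[OF t(1)], of "b2 t"] sw(2) t tr by simp
    moreover have "\<bar>Im (\<phi> (t + r) (0, \<i>) - \<phi> t (0, \<i>))\<bar> \<le> C * r"
      using abs_Im_le_cmod phi[OF iU] order_trans by blast
    ultimately show ?thesis using A by (simp add: distrib_right)
  qed
  show ?thesis using main C(1) by (intro exI[of _ "C + 21 * C"]) auto
qed

lemma b2_abs_continuous: "abs_continuous_on_halfline b2"
  unfolding abs_continuous_on_halfline_def abs_continuous_on_interval_def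
proof (intro allI impI)
  fix S \<epsilon> :: real assume S: "0 \<le> S" and \<epsilon>: "0 < \<epsilon>"
  obtain C where C: "C \<ge> 0" "\<And>t r. 0 \<le> t \<Longrightarrow> t \<le> S \<Longrightarrow> 0 < r \<Longrightarrow> r \<le> T \<Longrightarrow> \<bar>b2 (t + r) - b2 t\<bar> \<le> C * r"
    using b2_increment[OF S] by blast
  \<comment> \<open>The local Lipschitz bound holds for spans up to \<open>T\<close> only; a total
    length below \<open>T\<close> forces this on each interval. The denominator C + 1 covers C = 0
    and makes the final inequality strict.\<close>
  define \<delta> where "\<delta> = min T (\<epsilon> / (C + 1))"
  have \<delta>: "\<delta> > 0" "\<delta> \<le> T" "(C + 1) * \<delta> \<le> \<epsilon>"
  proof -
    show "\<delta> > 0" "\<delta> \<le> T" using T_pos \<epsilon> C(1) by (simp_all add: \<delta>_def)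
    have "(C + 1) * \<delta> \<le> (C + 1) * (\<epsilon> / (C + 1))"
      using C(1) by (intro mult_left_mono) (simp_all add: \<delta>_def)
    then show "(C + 1) * \<delta> \<le> \<epsilon>" using C(1) by simp
  qed
  show "\<exists>\<delta>>0. \<forall>d. d division_of \<Union>d \<and> \<Union>d \<subseteq> {0..S} \<and> (\<Sum>K\<in>d. Sup K - Inf K) < \<delta>
      \<longrightarrow> (\<Sum>K\<in>d. \<bar>b2 (Sup K) - b2 (Inf K)\<bar>) < \<epsilon>"
  proof (intro exI[of _ \<delta>] conjI allI impI \<delta>(1))
    fix d assume "d division_of \<Union>d \<and> \<Union>d \<subseteq> {0..S} \<and> (\<Sum>K\<in>d. Sup K - Inf K) < \<delta>"
    then have d: "d division_of \<Union>d" "\<Union>d \<subseteq> {0..S}" "(\<Sum>K\<in>d. Sup K - Inf K) < \<delta>" by auto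
    have fin: "finite d" using d(1) by (rule division_of_finite)
    have K: "0 \<le> Inf K" "Inf K \<le> Sup K" "Sup K \<le> S" if Kd: "K \<in> d" for K
    proof -
      obtain x y where xy: "K = {x..y}" "K \<noteq> {}"
        using division_ofD(3)[OF d(1) Kd] division_ofD(4)[OF d(1) Kd] by (metis cbox_interval)
      have "x \<in> K" "y \<in> K" using xy by auto
      then have "x \<in> {0..S}" "y \<in> {0..S}" using d(2) Kd by blast+
      then show "0 \<le> Inf K" "Inf K \<le> Sup K" "Sup K \<le> S" using xy by auto
    qed
    have "\<bar>b2 (Sup K) - b2 (Inf K)\<bar> \<le> C * (Sup K - Inf K)" if Kd: "K \<in> d" for K
    proof (cases "Inf K = Sup K")
      case False
      have "Sup K - Inf K \<le> (\<Sum>K\<in>d. Sup K - Inf K)"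
        using K(2) fin Kd by (intro member_le_sum) auto
      then have "Sup K - Inf K \<le> T" using d(3) \<delta>(2) by linarith
      then show ?thesis using C(2)[of "Inf K" "Sup K - Inf K"] K[OF Kd] False by simp
    qed simp
    then have "(\<Sum>K\<in>d. \<bar>b2 (Sup K) - b2 (Inf K)\<bar>) \<le> (\<Sum>K\<in>d. C * (Sup K - Inf K))"
      by (rule sum_mono)
    also have "\<dots> = C * (\<Sum>K\<in>d. Sup K - Inf K)" by (rule sum_distrib_left[symmetric])
    also have "\<dots> \<le> C * \<delta>" using C(1) d(3) by (intro mult_left_mono) auto
    also have "\<dots> < (C + 1) * \<delta>" using \<delta>(1) by simp
    finally show "(\<Sum>K\<in>d. \<bar>b2 (Sup K) - b2 (Inf K)\<bar>) < \<epsilon>" using \<delta>(3) by linarith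
  qed
qed

end

section \<open>The characterization of regularity\<close>

context sc_semigroup_short
begin

text \<open>The exponent of the \<open>N' k\<close>-fold power of \<open>\<gamma> (h k)\<close> is
  \<open>N' k * \<phi> (h k)\<close>, and \<open>N' k * h k\<close> = 1 / n turns it into the
  quotient \<phi> / h divided by n. Equicontinuity at 0 of these quotients is what
  \<open>prob_D_limit\<close> requires.\<close>

lemma root_exists:
  assumes n: "n \<ge> (1::nat)"
  shows "\<exists>\<mu>\<in>prob_D. \<forall>u\<in>U. char_fun \<mu> u = exp (F u / of_nat n)"
proof -
  obtain k0 :: nat where k0: "1 / T < real k0" using reals_Archimedean2 by blast
  \<comment> \<open>The shift by \<open>k0\<close> keeps all times \<open>h k\<close> below
    \<open>T\<close>, where the equicontinuity estimates hold.\<close>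
  define N' where "N' k = k + k0 + 1" for k
  define h where "h k = 1 / (real n * real (N' k))" for k
  have N': "real (N' k) > 0" for k by (simp add: N'_def)
  have Nh: "real (N' k) * h k = 1 / real n" for k
    using N'[of k] n by (simp add: h_def)
  have h: "0 < h k" "h k \<le> T" for k
  proof -
    show "0 < h k" using N'[of k] n by (simp add: h_def)
    have "1 / T \<le> real (N' k)" using k0 by (simp add: N'_def)
    also have "\<dots> \<le> real n * real (N' k)" using n N'[of k] by simp
    finally have "1 / (real n * real (N' k)) \<le> 1 / (1 / T)"
      using T_pos by (intro divide_left_mono mult_pos_pos divide_pos_pos) (use n N'[of k] in auto)
    then show "h k \<le> T" by (simp add: h_def)
  qed
  have h0: "h \<longlonglongrightarrow> 0"
  proof (rule tendsto_sandwich[OF _ _ tendsto_const])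
    show "\<forall>\<^sub>F k in sequentially. 0 \<le> h k" using h(1) by (intro always_eventually allI less_imp_le)
    show "\<forall>\<^sub>F k in sequentially. h k \<le> 1 / real (Suc k)"
    proof (intro always_eventually allI)
      fix k
      have "real (Suc k) \<le> real (N' k)" by (simp add: N'_def)
      also have "\<dots> \<le> real n * real (N' k)" using n N'[of k] by simp
      finally show "h k \<le> 1 / real (Suc k)"
        unfolding h_def using N'[of k] n by (intro divide_left_mono) auto
    qed
    show "(\<lambda>k. 1 / real (Suc k)) \<longlonglongrightarrow> 0" by (rule LIMSEQ_Suc[OF lim_1_over_n])
  qed
  define \<rho> where "\<rho> k = conv_power (\<gamma> (h k)) (N' k)" for k
  have hk: "0 \<le> h k" for k using h(1)[of k] by simp
  have \<rho>: "\<rho> k \<in> prob_D" for k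
    unfolding \<rho>_def by (intro conv_power_in_prob_D gamma_prob hk)
  have cf: "char_fun (\<rho> k) u = exp (of_nat (N' k) * \<phi> (h k) u)" if u: "u \<in> U" for k u
    using char_fun_conv_power[OF gamma_prob[OF hk] u, of k "N' k"] char_fun_\<gamma>[OF hk u, of k]
    by (simp only: \<rho>_def exp_of_nat_mult)
  show ?thesis
  proof (rule prob_D_limit[OF \<rho>])
    fix u assume u: "u \<in> U"
    have "of_nat (N' k) * \<phi> (h k) u = (\<phi> (h k) u / of_real (h k)) / of_nat n" for k
    proof -
      have "real (N' k) = 1 / real n / h k"
        unfolding Nh[of k, symmetric] using h(1)[of k] by simp
      then have "complex_of_real (real (N' k)) = of_real (1 / real n / h k)" by (rule arg_cong)
      then show ?thesis by simp
    qed
    moreover have "(\<lambda>k. (\<phi> (h k) u / of_real (h k)) / of_nat n) \<longlonglongrightarrow> F u / of_nat n"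
      using n by (intro tendsto_divide F_tendsto[OF u h(1) h0] tendsto_const) simp
    ultimately have "(\<lambda>k. of_nat (N' k) * \<phi> (h k) u) \<longlonglongrightarrow> F u / of_nat n" by simp
    then show "(\<lambda>k. char_fun (\<rho> k) u) \<longlonglongrightarrow> exp (F u / of_nat n)"
      unfolding cf[OF u] by (rule tendsto_exp)
  next
    fix \<eta> :: real assume \<eta>: "\<eta> > 0"
    obtain \<delta> where \<delta>: "\<delta> > 0" "\<And>r u. 0 < r \<Longrightarrow> r \<le> T \<Longrightarrow> u \<in> U \<Longrightarrow> norm u \<le> \<delta> \<Longrightarrow> norm (\<phi> r u) \<le> \<eta> * r"
      using phi_equicontinuous_zero[OF \<eta>] by blast
    have "norm (char_fun (\<rho> k) u - 1) \<le> \<eta>" if u: "u \<in> U" "norm u \<le> \<delta>" for k u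
    proof -
      let ?w = "of_nat (N' k) * \<phi> (h k) u"
      have "0 \<le> - Re (\<phi> (h k) u)"
        using N_nonneg[OF hk[of k] u(1)] unfolding levy_khintchine.nrm_def[OF LK[OF hk]] .
      then have "Re ?w \<le> 0" by (simp add: mult_nonneg_nonpos)
      then have "norm (exp ?w - exp 0) \<le> norm (?w - 0)" by (intro norm_exp_diff_le) auto
      also have "\<dots> = real (N' k) * norm (\<phi> (h k) u)" by (simp add: norm_mult)
      also have "\<dots> \<le> real (N' k) * (\<eta> * h k)"
        using \<delta>(2)[OF h u] N'[of k] by (intro mult_left_mono) auto
      also have "\<dots> = \<eta> * (real (N' k) * h k)" by (rule mult.left_commute)
      also have "\<dots> \<le> \<eta> * 1" unfolding Nh using \<eta> n by (intro mult_left_mono) auto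
      finally show ?thesis unfolding cf[OF u(1)] by simp
    qed
    then show "\<exists>\<delta>>0. \<forall>k. \<forall>u\<in>U. norm u \<le> \<delta> \<longrightarrow> norm (char_fun (\<rho> k) u - 1) \<le> \<eta>"
      using \<delta>(1) by blast
  qed
qed

text \<open>The case n = 1 of \<open>root_exists\<close> yields \<open>\<nu>\<close>. For general n
  the n-th convolution power of the root has the same characteristic function, hence equals
  \<open>\<nu>\<close> by uniqueness.\<close>

lemma regular_SC: "regular_SC_semigroup \<psi> \<gamma>"
proof -
  obtain \<nu> where \<nu>: "\<nu> \<in> prob_D" "\<And>u. u \<in> U \<Longrightarrow> char_fun \<nu> u = exp (F u)"
    using root_exists[of 1] by auto
  have inf_div: "infinitely_divisible \<nu>"
    unfolding infinitely_divisible_def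
  proof (intro conjI allI impI \<nu>(1))
    fix n :: nat assume n: "1 \<le> n"
    then obtain \<mu> where \<mu>: "\<mu> \<in> prob_D" "\<And>u. u \<in> U \<Longrightarrow> char_fun \<mu> u = exp (F u / of_nat n)"
      using root_exists by blast
    have "conv_power \<mu> n = \<nu>"
    proof (rule prob_D_eq_of_char_fun[OF conv_power_in_prob_D(1)[OF \<mu>(1)] \<nu>(1)])
      fix u assume u: "u \<in> U"
      have "char_fun (conv_power \<mu> n) u = exp (of_nat n * (F u / of_nat n))"
        unfolding exp_of_nat_mult char_fun_conv_power[OF \<mu>(1) u] \<mu>(2)[OF u] ..
      also have "\<dots> = char_fun \<nu> u" using \<nu>(2)[OF u] n by simp
      finally show "char_fun (conv_power \<mu> n) u = char_fun \<nu> u" .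
    qed
    then show "\<exists>\<mu>\<in>prob_D. conv_power \<mu> n = \<nu>" using \<mu>(1) by blast
  qed
  have log_\<nu>: "is_log_char_fun \<nu> F"
    unfolding is_log_char_fun_def using continuous_on_F F_0 \<nu>(2) by simp
  have log_\<gamma>: "is_log_char_fun (\<gamma> t) (\<phi> t)" if "t \<ge> 0" for t
    unfolding is_log_char_fun_def using continuous_on_phi[OF that] phi_t_0[OF that] char_fun_\<gamma>[OF that] by simp
  show ?thesis
    unfolding regular_SC_semigroup_def
    by (intro exI[of _ \<nu>] exI[of _ F] exI[of _ \<phi>] conjI allI impI ballI
          inf_div log_\<nu> log_\<gamma> phi_has_integral)
qed

end

theorem theorem3p1:
  fixes Q :: "real \<Rightarrow> real \<times> real \<Rightarrow> (real \<times> real) measure"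
    and \<psi> :: "real \<Rightarrow> complex \<times> complex \<Rightarrow> complex \<times> complex"
    and \<gamma> :: "real \<Rightarrow> (real \<times> real) measure"
    and \<phi> :: "real \<Rightarrow> complex \<times> complex \<Rightarrow> complex"
    and a b1 b2 :: "real \<Rightarrow> real"
    and m :: "real \<Rightarrow> (real \<times> real) measure"
  assumes "regular_HA_semigroup Q \<psi>"
    and "SC_semigroup Q \<gamma>"
    and "weakly_continuous \<gamma>"
    and "\<And>t u. t \<ge> 0 \<Longrightarrow> u \<in> U \<Longrightarrow> char_fun (\<gamma> t) u = exp (\<phi> t u)"
    and "\<And>t u1 u2. t \<ge> 0 \<Longrightarrow> (u1, u2) \<in> U \<Longrightarrow>
           \<phi> t (u1, u2) = of_real (b1 t) * u1 + of_real (b2 t) * u2 + of_real (a t) * u2\<^sup>2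
             + (LINT \<xi>|m t. exp (pairing (u1, u2) \<xi>) - 1 - u2 * of_real (trunc (snd \<xi>)))"
    and "\<And>t. t \<ge> 0 \<Longrightarrow> a t \<ge> 0"
    and "\<And>t. t \<ge> 0 \<Longrightarrow> (b1 t, b2 t) \<in> D"
    and "\<And>t. t \<ge> 0 \<Longrightarrow> sets (m t) = sets borel_D"
    and "\<And>t. t \<ge> 0 \<Longrightarrow> sigma_finite_measure (m t)"
    and "\<And>t. t \<ge> 0 \<Longrightarrow> emeasure (m t) {0} = 0"
    and "\<And>t. t \<ge> 0 \<Longrightarrow>
           (\<integral>\<^sup>+ \<xi>. ennreal (trunc (fst \<xi>) + (trunc (snd \<xi>))\<^sup>2) \<partial>m t) < \<infinity>"
  shows "regular_SC_semigroup \<psi> \<gamma> \<longleftrightarrow> abs_continuous_on_halfline b2"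
proof -
  have LK: "levy_khintchine (b1 t) (a t) (m t)" if "t \<ge> 0" for t
    using assms(6,8,9,11)[OF that] assms(7)[OF that] by (simp add: levy_khintchine_def in_D_iff)
  have expo: "\<phi> t u = levy_khintchine.expo (b1 t) (b2 t) (a t) (m t) u" if t: "t \<ge> 0" and u: "u \<in> U" for t u
  proof (cases u)
    case (Pair u1 u2)
    then show ?thesis
      using assms(5)[OF t, of u1 u2] u
      by (simp add: levy_khintchine.expo_def[OF LK[OF t]] levy_khintchine.integrand_def[OF LK[OF t]])
  qed
  interpret sc_semigroup Q \<psi> \<gamma> b1 b2 a m
    by (rule sc_semigroup.intro[OF assms(1-3) LK]) (use assms(4) expo in simp_all)
  \<comment> \<open>The tolerance 1/3 on the unit ball is what gives 1/2 \<le> z t \<le> 2 and the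
    lower bound 2/3 for the first axis at l = 1.\<close>
  obtain T where T: "T > 0" "\<forall>t\<in>{0..T}. \<forall>u\<in>U. norm u \<le> 1 \<longrightarrow> norm (\<psi> t u - u) < 1 / 3"
    using psi_near_initial[of "1 / 3" 1] by auto
  interpret sc_semigroup_short Q \<psi> \<gamma> b1 b2 a m T
    by unfold_locales (use T in auto)
  show ?thesis using regular_SC b2_abs_continuous by blast
qed

end
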